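(* Let $\Omega\subset\subset\mathbb{C}^n$ be a smoothly bounded domain and $1\le q\le n$. Suppose there exists a smooth defining function $\rho$ of $\Omega$ such that the sum of any $q$ eigenvalues of $\left(\frac{\partial^2\rho}{\partial z_k\partial\bar z_l}\right)_{k,l=1}^n$ is non-negative on $\overline\Omega$. Let $s\in[0,1)$. Then there exist a smooth defining function $r$ for $\Omega$ and a constant $C>0$ (depending on $s$ but not on $u$) such that $$\int_\Omega(-r)^{-2+s}\left|[\bar\partial^\star,r]u\right|^2\,dV\le C\left\{\bigl((-r)^s\bar\partial u,\bar\partial u\bigr)+\bigl((-r)^s\bar\partial^\star u,\bar\partial^\star u\bigr)\right\}$$ holds for all $u\in\mathcal{D}^{0,q}(\Omega)$.
   Context: A smoothly bounded domain is a bounded domain $\Omega=\{z\in\mathbb{C}^n : r(z)<0\}$ with $r$ a smooth real-valued function (a smooth defining function) satisfying $\nabla r\ne0$ where $r=0$; $b\Omega$ is its boundary. A $(0,q)$-form is written $u=\sum'_{|J|=q}u_J\,d\bar z^J$, where $\sum'$ is the sum over strictly increasing multi-indices, with $u_I$ extended antisymmetrically to all multi-indices $I$ of length $q$; $kJ$ denotes the multi-index $\{k,J\}$. $(u,v)=\int_\Omega\sum'_J u_J\bar v_J\,dV$ and $|u|^2=\sum'_J|u_J|^2$. $\bar\partial^\star$ is the $L^2$ Hilbert space adjoint of $\bar\partial$ (the latter taken with maximal distributional domain). $\mathcal{D}^{0,q}(\Omega)$ is the set of $(0,q)$-forms with coefficients in $C^\infty(\overline\Omega)$ lying in $\mathrm{Dom}(\bar\partial^\star)$,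 equivalently satisfying $\sum_{k=1}^n\frac{\partial r}{\partial z_k}u_{kJ}=0$ on $b\Omega$ for every strictly increasing $J$ of length $q-1$; on it $\bar\partial^\star u=-\sum'_{|J|=q-1}\sum_l\frac{\partial u_{lJ}}{\partial z_l}d\bar z^J$. $[L,M]=LM-ML$, so $[\bar\partial^\star,r]u=-\sum'_{|J|=q-1}\sum_l\frac{\partial r}{\partial z_l}u_{lJ}\,d\bar z^J$. Eigenvalues are counted with multiplicity. *)

theory Defs
  imports "HOL-Analysis.Analysis"
begin

section \<open>Smooth functions\<close>

primrec Ck :: "nat \<Rightarrow> ('a::real_normed_vector \<Rightarrow> 'b::real_normed_vector) \<Rightarrow> bool" where
  "Ck 0 f \<longleftrightarrow> continuous_on UNIV f"
| "Ck (Suc k) f \<longleftrightarrow>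
     (\<forall>x. f differentiable (at x)) \<and> (\<forall>v. Ck k (\<lambda>x. frechet_derivative f (at x) v))"

definition smooth :: "('a::real_normed_vector \<Rightarrow> 'b::real_normed_vector) \<Rightarrow> bool" where
  "smooth f \<longleftrightarrow> (\<forall>k. Ck k f)"

text \<open>The space \<open>C\<^sup>\<infinity>\<close> of the closure of \<open>\<Omega>\<close>: restrictions to the closure of smooth functions
  on the whole space. Values outside the closure are irrelevant.\<close>

definition smooth_up_to_boundary ::
  "'a::real_normed_vector set \<Rightarrow> ('a \<Rightarrow> 'b::real_normed_vector) \<Rightarrow> bool" where
  "smooth_up_to_boundary \<Omega> f \<longleftrightarrow> (\<exists>g. smooth g \<and> (\<forall>z\<in>closure \<Omega>. f z = g z))"

definition test_function :: "'a::real_normed_vector set \<Rightarrow> ('a \<Rightarrow> complex) \<Rightarrow> bool" where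
  "test_function \<Omega> \<phi> \<longleftrightarrow> smooth \<phi> \<and>
     compact (closure {z. \<phi> z \<noteq> 0}) \<and> closure {z. \<phi> z \<noteq> 0} \<subseteq> \<Omega>"

section \<open>Smoothly bounded domains\<close>

definition defining_function ::
  "(complex ^ 'n) set \<Rightarrow> (complex ^ 'n \<Rightarrow> real) \<Rightarrow> bool" where
  "defining_function \<Omega> r \<longleftrightarrow> smooth r \<and> \<Omega> = {z. r z < 0} \<and>
     (\<forall>z. r z = 0 \<longrightarrow> frechet_derivative r (at z) \<noteq> (\<lambda>h. 0))"

definition smoothly_bounded_domain :: "(complex ^ 'n) set \<Rightarrow> bool" where
  "smoothly_bounded_domain \<Omega> \<longleftrightarrow>
     open \<Omega> \<and> connected \<Omega> \<and> \<Omega> \<noteq> {} \<and> bounded \<Omega> \<and> (\<exists>r. defining_function \<Omega> r)"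

section \<open>Wirtinger derivatives and the complex Hessian\<close>

definition d_z :: "'n::finite \<Rightarrow> (complex ^ 'n \<Rightarrow> complex) \<Rightarrow> complex ^ 'n \<Rightarrow> complex" where
  "d_z k f z = (frechet_derivative f (at z) (axis k 1)
                - \<i> * frechet_derivative f (at z) (axis k \<i>)) / 2"

definition d_zbar :: "'n::finite \<Rightarrow> (complex ^ 'n \<Rightarrow> complex) \<Rightarrow> complex ^ 'n \<Rightarrow> complex" where
  "d_zbar k f z = (frechet_derivative f (at z) (axis k 1)
                   + \<i> * frechet_derivative f (at z) (axis k \<i>)) / 2"

definition complex_hessian ::
  "(complex ^ 'n::finite \<Rightarrow> real) \<Rightarrow> complex ^ 'n \<Rightarrow> complex ^ 'n ^ 'n" where
  "complex_hessian \<rho> z = (\<chi> k l. d_z k (d_zbar l (\<lambda>w. complex_of_real (\<rho> w))) z)"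

text \<open>The family \<open>\<mu>\<close> lists the eigenvalues of \<open>A\<close> with algebraic multiplicity, as the roots of
  the characteristic polynomial. Such a family always exists and is unique up to reordering.\<close>

definition eigenvalue_family :: "complex ^ 'n ^ 'n::finite \<Rightarrow> ('n \<Rightarrow> complex) \<Rightarrow> bool" where
  "eigenvalue_family A \<mu> \<longleftrightarrow> (\<forall>x. det (mat x - A) = (\<Prod>i\<in>UNIV. x - \<mu> i))"

definition any_q_eigenvalues_sum_nonneg :: "nat \<Rightarrow> complex ^ 'n ^ 'n::finite \<Rightarrow> bool" where
  "any_q_eigenvalues_sum_nonneg q A \<longleftrightarrow>
     (\<forall>\<mu> I. eigenvalue_family A \<mu> \<longrightarrow> card I = q \<longrightarrow> (\<Sum>i\<in>I. \<mu> i) \<in> \<real>\<^sub>\<ge>\<^sub>0)"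

section \<open>\<open>(0,q)\<close>-forms\<close>

text \<open>The coordinates are indexed by a finite linearly ordered type \<open>'n\<close>. A \<open>(0,q)\<close>-form is the
  family of its coefficients \<open>u\<^sub>J\<close>; only the strictly increasing \<open>J\<close> of length \<open>q\<close> are ever used,
  so the values at all other lists are irrelevant. The antisymmetric extension of the
  coefficients to arbitrary multi-indices enters only the coordinate formula for the adjoint of
  \<open>dbar\<close>, which is not needed below because the adjoint is defined in the Hilbert space sense.\<close>

type_synonym 'n form = "'n list \<Rightarrow> complex ^ 'n \<Rightarrow> complex"

definition increasing :: "nat \<Rightarrow> 'n::{finite,linorder} list set" where
  "increasing q = {J. length J = q \<and> sorted_wrt (<) J}"

abbreviation omit :: "nat \<Rightarrow> 'a list \<Rightarrow> 'a list" where
  "omit i K \<equiv> take i K @ drop (Suc i) K"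

text \<open>Moving the differential with index \<open>K ! i\<close> from the front to its place in the increasing
  multi-index \<open>K\<close> costs the sign \<open>(-1)\<^sup>i\<close>.\<close>

definition dbar :: "'n::{finite,linorder} form \<Rightarrow> 'n form" where
  "dbar u = (\<lambda>K z. \<Sum>i<length K. (-1) ^ i * d_zbar (K ! i) (u (omit i K)) z)"

section \<open>The \<open>L\<^sup>2\<close> theory\<close>

definition L2_form :: "(complex ^ 'n::{finite,linorder}) set \<Rightarrow> nat \<Rightarrow> 'n form \<Rightarrow> bool" where
  "L2_form \<Omega> q u \<longleftrightarrow> (\<forall>J\<in>increasing q.
     set_borel_measurable lborel \<Omega> (u J) \<and> set_integrable lborel \<Omega> (\<lambda>z. (cmod (u J z))\<^sup>2))"

definition form_norm_sq ::
  "nat \<Rightarrow> 'n form \<Rightarrow> complex ^ 'n::{finite,linorder} \<Rightarrow> real" where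
  "form_norm_sq q u z = (\<Sum>J\<in>increasing q. (cmod (u J z))\<^sup>2)"

definition L2_inner ::
  "(complex ^ 'n::{finite,linorder}) set \<Rightarrow> nat \<Rightarrow> 'n form \<Rightarrow> 'n form \<Rightarrow> complex" where
  "L2_inner \<Omega> q u v = (LINT z:\<Omega>|lborel. (\<Sum>J\<in>increasing q. u J z * cnj (v J z)))"

text \<open>The graph of \<open>dbar\<close> on \<open>L\<^sup>2\<close> \<open>(0,q)\<close>-forms with its maximal distributional domain.\<close>

definition weak_dbar ::
  "(complex ^ 'n::{finite,linorder}) set \<Rightarrow> nat \<Rightarrow> 'n form \<Rightarrow> 'n form \<Rightarrow> bool" where
  "weak_dbar \<Omega> q f g \<longleftrightarrow> L2_form \<Omega> q f \<and> L2_form \<Omega> (Suc q) g \<and>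
     (\<forall>K\<in>increasing (Suc q). \<forall>\<phi>. test_function \<Omega> \<phi> \<longrightarrow>
        (LINT z:\<Omega>|lborel. g K z * \<phi> z) =
        - (LINT z:\<Omega>|lborel. (\<Sum>i<Suc q. (-1) ^ i * f (omit i K) z * d_zbar (K ! i) \<phi> z)))"

text \<open>The graph of the Hilbert space adjoint of \<open>dbar\<close> on \<open>(0,q)\<close>-forms, \<open>q \<ge> 1\<close>.\<close>

definition is_dbar_star ::
  "(complex ^ 'n::{finite,linorder}) set \<Rightarrow> nat \<Rightarrow> 'n form \<Rightarrow> 'n form \<Rightarrow> bool" where
  "is_dbar_star \<Omega> q u v \<longleftrightarrow> L2_form \<Omega> q u \<and> L2_form \<Omega> (q - 1) v \<and>
     (\<forall>f g. weak_dbar \<Omega> (q - 1) f g \<longrightarrow> L2_inner \<Omega> q g u = L2_inner \<Omega> (q - 1) f v)"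

definition dom_dbar_star ::
  "(complex ^ 'n::{finite,linorder}) set \<Rightarrow> nat \<Rightarrow> 'n form set" where
  "dom_dbar_star \<Omega> q = {u. \<exists>v. is_dbar_star \<Omega> q u v}"

text \<open>For \<open>u\<close> in the domain, \<open>dbar_star \<Omega> q u\<close> is a representative of a class of forms that is
  determined up to equality almost everywhere on \<open>\<Omega>\<close>; use it only below integrals.\<close>

definition dbar_star ::
  "(complex ^ 'n::{finite,linorder}) set \<Rightarrow> nat \<Rightarrow> 'n form \<Rightarrow> 'n form" where
  "dbar_star \<Omega> q u = (SOME v. is_dbar_star \<Omega> q u v)"

definition D_forms ::
  "(complex ^ 'n::{finite,linorder}) set \<Rightarrow> nat \<Rightarrow> 'n form set" where
  "D_forms \<Omega> q = {u. (\<forall>J\<in>increasing q. smooth_up_to_boundary \<Omega> (u J)) \<and> u \<in> dom_dbar_star \<Omega> q}"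

definition mult_form :: "(complex ^ 'n::{finite,linorder} \<Rightarrow> real) \<Rightarrow> 'n form \<Rightarrow> 'n form" where
  "mult_form h u = (\<lambda>J z. complex_of_real (h z) * u J z)"

text \<open>The commutator of \<open>dbar_star\<close> with multiplication by \<open>r\<close>. It is applied only to
  \<open>u \<in> D_forms \<Omega> q\<close> with \<open>r\<close> smooth, and then \<open>r u \<in> D_forms \<Omega> q\<close> as well.\<close>

definition dbar_star_commutator ::
  "(complex ^ 'n::{finite,linorder}) set \<Rightarrow> nat \<Rightarrow> (complex ^ 'n::{finite,linorder} \<Rightarrow> real) \<Rightarrow>
     'n form \<Rightarrow> 'n form" where
  "dbar_star_commutator \<Omega> q r u =
     (\<lambda>J z. dbar_star \<Omega> q (mult_form r u) J z - mult_form r (dbar_star \<Omega> q u) J z)"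

end

theory Submission
  imports Defs
begin

text \<open>
  The function \<open>r = \<rho>\<close> itself works. Write \<open>v = \<Sum>\<^sub>k (\<partial>\<rho>/\<partial>z\<^sub>k) u\<^sub>k\<close> for the normal part of \<open>u\<close>; up to sign it is the
  commutator applied to \<open>u\<close>. Testing the adjoint relation with the form \<open>\<Sum>\<^sub>j \<partial>(a u\<^sub>j)/\<partial>z\<^sub>j\<close>, where \<open>a\<close> vanishes
  on the boundary, gives a twisted Kohn--Morrey--Hoermander identity without boundary terms, in which the
  complex Hessian of \<open>a\<close> appears with a negative sign. For \<open>s > 0\<close> take \<open>a = (\<epsilon> - \<rho>)\<^sup>s - \<epsilon>\<^sup>s\<close> and let \<open>\<epsilon>\<close> tend
  to \<open>0\<close>: the Hessian of \<open>- a\<close> contributes the Levi term, which is nonnegative by the assumption on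
  eigenvalues, and \<open>s (1 - s) (-\<rho>)\<^bsup>s - 2\<^esup> |v|\<^sup>2\<close>, which absorbs the cross term.
  This degenerates at \<open>s = 0\<close>. There the choice \<open>a = (1 - exp (\<rho>/\<epsilon>)) (M - |z|\<^sup>2)\<close> bounds \<open>u\<close> and all its
  derivatives with respect to the conjugate variables; as \<open>v\<close> vanishes on the boundary, its full gradient is
  then bounded as well, and Hardy's inequality applies to \<open>v\<close>.
\<close>

text \<open>Membership in the domain of the adjoint is known only through duality, which gives no
  pointwise boundary condition on u. A weight that vanishes on the boundary removes the boundary
  terms of one integration by parts, and duality itself performs the other. The parameter \<epsilon>
  is there because (-\<rho>)^s is not C1 up to the boundary. All constants are independent of
  \<epsilon>, and Fatou's lemma yields integrability and the bound together. For s > 0 one half of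
  the coefficient s (1 - s) pays for the cross term and the other half survives, so the constant
  grows like 1/s and s = 0 is no limit of the other cases. There the profile 1 -
  exp(\<rho>/\<epsilon>) has second derivative of size 1/\<epsilon>^2 in a boundary layer, enough to
  absorb cross terms of size 1/\<epsilon>; the remaining errors vanish with the layer. The concave
  factor M - |z|^2 produces the term in |u|^2. The condition v = 0 on the boundary, which Hardy's
  inequality requires, is recovered from the adjoint relation by localised test forms.\<close>

abbreviation dir_deriv :: "'a::real_normed_vector \<Rightarrow> ('a \<Rightarrow> 'b::real_normed_vector) \<Rightarrow> 'a \<Rightarrow> 'b" where
  "dir_deriv v f \<equiv> (\<lambda>x. frechet_derivative f (at x) v)"

lemma dir_deriv_eqI: "(f has_derivative f') (at x) \<Longrightarrow> dir_deriv v f x = f' v"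
  using frechet_derivative_at by metis

text \<open>\<open>frechet_derivative\<close> is a choice among all derivatives. Two functions with
  the same germ have the same set of derivatives, so the choices coincide, at points of
  non-differentiability as well.\<close>

lemma dir_deriv_cong:
  assumes "open U" "x \<in> U" "\<And>y. y \<in> U \<Longrightarrow> f y = g y"
  shows "dir_deriv v f x = dir_deriv v g x"
proof -
  have "(f has_derivative f') (at x) \<longleftrightarrow> (g has_derivative f') (at x)" for f'
    using has_derivative_transform_within_open[of f f' x UNIV U g]
      has_derivative_transform_within_open[of g f' x UNIV U f] assms by auto
  then show ?thesis by (simp add: frechet_derivative_def)
qed

lemma differentiable_cong:
  assumes "open U" "x \<in> U" "\<And>y. y \<in> U \<Longrightarrow> f y = g y" "f differentiable (at x)"
  shows "g differentiable (at x)"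
  using assms has_derivative_transform_within_open[of f _ x UNIV U g]
  unfolding differentiable_def by blast

lemma dir_deriv_add:
  assumes "f differentiable (at x)" "g differentiable (at x)"
  shows "dir_deriv v (\<lambda>x. f x + g x) x = dir_deriv v f x + dir_deriv v g x"
  using assms by (intro dir_deriv_eqI) (auto intro!: has_derivative_add simp: frechet_derivative_works[symmetric])

lemma dir_deriv_mult:
  fixes f g :: "'a::real_normed_vector \<Rightarrow> 'b::real_normed_algebra"
  assumes "f differentiable (at x)" "g differentiable (at x)"
  shows "dir_deriv v (\<lambda>x. f x * g x) x = f x * dir_deriv v g x + dir_deriv v f x * g x"
  using assms
  by (intro dir_deriv_eqI[where f'="\<lambda>h. f x * dir_deriv h g x + dir_deriv h f x * g x"] has_derivative_mult)
     (auto simp: frechet_derivative_works[symmetric])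

lemma dir_deriv_bounded_linear:
  assumes "bounded_linear T" "f differentiable (at x)"
  shows "dir_deriv v (\<lambda>x. T (f x)) x = T (dir_deriv v f x)"
  using bounded_linear.has_derivative[OF assms(1), of f _ "at x"] assms(2)
  by (intro dir_deriv_eqI) (auto simp: frechet_derivative_works[symmetric])

lemma differentiable_bounded_linear:
  assumes "bounded_linear T" "f differentiable (at x)"
  shows "(\<lambda>x. T (f x)) differentiable (at x)"
  using bounded_linear.has_derivative[OF assms(1), of f _ "at x"] assms(2)
  unfolding differentiable_def by blast

lemma dir_deriv_real_comp:
  assumes "f differentiable (at x)" "(h has_real_derivative h') (at (f x))"
  shows "dir_deriv v (\<lambda>x. h (f x)) x = h' * dir_deriv v f x"
    and "(\<lambda>x. h (f x)) differentiable (at x)"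
proof -
  have "((\<lambda>x. h (f x)) has_derivative (\<lambda>v. h' * dir_deriv v f x)) (at x)"
    using has_derivative_compose[of f "\<lambda>v. dir_deriv v f x" x UNIV h "(*) h'"] assms
    by (auto simp: frechet_derivative_works[symmetric] has_field_derivative_def)
  then show "dir_deriv v (\<lambda>x. h (f x)) x = h' * dir_deriv v f x"
    "(\<lambda>x. h (f x)) differentiable (at x)"
    by (auto intro: dir_deriv_eqI simp: differentiable_def)
qed

section \<open>Smooth and continuously differentiable functions\<close>

lemma Ck_Suc_imp: "Ck (Suc k) f \<Longrightarrow> Ck k f"
proof (induction k arbitrary: f)
  case 0
  then show ?case
    by (auto intro!: differentiable_imp_continuous_on simp: differentiable_on_def)
next
  case (Suc k)
  then show ?case by (metis Ck.simps(2))
qed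

text \<open>Removes the order counter from \<open>smooth\<close>. For the converse the assumption
  yields the orders \<open>Suc k\<close> directly; \<open>Ck_Suc_imp\<close> brings them down to all
  orders.\<close>

lemma smooth_iff: "smooth f \<longleftrightarrow> (\<forall>x. f differentiable (at x)) \<and> (\<forall>v. smooth (dir_deriv v f))"
proof
  assume "smooth f"
  then have *: "Ck (Suc k) f" for k by (auto simp only: smooth_def)
  show "(\<forall>x. f differentiable (at x)) \<and> (\<forall>v. smooth (dir_deriv v f))"
    using * unfolding smooth_def Ck.simps by blast
next
  assume "(\<forall>x. f differentiable (at x)) \<and> (\<forall>v. smooth (dir_deriv v f))"
  then have "Ck (Suc k) f" for k by (auto simp: smooth_def)
  then show "smooth f" unfolding smooth_def using Ck_Suc_imp by blast
qed

lemma smooth_differentiable: "smooth f \<Longrightarrow> f differentiable (at x)"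
  using smooth_iff by blast

lemma smooth_dir_deriv: "smooth f \<Longrightarrow> smooth (dir_deriv v f)"
  using smooth_iff by blast

lemma smooth_continuous_on: "smooth f \<Longrightarrow> continuous_on U f"
  unfolding smooth_def using Ck.simps(1) continuous_on_subset by blast

lemma Ck_const: "Ck k (\<lambda>x. c)"
  by (induction k arbitrary: c) auto

lemma Ck_add: "Ck k f \<Longrightarrow> Ck k g \<Longrightarrow> Ck k (\<lambda>x. f x + g x)"
  by (induction k arbitrary: f g) (auto intro: continuous_intros simp: dir_deriv_add)

lemma Ck_mult:
  fixes f g :: "'a::real_normed_vector \<Rightarrow> 'b::real_normed_algebra"
  shows "Ck k f \<Longrightarrow> Ck k g \<Longrightarrow> Ck k (\<lambda>x. f x * g x)"
proof (induction k arbitrary: f g)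
  case 0
  then show ?case by (auto intro: continuous_intros)
next
  case (Suc k)
  have "Ck k f" "Ck k g" using Suc.prems Ck_Suc_imp by auto
  then show ?case using Suc.prems by (auto simp: dir_deriv_mult intro!: Ck_add Suc.IH)
qed

lemma Ck_bounded_linear: "bounded_linear T \<Longrightarrow> Ck k f \<Longrightarrow> Ck k (\<lambda>x. T (f x))"
  by (induction k arbitrary: f)
     (auto simp: dir_deriv_bounded_linear bounded_linear.continuous_on differentiable_bounded_linear)

lemma smooth_const [intro]: "smooth (\<lambda>x. c)"
  by (simp add: smooth_def Ck_const)

lemma smooth_add: "smooth f \<Longrightarrow> smooth g \<Longrightarrow> smooth (\<lambda>x. f x + g x)"
  by (simp add: smooth_def Ck_add)

lemma smooth_mult:
  fixes f g :: "'a::real_normed_vector \<Rightarrow> 'b::real_normed_algebra"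
  shows "smooth f \<Longrightarrow> smooth g \<Longrightarrow> smooth (\<lambda>x. f x * g x)"
  by (simp add: smooth_def Ck_mult)

lemma smooth_bounded_linear: "bounded_linear T \<Longrightarrow> smooth f \<Longrightarrow> smooth (\<lambda>x. T (f x))"
  by (simp add: smooth_def Ck_bounded_linear)

lemma smooth_sum: "(\<And>i. i \<in> I \<Longrightarrow> smooth (f i)) \<Longrightarrow> smooth (\<lambda>x. \<Sum>i\<in>I. f i x)"
  by (induction I rule: infinite_finite_induct) (auto intro: smooth_add)

lemma smooth_linear:
  assumes "bounded_linear T" shows "smooth T"
  unfolding smooth_iff[of T]
proof (intro conjI allI)
  show "T differentiable (at x)" for x
    using assms bounded_linear_imp_has_derivative differentiable_def by blast
  have "dir_deriv v T = (\<lambda>x. T v)" for v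
    using dir_deriv_eqI[OF bounded_linear_imp_has_derivative[OF assms]] by auto
  then show "smooth (dir_deriv v T)" for v by auto
qed

text \<open>Weights such as (\<epsilon> - \<rho>)^s are differentiable only near the closure of the
  domain, so global smoothness would ask too much. The derivatives are full derivatives at the
  points of \<open>U\<close>, not derivatives within \<open>U\<close>.\<close>

definition C1_on :: "'a::real_normed_vector set \<Rightarrow> ('a \<Rightarrow> 'b::real_normed_vector) \<Rightarrow> bool" where
  "C1_on U f \<longleftrightarrow> (\<forall>x\<in>U. f differentiable (at x)) \<and> (\<forall>v. continuous_on U (dir_deriv v f))"

lemma C1_onD:
  assumes "C1_on U f"
  shows "x \<in> U \<Longrightarrow> f differentiable (at x)" "continuous_on U (dir_deriv v f)" "continuous_on U f"
  using assms unfolding C1_on_def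
  by (auto intro!: differentiable_imp_continuous_on simp: differentiable_on_def differentiable_at_withinI)

lemma C1_on_smooth: "smooth f \<Longrightarrow> C1_on U f"
  using smooth_iff smooth_continuous_on unfolding C1_on_def by blast

lemma C1_on_cong:
  assumes "open U" "\<And>x. x \<in> U \<Longrightarrow> f x = g x" "C1_on U f"
  shows "C1_on U g"
  unfolding C1_on_def
proof (intro conjI ballI allI)
  show "g differentiable (at x)" if "x \<in> U" for x
    using differentiable_cong[OF assms(1) that assms(2)] C1_onD(1)[OF assms(3) that] by auto
  show "continuous_on U (dir_deriv v g)" for v
    using continuous_on_eq[OF C1_onD(2)[OF assms(3)] dir_deriv_cong[OF assms(1) _ assms(2)]] .
qed

lemma C1_on_const: "C1_on U (\<lambda>x. c)"
  by (simp add: C1_on_def)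

lemma C1_on_add: "C1_on U f \<Longrightarrow> C1_on U g \<Longrightarrow> C1_on U (\<lambda>x. f x + g x)"
  unfolding C1_on_def by (auto simp: dir_deriv_add intro!: continuous_intros cong: continuous_on_cong)

lemma C1_on_mult:
  fixes f g :: "'a::real_normed_vector \<Rightarrow> 'b::real_normed_algebra"
  assumes "C1_on U f" "C1_on U g"
  shows "C1_on U (\<lambda>x. f x * g x)"
  using assms C1_onD(3)[OF assms(1)] C1_onD(3)[OF assms(2)]
  unfolding C1_on_def by (auto simp: dir_deriv_mult intro!: continuous_intros cong: continuous_on_cong)

lemma C1_on_bounded_linear: "bounded_linear T \<Longrightarrow> C1_on U f \<Longrightarrow> C1_on U (\<lambda>x. T (f x))"
  unfolding C1_on_def
  by (auto simp: dir_deriv_bounded_linear differentiable_bounded_linear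
      cong: continuous_on_cong intro!: bounded_linear.continuous_on[of T])

lemma C1_on_sum: "(\<And>i. i \<in> I \<Longrightarrow> C1_on U (f i)) \<Longrightarrow> C1_on U (\<lambda>x. \<Sum>i\<in>I. f i x)"
  by (induction I rule: infinite_finite_induct) (auto intro: C1_on_add C1_on_const)

text \<open>The outer function has to be differentiable only on the range set \<open>S\<close>; for
  powers of \<epsilon> - \<rho> this is a half-line.\<close>

lemma C1_on_real_comp:
  assumes "C1_on U f" "\<And>x. x \<in> U \<Longrightarrow> f x \<in> S"
    "\<And>t. t \<in> S \<Longrightarrow> (h has_real_derivative h' t) (at t)" "continuous_on S h'"
  shows "C1_on U (\<lambda>x. h (f x))"
proof -
  have "continuous_on U (\<lambda>x. h' (f x) * dir_deriv v f x)" for v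
    using C1_onD(2,3)[OF assms(1)] assms(2)
    by (auto intro!: continuous_intros continuous_on_compose2[OF assms(4)])
  moreover have "dir_deriv v (\<lambda>x. h (f x)) x = h' (f x) * dir_deriv v f x"
    "(\<lambda>x. h (f x)) differentiable (at x)" if "x \<in> U" for x v
    using dir_deriv_real_comp[OF C1_onD(1)[OF assms(1) that] assms(3)[OF assms(2)[OF that]]] by auto
  ultimately show ?thesis
    unfolding C1_on_def by (auto cong: continuous_on_cong)
qed

section \<open>Symmetry of second derivatives\<close>

lemma mean_value_direction:
  fixes f :: "'a::real_normed_vector \<Rightarrow> real"
  assumes "\<And>x. f differentiable (at x)" "0 < h"
  shows "\<exists>\<xi>. 0 < \<xi> \<and> \<xi> < h \<and> f (x + h *\<^sub>R v) - f x = h * dir_deriv v f (x + \<xi> *\<^sub>R v)"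
proof -
  have d: "((\<lambda>t. f (x + t *\<^sub>R v)) has_real_derivative dir_deriv v f (x + t *\<^sub>R v)) (at t)" for t
  proof -
    have "((\<lambda>t. f (x + t *\<^sub>R v)) has_derivative (\<lambda>s. frechet_derivative f (at (x + t *\<^sub>R v)) (s *\<^sub>R v))) (at t)"
      by (rule has_derivative_compose[of "\<lambda>t. x + t *\<^sub>R v" "\<lambda>s. s *\<^sub>R v" t UNIV f])
        (auto intro!: derivative_eq_intros simp: assms(1) frechet_derivative_works[symmetric])
    moreover have "frechet_derivative f (at (x + t *\<^sub>R v)) (s *\<^sub>R v) = dir_deriv v f (x + t *\<^sub>R v) * s" for s
      using linear_frechet_derivative[OF assms(1)] by (simp add: linear_cmul)
    ultimately show ?thesis by (simp add: has_field_derivative_def)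
  qed
  show ?thesis using MVT2[OF assms(2), of "\<lambda>t. f (x + t *\<^sub>R v)"] d by force
qed

text \<open>The mean value theorem is applied twice: along \<open>v\<close> to the increment of
  \<open>f\<close> in direction \<open>h w\<close>, then along \<open>w\<close> to the directional
  derivative of \<open>f\<close> along \<open>v\<close>.\<close>

lemma second_difference:
  fixes f :: "'a::real_normed_vector \<Rightarrow> real"
  assumes "smooth f" "0 < h"
  shows "\<exists>\<xi> \<eta>. 0 < \<xi> \<and> \<xi> < h \<and> 0 < \<eta> \<and> \<eta> < h \<and>
    f (x + h *\<^sub>R v + h *\<^sub>R w) - f (x + h *\<^sub>R v) - f (x + h *\<^sub>R w) + f x
      = h * h * dir_deriv w (dir_deriv v f) (x + \<xi> *\<^sub>R v + \<eta> *\<^sub>R w)"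
proof -
  let ?g = "\<lambda>y. f (y + h *\<^sub>R w) - f y"
  have sh: "((\<lambda>y. f (y + h *\<^sub>R w)) has_derivative (\<lambda>v. dir_deriv v f (y + h *\<^sub>R w))) (at y)" for y
    by (rule has_derivative_compose[of "\<lambda>y. y + h *\<^sub>R w" "\<lambda>v. v" y UNIV f, simplified])
      (auto intro!: derivative_eq_intros smooth_differentiable assms simp: frechet_derivative_works[symmetric])
  have g: "(?g has_derivative (\<lambda>v. dir_deriv v f (y + h *\<^sub>R w) - dir_deriv v f y)) (at y)" for y
    by (rule has_derivative_diff[OF sh])
      (simp add: frechet_derivative_works[symmetric] smooth_differentiable assms)
  obtain \<xi> where xi: "0 < \<xi>" "\<xi> < h" "?g (x + h *\<^sub>R v) - ?g x = h * dir_deriv v ?g (x + \<xi> *\<^sub>R v)"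
    using mean_value_direction[of ?g h x v] g assms(2) differentiable_def by blast
  obtain \<eta> where eta: "0 < \<eta>" "\<eta> < h"
    "dir_deriv v f (x + \<xi> *\<^sub>R v + h *\<^sub>R w) - dir_deriv v f (x + \<xi> *\<^sub>R v)
      = h * dir_deriv w (dir_deriv v f) (x + \<xi> *\<^sub>R v + \<eta> *\<^sub>R w)"
    using mean_value_direction[of "dir_deriv v f" h "x + \<xi> *\<^sub>R v" w]
      smooth_differentiable[OF smooth_dir_deriv[OF assms(1)]] assms(2) by blast
  have "f (x + h *\<^sub>R v + h *\<^sub>R w) - f (x + h *\<^sub>R v) - f (x + h *\<^sub>R w) + f x = ?g (x + h *\<^sub>R v) - ?g x"
    by simp
  also have "\<dots> = h * (dir_deriv v f (x + \<xi> *\<^sub>R v + h *\<^sub>R w) - dir_deriv v f (x + \<xi> *\<^sub>R v))"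
    using xi(3) dir_deriv_eqI[OF g] by simp
  finally show ?thesis using xi eta by auto
qed

text \<open>Both iterated derivatives are limits of the same second difference quotient
  \<open>Q\<close>, which is symmetric in the two directions.\<close>

lemma dir_deriv_commute_real:
  fixes f :: "'a::real_normed_vector \<Rightarrow> real"
  assumes "smooth f"
  shows "dir_deriv v (dir_deriv w f) x = dir_deriv w (dir_deriv v f) x"
proof -
  define h where "h n = inverse (real (Suc n))" for n
  define Q where "Q v w n = (f (x + h n *\<^sub>R v + h n *\<^sub>R w) - f (x + h n *\<^sub>R v)
         - f (x + h n *\<^sub>R w) + f x) / (h n)^2" for v w n
  have h0: "0 < h n" for n by (simp add: h_def)
  have h_lim: "h \<longlonglongrightarrow> 0"
    using LIMSEQ_inverse_real_of_nat by (simp add: h_def[abs_def])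
  have ex: "\<exists>\<xi> \<eta>. 0 < \<xi> \<and> \<xi> < h n \<and> 0 < \<eta> \<and> \<eta> < h n \<and>
      dir_deriv w (dir_deriv v f) (x + \<xi> *\<^sub>R v + \<eta> *\<^sub>R w) = Q v w n" for n v w
    using second_difference[OF assms h0[of n], where x=x and v=v and w=w] h0[of n]
    by (force simp: power2_eq_square Q_def)
  have lim: "Q v w \<longlonglongrightarrow> dir_deriv w (dir_deriv v f) x" for v w
  proof -
    obtain \<xi> \<eta> where x: "\<And>n. 0 < \<xi> n \<and> \<xi> n < h n \<and> 0 < \<eta> n \<and> \<eta> n < h n \<and>
      dir_deriv w (dir_deriv v f) (x + \<xi> n *\<^sub>R v + \<eta> n *\<^sub>R w) = Q v w n"
      using ex[where v=v and w=w] by metis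
    have z: "\<xi> \<longlonglongrightarrow> 0" "\<eta> \<longlonglongrightarrow> 0"
      by (rule tendsto_sandwich[OF _ _ tendsto_const h_lim];
          use x in \<open>force intro: always_eventually less_imp_le\<close>)+
    have "(\<lambda>n. x + \<xi> n *\<^sub>R v + \<eta> n *\<^sub>R w) \<longlonglongrightarrow> x + 0 *\<^sub>R v + 0 *\<^sub>R w"
      by (intro tendsto_intros z)
    moreover have "isCont (dir_deriv w (dir_deriv v f)) x"
      using smooth_continuous_on[OF smooth_dir_deriv[OF smooth_dir_deriv[OF assms]], of UNIV]
      by (simp add: continuous_on_eq_continuous_at)
    ultimately have "(\<lambda>n. dir_deriv w (dir_deriv v f) (x + \<xi> n *\<^sub>R v + \<eta> n *\<^sub>R w)) \<longlonglongrightarrow> dir_deriv w (dir_deriv v f) x"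
      using isCont_tendsto_compose by fastforce
    then show ?thesis using x by simp
  qed
  have "Q v w = Q w v" by (auto simp: Q_def algebra_simps)
  with lim[where v=v and w=w] lim[where v=w and w=v] show ?thesis
    using LIMSEQ_unique by metis
qed

lemma dir_deriv_commute:
  fixes f :: "'a::real_normed_vector \<Rightarrow> 'b::euclidean_space"
  assumes "smooth f"
  shows "dir_deriv v (dir_deriv w f) x = dir_deriv w (dir_deriv v f) x"
proof (rule euclidean_eqI)
  fix b :: 'b assume "b \<in> Basis"
  have bl: "bounded_linear (\<lambda>y::'b. y \<bullet> b)" by (rule bounded_linear_inner_left)
  have 1: "dir_deriv w (\<lambda>x. f x \<bullet> b) = (\<lambda>x. dir_deriv w f x \<bullet> b)" for w
    by (rule ext) (rule dir_deriv_bounded_linear[OF bl smooth_differentiable[OF assms]])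
  have 2: "dir_deriv v (\<lambda>x. dir_deriv w f x \<bullet> b) x = dir_deriv v (dir_deriv w f) x \<bullet> b" for v w
    using dir_deriv_bounded_linear[OF bl] smooth_differentiable[OF smooth_dir_deriv[OF assms]] by blast
  show "dir_deriv v (dir_deriv w f) x \<bullet> b = dir_deriv w (dir_deriv v f) x \<bullet> b"
    using dir_deriv_commute_real[OF smooth_bounded_linear[OF bl assms], where v=v and w=w and x=x]
    unfolding 1 by (simp only: 2)
qed

section \<open>Integration by parts on a bounded open set\<close>

lemma set_integrable_continuous_closure:
  fixes f :: "'a::euclidean_space \<Rightarrow> 'b::{banach,second_countable_topology}"
  assumes "open \<Omega>" "bounded \<Omega>" "continuous_on (closure \<Omega>) f"
  shows "set_integrable lborel \<Omega> f"
proof -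
  have "set_integrable lborel (closure \<Omega>) f"
    unfolding set_integrable_def using assms by (intro borel_integrable_compact) auto
  then show ?thesis
    by (rule set_integrable_subset) (use assms closure_subset in auto)
qed

text \<open>Near a zero some directional derivative is positive, so every line in that direction
  meets the local zero set at most once. Infinitely many small translates of that piece in this
  direction are therefore disjoint, have equal measure and lie in one ball, which forces measure
  zero.\<close>

lemma null_sets_zero_set:
  fixes r :: "'a::euclidean_space \<Rightarrow> real"
  assumes "smooth r" and nz: "\<And>z. r z = 0 \<Longrightarrow> frechet_derivative r (at z) \<noteq> (\<lambda>h. 0)"
  shows "{z. r z = 0} \<in> null_sets lborel"
proof -
  let ?S = "{z. r z = 0}"
  have cont: "continuous_on A r" for A by (rule smooth_continuous_on[OF assms(1)])
  have clS: "closed ?S" using continuous_closed_preimage_constant[OF cont[of UNIV], of 0] by (simp add: vimage_def)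
  have diff: "r differentiable (at z)" for z using smooth_differentiable[OF assms(1)] .
  have "negligible ?S"
  proof (subst locally_negligible_alt, rule ballI)
    fix p assume p: "p \<in> ?S"
    obtain e0 where e0: "dir_deriv e0 r p \<noteq> 0" using nz[of p] p by auto
    have lin: "linear (frechet_derivative r (at p))" by (rule linear_frechet_derivative[OF diff])
    obtain e where e: "dir_deriv e r p > 0"
    proof (cases "dir_deriv e0 r p > 0")
      case False
      then have "dir_deriv (- e0) r p > 0" using e0 linear_neg[OF lin, of e0] by auto
      then show ?thesis using that by blast
    qed (use that in blast)
    have "isCont (dir_deriv e r) p"
      using smooth_continuous_on[OF smooth_dir_deriv[OF assms(1)], of UNIV]
      by (simp add: continuous_on_eq_continuous_at)
    then obtain d where d: "d > 0" "\<And>x. dist x p < d \<Longrightarrow> dir_deriv e r x > 0"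
      using e by (metis (no_types, lifting) continuous_at_eps_delta dist_real_def abs_diff_less_iff diff_self
          cancel_comm_monoid_add_class.diff_cancel)
    \<comment> \<open>Half the radius is kept in reserve: the shifts by c e / (n + 1) are shorter
      than d/2, so all translates of \<open>U\<close> stay inside the ball of radius
      \<open>d\<close>.\<close>
    define U where "U = ?S \<inter> ball p (d/2)"
    define c where "c = d / (2 * (norm e + 1))"
    have ne: "norm e + 1 > 0" by (rule add_nonneg_pos) auto
    have c0: "c > 0" using d ne by (simp add: c_def)
    have ce: "c * norm e < d / 2"
    proof -
      have "c * norm e < c * (norm e + 1)" using c0 by simp
      also have "\<dots> = d / 2" using ne by (simp add: c_def field_simps)
      finally show ?thesis .
    qed
    have Ub: "U \<in> sets borel" using clS by (auto simp: U_def)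
    define T where "T n = (+) ((c / real (Suc n)) *\<^sub>R e) ` U" for n
    have Tsub: "T n \<subseteq> ball p d" for n
    proof
      fix y assume "y \<in> T n"
      then obtain x where x: "x \<in> U" "y = (c / real (Suc n)) *\<^sub>R e + x" by (auto simp: T_def)
      have "norm ((c / real (Suc n)) *\<^sub>R e) \<le> c * norm e"
        using c0 by (simp add: field_simps mult_le_cancel_left1)
      moreover have "dist p y \<le> dist p x + norm ((c / real (Suc n)) *\<^sub>R e)"
        using x(2) by (metis add.commute dist_triangle dist_norm add_diff_cancel_left' norm_minus_commute)
      ultimately show "y \<in> ball p d" using ce x by (auto simp: U_def)
    qed
    \<comment> \<open>Two zeros on one line in direction \<open>e\<close> would give a zero of the
      derivative between them, but the ball is convex and the derivative is positive there.\<close>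
    have inj: False if xy: "x \<in> U" "y \<in> U" "y = x + t *\<^sub>R e" "t > 0" for x y t
    proof -
      have "\<exists>\<xi>. 0 < \<xi> \<and> \<xi> < t \<and> r (x + t *\<^sub>R e) - r x = t * dir_deriv e r (x + \<xi> *\<^sub>R e)"
        by (rule mean_value_direction[OF diff xy(4)])
      then obtain \<xi> where xi: "0 < \<xi>" "\<xi> < t" "r (x + t *\<^sub>R e) - r x = t * dir_deriv e r (x + \<xi> *\<^sub>R e)" by blast
      have "x + \<xi> *\<^sub>R e = (1 - \<xi>/t) *\<^sub>R x + (\<xi>/t) *\<^sub>R y"
        using xy(3,4) by (simp add: algebra_simps)
      moreover have "(1 - \<xi>/t) *\<^sub>R x + (\<xi>/t) *\<^sub>R y \<in> ball p (d/2)"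
        using xy xi by (intro convexD[OF convex_ball]) (auto simp: U_def field_simps)
      ultimately have "dir_deriv e r (x + \<xi> *\<^sub>R e) > 0"
        using d by (simp add: dist_commute)
      then show False using xi xy by (auto simp: U_def)
    qed
    have disj: "disjoint_family T"
    proof (unfold disjoint_family_on_def, intro ballI impI)
      have *: "T m \<inter> T n = {}" if "m < n" for m n
      proof (rule ccontr)
        assume "T m \<inter> T n \<noteq> {}"
        then obtain x y where xy: "x \<in> U" "y \<in> U"
          "(c / real (Suc m)) *\<^sub>R e + x = (c / real (Suc n)) *\<^sub>R e + y" by (auto simp: T_def)
        then have "y = x + (c / real (Suc m) - c / real (Suc n)) *\<^sub>R e" by (simp add: algebra_simps)
        moreover have "c / real (Suc m) - c / real (Suc n) > 0"
          using that c0 by (simp add: divide_strict_left_mono)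
        ultimately show False using inj xy by blast
      qed
      fix m n :: nat assume "m \<noteq> n" then show "T m \<inter> T n = {}"
        using *[of m n] *[of n m] by (cases m n rule: linorder_cases) auto
    qed
    have UL: "U \<in> lmeasurable" using Ub
      by (intro bounded_set_imp_lmeasurable) (auto simp: U_def bounded_Int)
    have TL: "T n \<in> lmeasurable" for n unfolding T_def by (rule measurable_translation[OF UL])
    have mT: "measure lebesgue (T n) = measure lebesgue U" for n
      unfolding T_def by (rule measure_translation)
    have "real N * measure lebesgue U \<le> measure lebesgue (ball p d)" for N
    proof -
      have "real N * measure lebesgue U = (\<Sum>n<N. measure lebesgue (T n))" by (simp add: mT)
      also have "\<dots> = measure lebesgue (\<Union>n<N. T n)"
      proof (intro measure_finite_Union[symmetric])
        show "emeasure lebesgue (T n) \<noteq> \<infinity>" for n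
          unfolding infinity_ennreal_def by (rule fmeasurableD2[OF TL])
        show "T ` {..<N} \<subseteq> sets lebesgue" using TL by (auto simp: fmeasurableD)
        show "disjoint_family_on T {..<N}" using disj by (auto simp: disjoint_family_on_def)
      qed simp
      also have "\<dots> \<le> measure lebesgue (ball p d)"
        using Tsub TL by (intro measure_mono_fmeasurable) (auto simp: fmeasurableD)
      finally show ?thesis .
    qed
    then have "\<not> measure lebesgue U > 0"
      using ex_less_of_nat_mult[of "measure lebesgue U" "measure lebesgue (ball p d)"] by (meson not_le)
    then have "measure lebesgue U = 0" using measure_nonneg[of lebesgue U] by linarith
    then have "negligible U" using UL by (simp add: negligible_iff_measure)
    moreover have "openin (top_of_set ?S) U" unfolding U_def by (rule openin_open_Int) simp
    ultimately show "\<exists>U. openin (top_of_set ?S) U \<and> p \<in> U \<and> negligible U"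
      using p d by (intro exI[of _ U]) (auto simp: U_def)
  qed
  then show ?thesis using clS
    by (simp add: negligible_iff_null_sets null_sets_completion_iff)
qed

lemma segment_bound:
  fixes G :: "'a::real_normed_vector \<Rightarrow> 'b::real_normed_vector"
  assumes "\<And>\<tau>. a \<le> \<tau> \<Longrightarrow> \<tau> \<le> b \<Longrightarrow> G differentiable (at (z + \<tau> *\<^sub>R v)) \<and> norm (dir_deriv v G (z + \<tau> *\<^sub>R v)) \<le> L"
    "a \<le> b"
  shows "norm (G (z + b *\<^sub>R v) - G (z + a *\<^sub>R v)) \<le> L * (b - a)"
proof -
  have d: "((\<lambda>t. G (z + t *\<^sub>R v)) has_derivative (\<lambda>s. s *\<^sub>R dir_deriv v G (z + t *\<^sub>R v))) (at t within {a..b})"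
    if "t \<in> {a..b}" for t
  proof -
    have dG: "G differentiable (at (z + t *\<^sub>R v))" using assms(1) that by auto
    have "((\<lambda>t. G (z + t *\<^sub>R v)) has_derivative (\<lambda>s. frechet_derivative G (at (z + t *\<^sub>R v)) (s *\<^sub>R v))) (at t)"
      by (rule has_derivative_compose[of "\<lambda>t. z + t *\<^sub>R v" "\<lambda>s. s *\<^sub>R v" t UNIV G])
        (auto intro!: derivative_eq_intros simp: dG frechet_derivative_works[symmetric])
    then show ?thesis
      using linear_cmul[OF linear_frechet_derivative[OF dG]] has_derivative_at_withinI by fastforce
  qed
  have "norm (G (z + b *\<^sub>R v) - G (z + a *\<^sub>R v)) \<le> L * norm (b - a)"
  proof (rule differentiable_bound[OF _ d])
    show "onorm (\<lambda>s. s *\<^sub>R dir_deriv v G (z + x *\<^sub>R v)) \<le> L" if "x \<in> {a..b}" for x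
      using assms(1)[of x] that
      by (intro onorm_le) (auto simp: mult.commute[of L] intro: mult_left_mono)
  qed (use assms(2) in auto)
  then show ?thesis using assms(2) by simp
qed

text \<open>Let c be the first time at which the segment is outside the domain. Up to c it stays in
  the closure, and at c it is on the frontier, where \<open>G\<close> vanishes; the bound on the
  derivative does the rest.\<close>

lemma exit_bound:
  fixes G :: "'a::real_normed_vector \<Rightarrow> 'b::real_normed_vector"
  assumes "open \<Omega>" "\<And>x. x \<in> closure \<Omega> \<Longrightarrow> G differentiable (at x) \<and> norm (dir_deriv v G x) \<le> L"
    "\<And>x. x \<in> frontier \<Omega> \<Longrightarrow> G x = 0" "0 \<le> L"
    "z \<in> \<Omega>" "z + b *\<^sub>R v \<notin> \<Omega>" "0 \<le> b"
  shows "norm (G z) \<le> L * b"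
proof -
  let ?p = "\<lambda>t. z + t *\<^sub>R v"
  have pc: "continuous_on A ?p" for A by (intro continuous_intros)
  define T where "T = {0..b} \<inter> ?p -` (- \<Omega>)"
  have "closed T" unfolding T_def
    by (rule continuous_closed_preimage[OF pc]) (use assms(1) in auto)
  then have "compact T"
    by (auto simp: compact_eq_bounded_closed T_def intro: bounded_subset[of "{0..b}"])
  moreover have "b \<in> T" using assms by (auto simp: T_def)
  ultimately obtain c where c: "c \<in> T" "\<And>t. t \<in> T \<Longrightarrow> c \<le> t"
    using compact_attains_inf[of T] by auto
  have c0: "0 < c" "c \<le> b" using c assms by (auto simp: T_def less_le)
  have inO: "?p t \<in> \<Omega>" if "0 \<le> t" "t < c" for t using c that c0 by (force simp: T_def)
  have "?p ` closure {0..<c} \<subseteq> closure \<Omega>"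
    by (rule image_closure_subset[OF pc]) (use inO closure_subset[of \<Omega>] in auto)
  then have im: "?p ` {0..c} \<subseteq> closure \<Omega>" using c0 by (simp add: closure_atLeastLessThan)
  have cl: "?p t \<in> closure \<Omega>" if "0 \<le> t" "t \<le> c" for t
    using subsetD[OF im imageI[of t]] that by simp
  have "?p c \<in> frontier \<Omega>"
    using c(1) cl[of c] c0 assms(1) by (auto simp: frontier_def T_def interior_open)
  then have "G (?p c) = 0" by (rule assms(3))
  moreover have "norm (G (?p c) - G (?p 0)) \<le> L * (c - 0)"
    by (rule segment_bound) (use cl assms(2) c0 in auto)
  ultimately have "norm (G z) \<le> L * c" by simp
  also have "\<dots> \<le> L * b" using c0 assms(4) by (intro mult_left_mono) auto
  finally show ?thesis .
qed

lemma lborel_integral_shift: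
  fixes F :: "'a::euclidean_space \<Rightarrow> 'b::{banach,second_countable_topology}"
  assumes "integrable lborel F"
  shows "integrable lborel (\<lambda>z. F (z + c))" "(\<integral>z. F (z + c) \<partial>lborel) = (\<integral>z. F z \<partial>lborel)"
proof -
  have *: "distr lborel borel ((+) c) = (lborel :: 'a measure)" by (rule lborel_distr_plus)
  have F: "F \<in> borel_measurable borel" using assms by (simp add: borel_measurable_integrable)
  show "integrable lborel (\<lambda>z. F (z + c))"
    using integrable_distr_eq[of "(+) c" lborel borel F] assms F by (simp add: * add.commute)
  show "(\<integral>z. F (z + c) \<partial>lborel) = (\<integral>z. F z \<partial>lborel)"
    using integral_distr[of "(+) c" lborel borel F] F by (simp add: * add.commute)
qed

text \<open>The extension of \<open>G\<close> by zero is Lipschitz, so its difference quotients, whose integrals vanish by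
  translation invariance, converge dominatedly to the derivative.\<close>

lemma integral_dir_deriv_eq_0:
  fixes G :: "'a::euclidean_space \<Rightarrow> 'b::euclidean_space"
  assumes "open \<Omega>" "bounded \<Omega>" "frontier \<Omega> \<in> null_sets lborel"
    "closure \<Omega> \<subseteq> U" "C1_on U G" "\<And>x. x \<in> frontier \<Omega> \<Longrightarrow> G x = 0"
  shows "(LINT z:\<Omega>|lborel. dir_deriv v G z) = 0"
proof -
  define K where "K = closure \<Omega>"
  have K: "compact K" using assms by (auto simp: K_def)
  have KU: "K \<subseteq> U" "\<Omega> \<subseteq> K" using assms closure_subset by (auto simp: K_def)
  have cD: "continuous_on K (dir_deriv v G)" using C1_onD(2)[OF assms(5)] KU continuous_on_subset by blast
  obtain L where L: "L > 0" "\<And>x. x \<in> K \<Longrightarrow> norm (dir_deriv v G x) \<le> L"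
    using compact_imp_bounded[OF compact_continuous_image[OF cD K]] by (auto simp: bounded_pos)
  have dG: "G differentiable (at x)" if "x \<in> K" for x using C1_onD(1)[OF assms(5)] KU that by auto
  have L': "norm (dir_deriv (- v) G x) \<le> L" if "x \<in> K" for x
    using L(2)[OF that] linear_neg[OF linear_frechet_derivative[OF dG[OF that]], of v] by simp
  define F where "F z = (if z \<in> \<Omega> then G z else 0)" for z
  have ex1: "norm (G z) \<le> L * b" if "z \<in> \<Omega>" "z + b *\<^sub>R v \<notin> \<Omega>" "0 \<le> b" for z b
    by (rule exit_bound[OF assms(1) _ assms(6) _ that]) (use L dG in \<open>auto simp: K_def\<close>)
  have ex2: "norm (G z) \<le> L * b" if "z \<in> \<Omega>" "z + b *\<^sub>R (- v) \<notin> \<Omega>" "0 \<le> b" for z b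
    by (rule exit_bound[OF assms(1) _ assms(6) _ that]) (use L L' dG in \<open>auto simp: K_def\<close>)
  have lip: "norm (F (z + t *\<^sub>R v) - F z) \<le> L * t" if t: "0 \<le> t" for z t
  proof -
    consider "z \<notin> \<Omega>" "z + t *\<^sub>R v \<notin> \<Omega>" | "z \<in> \<Omega>" "z + t *\<^sub>R v \<notin> \<Omega>" | "z \<notin> \<Omega>" "z + t *\<^sub>R v \<in> \<Omega>"
      | "\<forall>\<tau>\<in>{0..t}. z + \<tau> *\<^sub>R v \<in> \<Omega>"
      | \<tau> where "z \<in> \<Omega>" "z + t *\<^sub>R v \<in> \<Omega>" "0 \<le> \<tau>" "\<tau> \<le> t" "z + \<tau> *\<^sub>R v \<notin> \<Omega>"
      by force
    then show ?thesis
    proof cases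
      case 1 then show ?thesis using L t by (simp add: F_def)
    next
      case 2 then show ?thesis using ex1 t by (simp add: F_def)
    next
      case 3 then show ?thesis using ex2[of "z + t *\<^sub>R v" t] t by (simp add: F_def)
    next
      case 4
      have "norm (G (z + t *\<^sub>R v) - G (z + 0 *\<^sub>R v)) \<le> L * (t - 0)"
        using 4 KU by (intro segment_bound conjI L(2) dG t) auto
      then show ?thesis using bspec[OF 4, of 0] bspec[OF 4, of t] t by (simp add: F_def)
    next
      case 5
      have "norm (G z) \<le> L * \<tau>" using ex1 5 by blast
      moreover have "norm (G (z + t *\<^sub>R v)) \<le> L * (t - \<tau>)"
        using ex2[of "z + t *\<^sub>R v" "t - \<tau>"] 5 by (simp add: algebra_simps)
      ultimately show ?thesis
        using 5 norm_triangle_ineq4[of "G (z + t *\<^sub>R v)" "G z"] by (simp add: F_def algebra_simps)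
    qed
  qed
  have intF: "integrable lborel F"
  proof -
    have "set_integrable lborel \<Omega> G"
      using C1_onD(3)[OF assms(5)] assms by (intro set_integrable_continuous_closure) (auto intro: continuous_on_subset)
    moreover have "(\<lambda>x. indicat_real \<Omega> x *\<^sub>R G x) = F" by (auto simp: F_def indicator_def)
    ultimately show ?thesis by (simp add: set_integrable_def)
  qed
  define h where "h n = inverse (real (Suc n))" for n
  have h0: "0 < h n" "h n \<le> 1" for n by (auto simp: h_def field_simps)
  have h_lim: "h \<longlonglongrightarrow> 0"
    using LIMSEQ_inverse_real_of_nat by (simp add: h_def[abs_def])
  define s where "s n z = (1 / h n) *\<^sub>R (F (z + h n *\<^sub>R v) - F z)" for n z
  obtain R0 where R0: "\<And>x. x \<in> K \<Longrightarrow> norm x \<le> R0" using compact_imp_bounded[OF K] by (auto simp: bounded_iff)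
  \<comment> \<open>All shifts have length at most that of \<open>v\<close>, so every quotient
    \<open>s n\<close> is supported in this ball; this makes the dominating function
    integrable.\<close>
  define R where "R = R0 + norm v"
  have supp: "s n z = 0" if "z \<notin> cball 0 R" for n z
  proof -
    have z: "norm z > R" using that by auto
    have "norm (h n *\<^sub>R v) \<le> norm v" using h0[of n] by (simp add: mult_left_le_one_le)
    then have "norm (z + h n *\<^sub>R v) > R0"
      using z norm_diff_ineq[of z "h n *\<^sub>R v"] by (simp add: R_def)
    moreover have "norm z > R0" using z norm_ge_zero[of v] by (simp add: R_def del: norm_ge_zero)
    ultimately have "z + h n *\<^sub>R v \<notin> \<Omega>" "z \<notin> \<Omega>" using R0 KU by (meson subsetD not_le)+
    then show ?thesis by (simp add: s_def F_def)
  qed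
  have sb: "norm (s n z) \<le> L * indicat_real (cball 0 R) z" for n z
  proof (cases "z \<in> cball 0 R")
    case True
    have "norm (s n z) = norm (F (z + h n *\<^sub>R v) - F z) / h n" using h0[of n] by (simp add: s_def del: scaleR_diff_right)
    also have "\<dots> \<le> L" using lip[of "h n" z] h0[of n] by (simp add: pos_divide_le_eq)
    finally show ?thesis using True by simp
  qed (simp add: supp)
  have ints: "integrable lborel (s n)" "(\<integral>z. s n z \<partial>lborel) = 0" for n
    using lborel_integral_shift[OF intF, of "h n *\<^sub>R v"] intF by (auto simp: s_def[abs_def])
  \<comment> \<open>Off the frontier a point is interior either to the domain or to its complement;
    small shifts stay there, so the quotient is eventually an ordinary difference quotient or
    eventually zero.\<close>
  have lim: "AE z in lborel. (\<lambda>n. s n z) \<longlonglongrightarrow> indicat_real \<Omega> z *\<^sub>R dir_deriv v G z"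
  proof (rule AE_I'[OF assms(3)], rule subsetI, rule ccontr)
    fix z assume z: "z \<in> {z \<in> space lborel. \<not> (\<lambda>n. s n z) \<longlonglongrightarrow> indicat_real \<Omega> z *\<^sub>R dir_deriv v G z}" "z \<notin> frontier \<Omega>"
    have hz: "(\<lambda>n. z + h n *\<^sub>R v) \<longlonglongrightarrow> z + 0 *\<^sub>R v" by (intro tendsto_intros h_lim)
    show False
    proof (cases "z \<in> \<Omega>")
      case True
      have ev: "\<forall>\<^sub>F n in sequentially. z + h n *\<^sub>R v \<in> \<Omega>"
        using topological_tendstoD[OF hz assms(1)] True by simp
      have dz: "(G has_derivative frechet_derivative G (at z)) (at z)"
        using dG[of z] KU True by (auto simp: frechet_derivative_works[symmetric])
      have "((\<lambda>t. G (z + t *\<^sub>R v)) has_derivative (\<lambda>s. frechet_derivative G (at z) (s *\<^sub>R v))) (at 0)"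
        by (rule has_derivative_compose[of "\<lambda>t. z + t *\<^sub>R v" "\<lambda>s. s *\<^sub>R v" 0 UNIV G])
           (auto intro!: derivative_eq_intros simp: dz)
      then have "((\<lambda>t. G (z + t *\<^sub>R v)) has_vector_derivative dir_deriv v G z) (at 0)"
        using linear_cmul[OF has_derivative_linear[OF dz]] by (simp add: has_vector_derivative_def)
      then have "(\<lambda>t. norm (G (z + t *\<^sub>R v) - G z - t *\<^sub>R dir_deriv v G z) / \<bar>t\<bar>) \<midarrow>0\<rightarrow> 0"
        by (simp add: has_vector_derivative_def has_derivative_iff_norm)
      moreover have "norm (G (z + t *\<^sub>R v) - G z - t *\<^sub>R dir_deriv v G z) / \<bar>t\<bar>
          = norm ((G (z + t *\<^sub>R v) - G z) /\<^sub>R t - dir_deriv v G z)" if "t \<noteq> 0" for t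
      proof -
        have "(G (z + t *\<^sub>R v) - G z - t *\<^sub>R dir_deriv v G z) /\<^sub>R t = (G (z + t *\<^sub>R v) - G z) /\<^sub>R t - dir_deriv v G z"
          using that by (simp add: scaleR_diff_right)
        then show ?thesis
          by (metis abs_inverse divide_inverse_commute norm_scaleR)
      qed
      ultimately have "(\<lambda>t. norm ((G (z + t *\<^sub>R v) - G z) /\<^sub>R t - dir_deriv v G z)) \<midarrow>0\<rightarrow> 0"
        by (simp cong: LIM_cong)
      then have vd: "((\<lambda>t. (G (z + t *\<^sub>R v) - G z) /\<^sub>R t) \<longlongrightarrow> dir_deriv v G z) (at 0)"
        using LIM_zero_iff tendsto_norm_zero_iff by blast
      have "(\<lambda>n. (G (z + h n *\<^sub>R v) - G z) /\<^sub>R h n) \<longlonglongrightarrow> dir_deriv v G z"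
        by (rule filterlim_compose[OF vd]) (use h_lim h0 in \<open>auto simp: filterlim_at less_imp_neq[symmetric]\<close>)
      moreover have "\<forall>\<^sub>F n in sequentially. (G (z + h n *\<^sub>R v) - G z) /\<^sub>R h n = s n z"
        using ev by eventually_elim (use True in \<open>simp add: s_def F_def divide_inverse\<close>)
      ultimately have "(\<lambda>n. s n z) \<longlonglongrightarrow> dir_deriv v G z" by (rule Lim_transform_eventually)
      then show False using z True by simp
    next
      case False
      then have "z \<in> - closure \<Omega>" using z assms(1) by (auto simp: frontier_def interior_open)
      then have ev: "\<forall>\<^sub>F n in sequentially. z + h n *\<^sub>R v \<in> - closure \<Omega>"
        using topological_tendstoD[OF hz, of "- closure \<Omega>"] by auto
      have "\<forall>\<^sub>F n in sequentially. 0 = s n z"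
        using ev by eventually_elim (use False closure_subset in \<open>auto simp: s_def F_def\<close>)
      then have "(\<lambda>n. s n z) \<longlonglongrightarrow> 0" by (rule Lim_transform_eventually[OF tendsto_const])
      then show False using z False by simp
    qed
  qed
  have "(\<lambda>n. \<integral>z. s n z \<partial>lborel) \<longlonglongrightarrow> (\<integral>z. indicat_real \<Omega> z *\<^sub>R dir_deriv v G z \<partial>lborel)"
  proof (rule integral_dominated_convergence[OF _ _ _ lim])
    have "set_integrable lborel \<Omega> (dir_deriv v G)"
      using cD assms by (intro set_integrable_continuous_closure) (auto simp: K_def)
    then show "(\<lambda>z. indicat_real \<Omega> z *\<^sub>R dir_deriv v G z) \<in> borel_measurable lborel"
      by (simp add: set_integrable_def borel_measurable_integrable)
    show "integrable lborel (\<lambda>z. L * indicat_real (cball 0 R) z)"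
      by (intro integrable_mult_right integrable_real_indicator emeasure_lborel_cball_finite) auto
  qed (use ints sb in auto)
  then show ?thesis
    by (simp add: ints(2) LIMSEQ_const_iff set_lebesgue_integral_def)
qed

section \<open>Wirtinger calculus\<close>

lemma d_z_cong:
  assumes "open U" "x \<in> U" "\<And>y. y \<in> U \<Longrightarrow> f y = g y"
  shows "d_z k f x = d_z k g x" "d_zbar k f x = d_zbar k g x"
  using dir_deriv_cong[OF assms] by (simp_all add: d_z_def d_zbar_def)

lemma d_z_const: "d_z k (\<lambda>x. c) x = 0" "d_zbar k (\<lambda>x. c) x = 0"
  by (simp_all add: d_z_def d_zbar_def)

lemma d_z_add:
  assumes "f differentiable (at x)" "g differentiable (at x)"
  shows "d_z k (\<lambda>x. f x + g x) x = d_z k f x + d_z k g x"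
    "d_zbar k (\<lambda>x. f x + g x) x = d_zbar k f x + d_zbar k g x"
  using assms by (simp_all add: d_z_def d_zbar_def dir_deriv_add algebra_simps add_divide_distrib diff_divide_distrib)

lemma d_z_mult:
  assumes "f differentiable (at x)" "g differentiable (at x)"
  shows "d_z k (\<lambda>x. f x * g x) x = f x * d_z k g x + d_z k f x * g x"
    "d_zbar k (\<lambda>x. f x * g x) x = f x * d_zbar k g x + d_zbar k f x * g x"
  using assms by (simp_all add: d_z_def d_zbar_def dir_deriv_mult algebra_simps add_divide_distrib diff_divide_distrib)

lemma differentiable_sum':
  "finite I \<Longrightarrow> (\<And>i. i \<in> I \<Longrightarrow> f i differentiable (at x)) \<Longrightarrow> (\<lambda>x. \<Sum>i\<in>I. f i x) differentiable (at x)"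
  by (induction I rule: finite_induct) auto

lemma d_z_sum:
  assumes "finite I" "\<And>i. i \<in> I \<Longrightarrow> f i differentiable (at x)"
  shows "d_z k (\<lambda>x. \<Sum>i\<in>I. f i x) x = (\<Sum>i\<in>I. d_z k (f i) x)"
    "d_zbar k (\<lambda>x. \<Sum>i\<in>I. f i x) x = (\<Sum>i\<in>I. d_zbar k (f i) x)"
  using assms
  by (induction I rule: finite_induct) (auto simp: d_z_const d_z_add differentiable_sum')

lemma differentiable_cnj: "f differentiable (at x) \<Longrightarrow> (\<lambda>x. cnj (f x)) differentiable (at x)"
  by (rule differentiable_bounded_linear[OF bounded_linear_cnj])

lemma differentiable_of_real:
  "f differentiable (at x) \<Longrightarrow> (\<lambda>x. complex_of_real (f x)) differentiable (at x)"
  by (rule differentiable_bounded_linear[OF bounded_linear_of_real])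

lemma d_z_cnj:
  assumes "f differentiable (at x)"
  shows "d_z k (\<lambda>x. cnj (f x)) x = cnj (d_zbar k f x)" "d_zbar k (\<lambda>x. cnj (f x)) x = cnj (d_z k f x)"
  using dir_deriv_bounded_linear[OF bounded_linear_cnj assms] by (simp_all add: d_z_def d_zbar_def)

lemma d_z_of_real:
  assumes "f differentiable (at x)"
  shows "cnj (d_z k (\<lambda>x. complex_of_real (f x)) x) = d_zbar k (\<lambda>x. complex_of_real (f x)) x"
  using d_z_cnj(2)[OF differentiable_of_real[OF assms], of k] by simp

lemma d_z_real_comp:
  assumes "f differentiable (at x)" "(h has_real_derivative h') (at (f x))"
  shows "d_z k (\<lambda>x. complex_of_real (h (f x))) x = of_real h' * d_z k (\<lambda>x. complex_of_real (f x)) x"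
    "d_zbar k (\<lambda>x. complex_of_real (h (f x))) x = of_real h' * d_zbar k (\<lambda>x. complex_of_real (f x)) x"
proof -
  have "dir_deriv v (\<lambda>x. complex_of_real (h (f x))) x = of_real h' * dir_deriv v (\<lambda>x. complex_of_real (f x)) x" for v
    by (subst (1 2) dir_deriv_bounded_linear[OF bounded_linear_of_real])
      (use dir_deriv_real_comp[OF assms] assms in auto)
  then show "d_z k (\<lambda>x. complex_of_real (h (f x))) x = of_real h' * d_z k (\<lambda>x. complex_of_real (f x)) x"
    "d_zbar k (\<lambda>x. complex_of_real (h (f x))) x = of_real h' * d_zbar k (\<lambda>x. complex_of_real (f x)) x"
    by (simp_all add: d_z_def d_zbar_def algebra_simps)
qed

lemma smooth_cmult: "smooth f \<Longrightarrow> smooth (\<lambda>x. c * f x)" for f :: "'a::real_normed_vector \<Rightarrow> complex"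
  by (intro smooth_mult) auto

lemma d_z_alt:
  "d_z k f = (\<lambda>z. (1/2) * dir_deriv (axis k 1) f z + (- \<i>/2) * dir_deriv (axis k \<i>) f z)"
  "d_zbar k f = (\<lambda>z. (1/2) * dir_deriv (axis k 1) f z + (\<i>/2) * dir_deriv (axis k \<i>) f z)"
  by (auto simp: d_z_def d_zbar_def field_simps)

lemma smooth_d_z: "smooth f \<Longrightarrow> smooth (d_z k f)" "smooth f \<Longrightarrow> smooth (d_zbar k f)"
  unfolding d_z_alt by (intro smooth_add smooth_cmult smooth_dir_deriv; assumption)+

lemma C1_on_continuous_d_z:
  assumes "C1_on U f"
  shows "continuous_on U (d_z k f)" "continuous_on U (d_zbar k f)"
  unfolding d_z_alt by (intro continuous_intros C1_onD(2)[OF assms])+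

lemma smooth_of_real: "smooth f \<Longrightarrow> smooth (\<lambda>x. complex_of_real (f x))"
  by (rule smooth_bounded_linear[OF bounded_linear_of_real])

lemma smooth_cnj: "smooth f \<Longrightarrow> smooth (\<lambda>x. cnj (f x))"
  by (rule smooth_bounded_linear[OF bounded_linear_cnj])

lemma C1_on_of_real: "C1_on U f \<Longrightarrow> C1_on U (\<lambda>x. complex_of_real (f x))"
  by (rule C1_on_bounded_linear[OF bounded_linear_of_real])

lemma deriv_lincomb:
  fixes f g :: "'a::real_normed_vector \<Rightarrow> complex"
  assumes "f differentiable (at x)" "g differentiable (at x)"
  shows "dir_deriv v (\<lambda>z. a * f z + b * g z) x = a * dir_deriv v f x + b * dir_deriv v g x"
proof -
  have "(\<lambda>z. a * f z) differentiable (at x)" "(\<lambda>z. b * g z) differentiable (at x)"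
    using assms by (auto intro!: differentiable_mult)
  then show ?thesis
    using assms dir_deriv_mult[of "\<lambda>_. a" x f v] dir_deriv_mult[of "\<lambda>_. b" x g v] by (simp add: dir_deriv_add)
qed

lemma d_zbar_lincomb:
  assumes "f differentiable (at x)" "g differentiable (at x)"
  shows "d_zbar k (\<lambda>z. a * f z + b * g z) x = a * d_zbar k f x + b * d_zbar k g x"
  using deriv_lincomb[OF assms] by (simp add: d_zbar_def field_simps)

lemma dir_deriv_d_z:
  assumes "smooth f"
  shows "dir_deriv v (d_z k f) x = d_z k (dir_deriv v f) x"
    "dir_deriv v (d_zbar k f) x = d_zbar k (dir_deriv v f) x"
proof -
  have d: "dir_deriv w f differentiable (at x)" for w x
    by (rule smooth_differentiable[OF smooth_dir_deriv[OF assms]])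
  have c: "dir_deriv v (dir_deriv w f) x = dir_deriv w (dir_deriv v f) x" for w
    by (rule dir_deriv_commute[OF assms])
  show "dir_deriv v (d_z k f) x = d_z k (dir_deriv v f) x"
    "dir_deriv v (d_zbar k f) x = d_zbar k (dir_deriv v f) x"
    unfolding d_z_alt by (simp_all only: deriv_lincomb[OF d d] c)
qed

lemma d_z_d_zbar_commute:
  assumes "smooth f"
  shows "d_z j (d_zbar k f) x = d_zbar k (d_z j f) x"
proof -
  have d: "d_z j f differentiable (at x)" "dir_deriv v f differentiable (at x)" for v
    using smooth_differentiable[OF smooth_d_z(1)] smooth_differentiable[OF smooth_dir_deriv] assms by blast+
  have "d_z j (d_zbar k f) x = (1/2) * dir_deriv (axis j 1) (d_zbar k f) x + (- \<i>/2) * dir_deriv (axis j \<i>) (d_zbar k f) x"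
    by (simp only: d_z_alt(1)[of j "d_zbar k f"])
  also have "\<dots> = (1/2) * d_zbar k (dir_deriv (axis j 1) f) x + (- \<i>/2) * d_zbar k (dir_deriv (axis j \<i>) f) x"
    using dir_deriv_d_z[OF assms] by simp
  also have "\<dots> = d_zbar k (d_z j f) x"
    by (simp only: d_z_alt(1)[of j f] d_zbar_lincomb[OF d(2) d(2)])
  finally show ?thesis .
qed

text \<open>Stokes' theorem in the form in which it is used throughout: the function vanishes on the
  frontier, so no surface measure appears.\<close>

lemma integral_d_z_eq_0:
  fixes G :: "complex ^ 'n::finite \<Rightarrow> complex"
  assumes "open \<Omega>" "bounded \<Omega>" "frontier \<Omega> \<in> null_sets lborel"
    "closure \<Omega> \<subseteq> U" "C1_on U G" "\<And>x. x \<in> frontier \<Omega> \<Longrightarrow> G x = 0"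
  shows "(LINT z:\<Omega>|lborel. d_z k G z) = 0" "(LINT z:\<Omega>|lborel. d_zbar k G z) = 0"
proof -
  have i: "set_integrable lborel \<Omega> (dir_deriv v G)" for v
    using assms C1_onD(2)[OF assms(5)]
    by (intro set_integrable_continuous_closure) (auto intro: continuous_on_subset)
  have z: "(LINT z:\<Omega>|lborel. dir_deriv v G z) = 0" for v
    by (rule integral_dir_deriv_eq_0[OF assms]) auto
  show "(LINT z:\<Omega>|lborel. d_z k G z) = 0" "(LINT z:\<Omega>|lborel. d_zbar k G z) = 0"
    unfolding d_z_alt using i z by (simp_all add: set_integral_add del: mult_minus_left)
qed

section \<open>The exterior algebra of \<open>(0,q)\<close>-covectors\<close>

text \<open>The sign of sorting \<open>k\<close> into the increasing multi-index \<open>S\<close>.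
  The comparison is strict, so the value is the same whether or not \<open>k\<close> itself belongs
  to \<open>S\<close>.\<close>

definition eps :: "'n::linorder \<Rightarrow> 'n set \<Rightarrow> complex" where
  "eps k S = (-1) ^ card {j \<in> S. j < k}"

text \<open>This is the coefficient w_{kK} of the antisymmetric extension, with multi-indices
  encoded as sets; equivalently, interior multiplication.\<close>

definition contraction :: "('n::linorder set \<Rightarrow> complex) \<Rightarrow> 'n \<Rightarrow> 'n set \<Rightarrow> complex" where
  "contraction w k K = (if k \<in> K then 0 else eps k K * w (insert k K))"

text \<open>The coefficient at \<open>L\<close> of the form \<Sum> d\<bar>z_k \<and> W_k, where the
  bar belongs to z. With \<open>W k J\<close> the derivative of u_J in the k-th conjugate variable
  it is the coefficient of dbar u.\<close>

definition wedge :: "('n::linorder \<Rightarrow> 'n set \<Rightarrow> complex) \<Rightarrow> 'n set \<Rightarrow> complex" where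
  "wedge W L = (\<Sum>k\<in>L. eps k L * W k (L - {k}))"

lemma eps_cnj [simp]: "cnj (eps k S) = eps k S"
  by (simp add: eps_def)

lemma eps_square [simp]: "eps k S * eps k S = 1"
  by (simp add: eps_def power_add[symmetric] mult_2[symmetric] power_mult)

lemma norm_eps [simp]: "cmod (eps k S) = 1"
  by (simp add: eps_def norm_power)

lemma eps_insert:
  assumes "finite K"
  shows "eps k (insert k K) = eps k K"
    "j \<notin> K \<Longrightarrow> eps k (insert j K) = (if j < k then - eps k K else eps k K)"
proof -
  have "{i \<in> insert k K. i < k} = {i \<in> K. i < k}" by auto
  then show "eps k (insert k K) = eps k K" by (simp add: eps_def)
  assume "j \<notin> K"
  moreover have "{i \<in> insert j K. i < k} = (if j < k then insert j {i \<in> K. i < k} else {i \<in> K. i < k})" by auto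
  ultimately show "eps k (insert j K) = (if j < k then - eps k K else eps k K)"
    using assms by (auto simp: eps_def)
qed

text \<open>Pairs of a set with one of its elements correspond to pairs of a set, smaller by one,
  with a point outside it.\<close>

lemma sum_subsets_swap:
  fixes F :: "'n::finite \<Rightarrow> 'n set \<Rightarrow> 'b::comm_monoid_add"
  shows "(\<Sum>J | card J = Suc p. \<Sum>k\<in>J. F k J) = (\<Sum>K | card K = p. \<Sum>k\<in>-K. F k (insert k K))"
proof -
  have "(\<Sum>J | card J = Suc p. \<Sum>k\<in>J. F k J) = (\<Sum>(J,k)\<in>Sigma {J. card J = Suc p} (\<lambda>J. J). F k J)"
    by (simp add: sum.Sigma)
  also have "\<dots> = (\<Sum>(K,k)\<in>Sigma {K. card K = p} (\<lambda>K. - K). F k (insert k K))"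
    by (rule sum.reindex_bij_witness[of _ "\<lambda>(K,k). (insert k K, k)" "\<lambda>(J,k). (J - {k}, k)"])
      (auto simp: insert_absorb)
  also have "\<dots> = (\<Sum>K | card K = p. \<Sum>k\<in>-K. F k (insert k K))"
    by (simp add: sum.Sigma)
  finally show ?thesis .
qed

text \<open>The algebra behind the Kohn--Morrey--Hoermander identity. In the expanded square on the
  left, equal indices give the terms with k outside J (\<open>?X\<close>) and distinct indices give
  \<open>- ?Z\<close>. In the mixed sum, equal indices give the terms with k in J
  (\<open>?Y\<close>) and distinct ones give \<open>?Z\<close>. The full sum is
  \<open>?X + ?Y\<close>.\<close>

lemma wedge_norm_identity:
  fixes W :: "'n::{finite,linorder} \<Rightarrow> 'n set \<Rightarrow> complex"
  shows "(\<Sum>L | card L = Suc (Suc p). wedge W L * cnj (wedge W L))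
    = (\<Sum>k\<in>UNIV. \<Sum>J | card J = Suc p. W k J * cnj (W k J))
      - (\<Sum>K | card K = p. \<Sum>j\<in>UNIV. \<Sum>k\<in>UNIV. contraction (W k) j K * cnj (contraction (W j) k K))"
    (is "?A = ?B - ?C")
proof -
  let ?E = "\<lambda>L k j. eps k L * W k (L - {k}) * (eps j L * cnj (W j (L - {j})))"
  let ?X = "\<Sum>J | card J = Suc p. \<Sum>k\<in>-J. W k J * cnj (W k J)"
  let ?Y = "\<Sum>J | card J = Suc p. \<Sum>k\<in>J. W k J * cnj (W k J)"
  let ?Z = "\<Sum>K | card K = p. \<Sum>j\<in>-K. \<Sum>k\<in>-insert j K.
      eps j K * eps k K * (W k (insert j K) * cnj (W j (insert k K)))"
  have e1: "eps k K * (eps k K * x) = x" for k K x using eps_square[of k K] by (simp flip: mult.assoc)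
  have "?A = (\<Sum>L | card L = Suc (Suc p). \<Sum>k\<in>L. \<Sum>j\<in>L. ?E L k j)"
    by (simp add: wedge_def sum_product)
  also have "\<dots> = (\<Sum>J | card J = Suc p. \<Sum>k\<in>-J. \<Sum>j\<in>insert k J. ?E (insert k J) k j)"
    by (rule sum_subsets_swap)
  also have "\<dots> = (\<Sum>J | card J = Suc p. \<Sum>k\<in>-J. W k J * cnj (W k J) + (\<Sum>j\<in>J. ?E (insert k J) k j))"
  proof (intro sum.cong refl)
    fix J k assume "k \<in> - (J :: 'n set)"
    then show "(\<Sum>j\<in>insert k J. ?E (insert k J) k j) = W k J * cnj (W k J) + (\<Sum>j\<in>J. ?E (insert k J) k j)"
      by (simp add: mult_ac e1)
  qed
  also have "\<dots> = ?X + (\<Sum>J | card J = Suc p. \<Sum>j\<in>J. \<Sum>k\<in>-J. ?E (insert k J) k j)"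
    by (simp add: sum.distrib sum.swap[of _ "- _"])
  also have "(\<Sum>J | card J = Suc p. \<Sum>j\<in>J. \<Sum>k\<in>-J. ?E (insert k J) k j)
      = (\<Sum>K | card K = p. \<Sum>j\<in>-K. \<Sum>k\<in>-insert j K. ?E (insert k (insert j K)) k j)"
    by (rule sum_subsets_swap)
  also have "\<dots> = - ?Z"
    unfolding sum_negf[symmetric]
  proof (intro sum.cong refl)
    fix K j k assume *: "j \<in> - (K :: 'n set)" "k \<in> - insert j K"
    have 1: "insert k (insert j K) - {k} = insert j K" "insert k (insert j K) - {j} = insert k K" using * by auto
    \<comment> \<open>Exactly one of \<open>j\<close>, \<open>k\<close> is below the other, so
      inserting both flips exactly one of the two signs; this is the origin of the minus sign in the
      identity.\<close>
    have 2: "eps k (insert k (insert j K)) * eps j (insert k (insert j K)) = - (eps j K * eps k K)"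
      using * by (subst (2) insert_commute) (auto simp: eps_insert)
    show "?E (insert k (insert j K)) k j = - (eps j K * eps k K * (W k (insert j K) * cnj (W j (insert k K))))"
      unfolding 1 using 2 by (metis (no_types, opaque_lifting) mult.assoc mult.left_commute mult_minus_left)
  qed
  finally have A: "?A = ?X - ?Z" by simp
  have "?C = (\<Sum>K | card K = p. \<Sum>j\<in>-K. \<Sum>k\<in>-K. eps j K * eps k K * (W k (insert j K) * cnj (W j (insert k K))))"
    unfolding contraction_def
    by (intro sum.cong refl sum.mono_neutral_cong_right) (auto simp: mult_ac)
  also have "\<dots> = (\<Sum>K | card K = p. \<Sum>j\<in>-K. W j (insert j K) * cnj (W j (insert j K)) +
      (\<Sum>k\<in>-insert j K. eps j K * eps k K * (W k (insert j K) * cnj (W j (insert k K)))))"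
  proof (intro sum.cong refl)
    fix K j assume "j \<in> - (K :: 'n set)"
    then have "- K = insert j (- insert j K)" by auto
    then show "(\<Sum>k\<in>-K. eps j K * eps k K * (W k (insert j K) * cnj (W j (insert k K)))) =
       W j (insert j K) * cnj (W j (insert j K)) +
      (\<Sum>k\<in>-insert j K. eps j K * eps k K * (W k (insert j K) * cnj (W j (insert k K))))"
      by (metis (no_types, lifting) ComplD e1 eps_square finite insertI1 mult_1 sum.insert ComplI)
  qed
  also have "\<dots> = ?Y + ?Z" by (simp add: sum.distrib sum_subsets_swap)
  finally have C: "?C = ?Y + ?Z" .
  have "?B = (\<Sum>J | card J = Suc p. \<Sum>k\<in>UNIV. W k J * cnj (W k J))" by (rule sum.swap)
  also have "\<dots> = (\<Sum>J | card J = Suc p. (\<Sum>k\<in>J. W k J * cnj (W k J)) + (\<Sum>k\<in>-J. W k J * cnj (W k J)))"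
  proof (intro sum.cong refl)
    fix J :: "'n set"
    show "(\<Sum>k\<in>UNIV. W k J * cnj (W k J)) = (\<Sum>k\<in>J. W k J * cnj (W k J)) + (\<Sum>k\<in>-J. W k J * cnj (W k J))"
      by (subst sum.union_disjoint[symmetric]) auto
  qed
  also have "\<dots> = ?Y + ?X" by (simp add: sum.distrib)
  finally show ?thesis using A C by simp
qed

text \<open>Each set with p + 1 elements arises once for every element that can be split
  off.\<close>

lemma contraction_norm_sum:
  fixes w :: "'n::{finite,linorder} set \<Rightarrow> complex"
  shows "(\<Sum>K | card K = p. \<Sum>j\<in>UNIV. (cmod (contraction w j K))\<^sup>2)
    = real (Suc p) * (\<Sum>J | card J = Suc p. (cmod (w J))\<^sup>2)"
proof -
  have "(\<Sum>K | card K = p. \<Sum>j\<in>UNIV. (cmod (contraction w j K))\<^sup>2)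
      = (\<Sum>K | card K = p. \<Sum>j\<in>-K. (cmod (w (insert j K)))\<^sup>2)"
    by (intro sum.cong refl sum.mono_neutral_cong_right) (auto simp: contraction_def norm_mult)
  also have "\<dots> = (\<Sum>J | card J = Suc p. \<Sum>j\<in>J. (cmod (w J))\<^sup>2)" by (rule sum_subsets_swap[symmetric])
  also have "\<dots> = real (Suc p) * (\<Sum>J | card J = Suc p. (cmod (w J))\<^sup>2)"
    by (simp add: sum_distrib_left)
  finally show ?thesis .
qed

text \<open>Interior multiplication by a vector is bounded by the length of the vector. With
  \<open>W k = cnj (\<xi> k) * w\<close> the norm identity says that the difference of the two sides
  is the square norm of an exterior product, hence nonnegative.\<close>

lemma contraction_le:
  fixes w :: "'n::{finite,linorder} set \<Rightarrow> complex" and \<xi> :: "'n \<Rightarrow> complex"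
  shows "(\<Sum>K | card K = p. (cmod (\<Sum>j\<in>UNIV. \<xi> j * contraction w j K))\<^sup>2)
    \<le> (\<Sum>k\<in>UNIV. (cmod (\<xi> k))\<^sup>2) * (\<Sum>J | card J = Suc p. (cmod (w J))\<^sup>2)" (is "?l \<le> ?r")
proof -
  define W where "W k J = cnj (\<xi> k) * w J" for k J
  have cW: "contraction (W k) j K = cnj (\<xi> k) * contraction w j K" for k j K
    by (simp add: contraction_def W_def)
  have "(\<Sum>K | card K = p. \<Sum>j\<in>UNIV. \<Sum>k\<in>UNIV. contraction (W k) j K * cnj (contraction (W j) k K)) =
     (\<Sum>K | card K = p. (\<Sum>j\<in>UNIV. \<xi> j * contraction w j K) * cnj (\<Sum>j\<in>UNIV. \<xi> j * contraction w j K))"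
    by (simp add: cW sum_product mult_ac)
  also have "\<dots> = of_real ?l" by (simp add: complex_norm_square[symmetric] del: cnj_sum)
  finally have 1: "(\<Sum>K | card K = p. \<Sum>j\<in>UNIV. \<Sum>k\<in>UNIV. contraction (W k) j K * cnj (contraction (W j) k K)) = of_real ?l" .
  have 2: "(\<Sum>k\<in>UNIV. \<Sum>J | card J = Suc p. W k J * cnj (W k J)) = of_real ?r"
    unfolding of_real_mult of_real_sum sum_product
    by (intro sum.cong refl) (simp add: complex_norm_square W_def mult_ac del: of_real_power)
  have 3: "(\<Sum>L | card L = Suc (Suc p). wedge W L * cnj (wedge W L)) = of_real (\<Sum>L | card L = Suc (Suc p). (cmod (wedge W L))\<^sup>2)"
    by (simp add: complex_norm_square[symmetric])
  have "complex_of_real (\<Sum>L | card L = Suc (Suc p). (cmod (wedge W L))\<^sup>2) = of_real (?r - ?l)"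
    using wedge_norm_identity[of W p] unfolding 1 2 3 by simp
  then have "(\<Sum>L | card L = Suc (Suc p). (cmod (wedge W L))\<^sup>2) = ?r - ?l"
    unfolding of_real_eq_iff .
  moreover have "0 \<le> (\<Sum>L | card L = Suc (Suc p). (cmod (wedge W L))\<^sup>2)"
    by (intro sum_nonneg) auto
  ultimately show ?thesis by linarith
qed

section \<open>Increasing multi-indices as sets\<close>

lemma sum_increasing:
  fixes F :: "'n::{finite,linorder} list \<Rightarrow> 'b::comm_monoid_add"
  shows "(\<Sum>J\<in>increasing p. F J) = (\<Sum>S | card S = p. F (sorted_list_of_set S))"
  by (rule sum.reindex_bij_witness[of _ sorted_list_of_set set])
    (auto simp: increasing_def strict_sorted_iff sorted_list_of_set.idem_if_sorted_distinct distinct_card)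

lemma ball_increasing:
  "(\<forall>J\<in>increasing p. P J) \<longleftrightarrow> (\<forall>S::'n::{finite,linorder} set. card S = p \<longrightarrow> P (sorted_list_of_set S))"
proof safe
  fix J :: "'n list" assume "J \<in> increasing p" and *: "\<forall>S. card S = p \<longrightarrow> P (sorted_list_of_set S)"
  then have "sorted_list_of_set (set J) = J" "card (set J) = p"
    by (auto simp: increasing_def strict_sorted_iff sorted_list_of_set.idem_if_sorted_distinct distinct_card)
  then show "P J" using * by metis
qed (auto simp: increasing_def)

text \<open>The position of an entry in a sorted list is the number of smaller entries; hence the
  sign in \<open>dbar\<close> and \<open>weak_dbar\<close> is \<open>eps\<close>.\<close>

lemma omit_sorted_list:
  assumes "finite S" "i < card S"
  shows "omit i (sorted_list_of_set S) = sorted_list_of_set (S - {sorted_list_of_set S ! i})"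
    "eps (sorted_list_of_set S ! i) S = (-1) ^ i"
proof -
  define K where "K = sorted_list_of_set S"
  have K: "sorted_wrt (<) K" "length K = card S" "set K = S" using assms by (auto simp: K_def)
  have split: "K = take i K @ K ! i # drop (Suc i) K" using assms K by (intro id_take_nth_drop) auto
  have s: "sorted_wrt (<) (take i K @ K ! i # drop (Suc i) K)" using K(1) split by simp
  have s1: "sorted_wrt (<) (omit i K)" using s unfolding sorted_wrt_append by auto
  have st: "set (omit i K) = S - {K ! i}"
  proof -
    have "S = set (take i K @ K ! i # drop (Suc i) K)" using split K by simp
    moreover have "K ! i \<notin> set (omit i K)" using s unfolding sorted_wrt_append by auto
    ultimately show ?thesis by auto
  qed
  show "omit i (sorted_list_of_set S) = sorted_list_of_set (S - {sorted_list_of_set S ! i})"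
    unfolding K_def[symmetric] using s1 st
    by (metis sorted_list_of_set.idem_if_sorted_distinct strict_sorted_iff)
  have "{j \<in> S. j < K ! i} = set (take i K)"
  proof -
    have "S = set (take i K) \<union> {K ! i} \<union> set (drop (Suc i) K)"
      using arg_cong[OF split, of set] K(3) by auto
    then show ?thesis using s unfolding sorted_wrt_append by (auto dest: order.strict_trans)
  qed
  moreover have "card (set (take i K)) = i"
    using K assms by (simp add: distinct_card strict_sorted_iff)
  ultimately show "eps (sorted_list_of_set S ! i) S = (-1) ^ i"
    by (simp add: eps_def K_def)
qed

lemma sum_omit:
  assumes "finite S"
  shows "(\<Sum>i<card S. (-1) ^ i * F (sorted_list_of_set S ! i) (omit i (sorted_list_of_set S)))
    = (\<Sum>k\<in>S. eps k S * F k (sorted_list_of_set (S - {k})))"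
proof -
  have "bij_betw ((!) (sorted_list_of_set S)) {..<card S} S"
    using assms by (intro bij_betw_nth) auto
  then have "(\<Sum>k\<in>S. eps k S * F k (sorted_list_of_set (S - {k}))) =
    (\<Sum>i<card S. eps (sorted_list_of_set S ! i) S * F (sorted_list_of_set S ! i) (sorted_list_of_set (S - {sorted_list_of_set S ! i})))"
    by (rule sum.reindex_bij_betw[symmetric])
  then show ?thesis using omit_sorted_list[OF assms] by simp
qed

lemma dbar_sorted_list:
  "dbar u (sorted_list_of_set S) z = wedge (\<lambda>k J. d_zbar k (u (sorted_list_of_set J)) z) S"
  using sum_omit[of S "\<lambda>k J. d_zbar k (u J) z"] by (simp add: dbar_def wedge_def)

section \<open>Hermitian matrices\<close>

text \<open>The inner product of the library on \<open>complex ^ 'n\<close> is real valued and only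
  the real part of this form. Orthogonality over the complex numbers requires the form
  itself.\<close>

definition herm :: "complex ^ 'n::finite \<Rightarrow> complex ^ 'n \<Rightarrow> complex" where
  "herm x y = (\<Sum>i\<in>UNIV. x $ i * cnj (y $ i))"

lemma inner_eq_Re_herm: "x \<bullet> y = Re (herm x y)"
  by (simp add: inner_vec_def herm_def inner_complex_def)

lemma herm_linear:
  "herm (x + y) z = herm x z + herm y z" "herm (x - y) z = herm x z - herm y z"
  "herm (r *\<^sub>R x) z = of_real r * herm x z" "herm (c *s x) z = c * herm x z"
  "herm z (c *s x) = cnj c * herm z x"
  unfolding herm_def
  by (auto simp: algebra_simps sum.distrib sum_distrib_left sum_subtractf scaleR_conv_of_real[where 'a=complex])

lemma herm_sym: "herm x y = cnj (herm y x)"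
  by (simp add: herm_def mult.commute)

lemma herm_self: "herm x x = of_real ((norm x)\<^sup>2)"
  by (simp add: herm_def power2_norm_eq_inner inner_vec_def complex_norm_square[symmetric] flip: of_real_sum of_real_power)

lemma herm_mult_vec:
  assumes "\<And>k l. cnj (A $ k $ l) = A $ l $ k"
  shows "herm (A *v x) y = herm x (A *v y)"
proof -
  have "herm (A *v x) y = (\<Sum>k\<in>UNIV. \<Sum>l\<in>UNIV. A $ k $ l * x $ l * cnj (y $ k))"
    by (simp add: herm_def matrix_vector_mult_def sum_distrib_right)
  also have "\<dots> = (\<Sum>l\<in>UNIV. \<Sum>k\<in>UNIV. A $ k $ l * x $ l * cnj (y $ k))" by (rule sum.swap)
  also have "\<dots> = herm x (A *v y)"
    by (simp add: herm_def matrix_vector_mult_def sum_distrib_left assms mult_ac)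
  finally show ?thesis .
qed

lemma linear_term_zero:
  fixes b c :: real
  assumes "\<And>t. 0 \<le> 2 * t * b + t * t * c"
  shows "b = 0"
proof (rule ccontr)
  assume "b \<noteq> 0"
  \<comment> \<open>Any positive m with c < 2 m would serve: at t = - b/m the quadratic is (b^2/m)
    (c/m - 2) < 0.\<close>
  define m where "m = \<bar>c\<bar> + 1"
  have m: "m > 0" "c < m" by (auto simp: m_def)
  have "2 * (- b / m) * b + (- b / m) * (- b / m) * c = (b * b / m) * (c / m - 2)"
    using m by (simp add: field_simps)
  also have "\<dots> < 0"
  proof (rule mult_pos_neg)
    show "b * b / m > 0" using m \<open>b \<noteq> 0\<close> by (auto simp: zero_less_divide_iff not_less mult_less_0_iff zero_less_mult_iff)
    show "c / m - 2 < 0" using m by (simp add: field_simps)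
  qed
  finally show False using assms[of "- b / m"] by linarith
qed

text \<open>A minimiser of the quadratic form on the unit sphere of the orthogonal complement of the
  eigenvectors found so far is a further eigenvector.\<close>

lemma hermitian_eigenbasis_partial:
  fixes A :: "complex ^ 'n ^ 'n::finite"
    and I :: "'n set"
  assumes A: "\<And>k l. cnj (A $ k $ l) = A $ l $ k" and "finite I"
  shows "\<exists>e lam. (\<forall>i\<in>I. \<forall>j\<in>I. herm (e i) (e j) = (if i = j then 1 else 0)) \<and>
    (\<forall>i\<in>I. A *v e i = complex_of_real (lam i) *s e i)"
  using assms(2)
proof (induction I rule: finite_induct)
  case empty then show ?case by simp
next
  case (insert j0 I)
  then obtain e lam where e: "\<And>i j. i \<in> I \<Longrightarrow> j \<in> I \<Longrightarrow> herm (e i) (e j) = (if i = j then 1 else 0)"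
    "\<And>i. i \<in> I \<Longrightarrow> A *v e i = complex_of_real (lam i) *s e i" by blast
  define W where "W = {x :: complex ^ 'n. \<forall>i\<in>I. herm x (e i) = 0}"
  \<comment> \<open>\<open>span\<close> is real, so each complex vector enters together with its
    multiple by i. The real dimension is then at most twice the number of vectors, below that of the
    space, and real orthogonality to both vectors is complex orthogonality.\<close>
  define S where "S = e ` I \<union> (\<lambda>i. \<i> *s e i) ` I"
  have "card I < CARD('n)" by (rule psubset_card_mono) (use insert.hyps in auto)
  moreover have "card S \<le> card I + card I"
    unfolding S_def by (rule order_trans[OF card_Un_le]) (intro add_mono card_image_le; use insert.hyps in simp)
  moreover have "finite S" using insert.hyps by (simp add: S_def)
  then have "dim S \<le> card S" using dim_le_card' by blast
  ultimately have "dim S < DIM(complex ^ 'n)" by simp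
  then obtain x0 where x0: "x0 \<noteq> 0" "\<And>y. y \<in> span S \<Longrightarrow> orthogonal x0 y"
    using orthogonal_to_subspace_exists by metis
  have x0W: "x0 \<in> W" unfolding W_def
  proof (rule CollectI, rule ballI)
    fix i assume "i \<in> I"
    then have "x0 \<bullet> e i = 0" "x0 \<bullet> (\<i> *s e i) = 0"
      using x0(2)[OF span_base] by (auto simp: S_def orthogonal_def)
    then show "herm x0 (e i) = 0" by (simp add: inner_eq_Re_herm herm_linear complex_eq_iff)
  qed
  have Wlin: "x + t *\<^sub>R y \<in> W" "t *\<^sub>R x \<in> W" if "x \<in> W" "y \<in> W" for x y t
    using that by (auto simp: W_def herm_linear)
  have AW: "A *v x \<in> W" if "x \<in> W" for x
    using that e(2) by (auto simp: W_def herm_mult_vec[OF A] herm_linear)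
  define K where "K = W \<inter> sphere 0 1"
  have ch: "continuous_on UNIV (\<lambda>x. herm x y)" for y :: "complex ^ 'n"
    unfolding herm_def by (intro continuous_intros)
  have "W = (\<Inter>i\<in>I. {x. herm x (e i) = 0})" by (auto simp: W_def)
  moreover have "closed {x. herm x (e i) = 0}" for i
    by (rule closed_Collect_eq[OF ch continuous_on_const])
  ultimately have "closed W" by auto
  then have "compact K" unfolding K_def by (intro closed_Int_compact) auto
  moreover have "(1 / norm x0) *\<^sub>R x0 \<in> K" using x0 Wlin x0W by (simp add: K_def)
  then have "K \<noteq> {}" by auto
  moreover have "continuous_on K (\<lambda>x. (A *v x) \<bullet> x)"
    unfolding matrix_vector_mult_def by (intro continuous_intros)
  ultimately obtain x where x: "x \<in> K" "\<And>y. y \<in> K \<Longrightarrow> (A *v x) \<bullet> x \<le> (A *v y) \<bullet> y"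
    using continuous_attains_inf[of K "\<lambda>x. (A *v x) \<bullet> x"] by blast
  define m where "m = (A *v x) \<bullet> x"
  have xW: "x \<in> W" "norm x = 1" using x by (auto simp: K_def)
  have Alin: "A *v (y + t *\<^sub>R z) = A *v y + t *\<^sub>R (A *v z)" for y z t
    by (simp add: vec_eq_iff matrix_vector_mult_def scaleR_sum_right sum.distrib algebra_simps)
  have Asc: "A *v (t *\<^sub>R z) = t *\<^sub>R (A *v z)" for z t using Alin[of 0 t z] by simp
  have Asym: "(A *v y) \<bullet> z = y \<bullet> (A *v z)" for y z by (simp add: inner_eq_Re_herm herm_mult_vec[OF A])
  have ge: "0 \<le> (A *v y) \<bullet> y - m * (y \<bullet> y)" if "y \<in> W" for y
  proof (cases "y = 0")
    case False
    have "(1 / norm y) *\<^sub>R y \<in> K" using False Wlin that by (simp add: K_def)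
    from x(2)[OF this] have "m \<le> ((A *v y) \<bullet> y) / (norm y * norm y)"
      by (simp add: m_def Asc)
    then show ?thesis using False by (simp add: pos_le_divide_eq power2_norm_eq_inner[symmetric] power2_eq_square)
  qed (simp add: matrix_vector_mult_def inner_vec_def)
  \<comment> \<open>The residual of the eigenvalue equation. Perturbing the minimiser in the
    direction of its own residual makes the linear term equal to the square norm of the residual,
    which must therefore vanish.\<close>
  define y where "y = A *v x - m *\<^sub>R x"
  have yW: "y \<in> W" unfolding y_def using Wlin(1)[OF AW[OF xW(1)] xW(1), of "- m"] by simp
  have "(A *v x) \<bullet> y - m * (x \<bullet> y) = 0"
  proof (rule linear_term_zero)
    fix t :: real
    have "0 \<le> (A *v (x + t *\<^sub>R y)) \<bullet> (x + t *\<^sub>R y) - m * ((x + t *\<^sub>R y) \<bullet> (x + t *\<^sub>R y))"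
      by (rule ge[OF Wlin(1)[OF xW(1) yW]])
    also have "\<dots> = ((A *v x) \<bullet> x - m * (x \<bullet> x)) + 2 * t * ((A *v x) \<bullet> y - m * (x \<bullet> y)) + t * t * ((A *v y) \<bullet> y - m * (y \<bullet> y))"
      using Asym[of y x] by (simp add: Alin Asc inner_add_left inner_add_right algebra_simps inner_commute)
    also have "(A *v x) \<bullet> x - m * (x \<bullet> x) = 0" using xW by (simp add: m_def power2_norm_eq_inner[symmetric])
    finally show "0 \<le> 2 * t * ((A *v x) \<bullet> y - m * (x \<bullet> y)) + t * t * ((A *v y) \<bullet> y - m * (y \<bullet> y))" by simp
  qed
  then have "y \<bullet> y = 0" by (simp add: y_def inner_diff_left)
  then have eig: "A *v x = complex_of_real m *s x" by (simp add: y_def vec_eq_iff scaleR_conv_of_real[symmetric])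
  have hx: "herm x x = 1" using xW by (simp add: herm_self)
  have hxe: "herm x (e i) = 0" "herm (e i) x = 0" if "i \<in> I" for i
    using xW that herm_sym[of "e i" x] by (auto simp: W_def)
  have "\<forall>i\<in>insert j0 I. \<forall>j\<in>insert j0 I. herm ((e(j0 := x)) i) ((e(j0 := x)) j) = (if i = j then 1 else 0)"
    using insert.hyps e(1) hx hxe by auto
  moreover have "\<forall>i\<in>insert j0 I. A *v (e(j0 := x)) i = complex_of_real ((lam(j0 := m)) i) *s (e(j0 := x)) i"
    using insert.hyps e(2) eig by auto
  ultimately show ?case by blast
qed

text \<open>The hypothesis on the Hessian speaks of roots of the characteristic polynomial, so the
  diagonalisation has to be linked to \<open>eigenvalue_family\<close>: x - A is the diagonal matrix
  with entries x - lam_i, conjugated by the unitary matrix of eigenvectors.\<close>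

lemma hermitian_spectral:
  fixes A :: "complex ^ 'n ^ 'n::finite"
  assumes A: "\<And>k l. cnj (A $ k $ l) = A $ l $ k"
  obtains e :: "'n \<Rightarrow> 'n \<Rightarrow> complex" and lam :: "'n \<Rightarrow> real" where
    "\<And>k l. (\<Sum>i\<in>UNIV. e i k * cnj (e i l)) = (if k = l then 1 else 0)"
    "\<And>i. (\<Sum>k\<in>UNIV. (cmod (e i k))\<^sup>2) = 1"
    "\<And>k l. A $ k $ l = (\<Sum>i\<in>UNIV. of_real (lam i) * e i k * cnj (e i l))"
    "eigenvalue_family A (\<lambda>i. complex_of_real (lam i))"
proof -
  obtain e :: "'n \<Rightarrow> complex ^ 'n" and lam where e: "\<And>i j. herm (e i) (e j) = (if i = j then 1 else 0)"
    "\<And>i. A *v e i = complex_of_real (lam i) *s e i"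
  proof -
    from hermitian_eigenbasis_partial[OF A finite, of UNIV] obtain e :: "'n \<Rightarrow> complex ^ 'n" and lam where
      "\<forall>i\<in>UNIV. \<forall>j\<in>UNIV. herm (e i) (e j) = (if i = j then 1 else 0)"
      "\<forall>i\<in>UNIV. A *v e i = complex_of_real (lam i) *s e i" by blast
    then show ?thesis by (intro that[of e lam]) blast+
  qed
  define P where "P = (\<chi> k i. e i $ k)"
  define Q where "Q = (\<chi> i k. cnj (e i $ k))"
  have "Q ** P = mat 1"
    using e(1) by (simp add: vec_eq_iff matrix_matrix_mult_def Q_def P_def mat_def herm_def mult.commute)

  \<comment> \<open>A one-sided inverse of a square matrix is two-sided; this turns orthonormality
    of the eigenvectors into the completeness relation.\<close>
  then have PQ: "P ** Q = mat 1" using matrix_left_right_inverse by blast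
  then have unit: "(\<Sum>i\<in>UNIV. e i $ k * cnj (e i $ l)) = (if k = l then 1 else 0)" for k l
    by (simp add: vec_eq_iff matrix_matrix_mult_def Q_def P_def mat_def)
  have norm1: "(\<Sum>k\<in>UNIV. (cmod (e i $ k))\<^sup>2) = 1" for i
  proof -
    have "complex_of_real (\<Sum>k\<in>UNIV. (cmod (e i $ k))\<^sup>2) = herm (e i) (e i)"
      by (simp add: herm_def complex_norm_square del: of_real_power)
    then show ?thesis using e(1) by (metis of_real_eq_1_iff)
  qed
  have Aeq: "A $ k $ l = (\<Sum>i\<in>UNIV. of_real (lam i) * e i $ k * cnj (e i $ l))" for k l
  proof -
    have "A = (A ** P) ** Q" using PQ by (simp add: matrix_mul_assoc[symmetric])
    then have "A $ k $ l = ((A ** P) ** Q) $ k $ l" by simp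
    also have "\<dots> = (\<Sum>i\<in>UNIV. (A ** P) $ k $ i * cnj (e i $ l))"
      by (simp add: matrix_matrix_mult_def[of "A ** P"] Q_def)
    finally have "A $ k $ l = (\<Sum>i\<in>UNIV. (A ** P) $ k $ i * cnj (e i $ l))" .
    moreover have "(A ** P) $ k $ i = of_real (lam i) * e i $ k" for i
      using arg_cong[OF e(2)[of i], of "\<lambda>v. v $ k"] by (simp add: matrix_matrix_mult_def P_def matrix_vector_mult_def)
    ultimately show ?thesis by simp
  qed
  have "eigenvalue_family A (\<lambda>i. complex_of_real (lam i))"
    unfolding eigenvalue_family_def
  proof
    fix x :: complex
    define E where "E = (\<chi> i j. if i = j then x - of_real (lam i) else (0 :: complex))"
    have PE: "(P ** E) $ k $ i = e i $ k * (x - of_real (lam i))" for k i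
      by (simp add: matrix_matrix_mult_def P_def E_def if_distrib cong: if_cong)
    have "(P ** E ** Q) $ k $ l = (mat x - A) $ k $ l" for k l
    proof -
      have "(P ** E ** Q) $ k $ l = (\<Sum>i\<in>UNIV. (P ** E) $ k $ i * cnj (e i $ l))"
        by (simp add: matrix_matrix_mult_def[of "P ** E"] Q_def)
      also have "\<dots> = x * (\<Sum>i\<in>UNIV. e i $ k * cnj (e i $ l)) - (\<Sum>i\<in>UNIV. of_real (lam i) * e i $ k * cnj (e i $ l))"
        unfolding PE by (simp add: algebra_simps sum_subtractf sum_distrib_left)
      also have "\<dots> = (mat x - A) $ k $ l" by (simp add: unit Aeq mat_def)
      finally show ?thesis .
    qed
    then have "mat x - A = P ** E ** Q" by (simp add: vec_eq_iff)
    then have "det (mat x - A) = det (P ** Q) * det E" by (simp add: det_mul)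
    also have "\<dots> = (\<Prod>i\<in>UNIV. x - of_real (lam i))"
      unfolding PQ by (simp add: det_diagonal E_def)
    finally show "det (mat x - A) = (\<Prod>i\<in>UNIV. x - of_real (lam i))" .
  qed
  then show ?thesis using that[of "\<lambda>i k. e i $ k" lam] unit norm1 Aeq by blast
qed

text \<open>A linear form on the polytope \<open>0 \<le> m\<^sub>i \<le> N\<close>, \<open>\<Sum> m\<^sub>i = q N\<close> is minimal where \<open>m\<close> is concentrated
  on the \<open>q\<close> smallest coefficients.\<close>

lemma weighted_sum_nonneg:
  fixes lam m :: "'n::finite \<Rightarrow> real"
  assumes "1 \<le> q" "q \<le> CARD('n)" "\<And>I. card I = q \<Longrightarrow> 0 \<le> (\<Sum>i\<in>I. lam i)"
    "\<And>i. 0 \<le> m i" "\<And>i. m i \<le> N" "(\<Sum>i\<in>UNIV. m i) = real q * N"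
  shows "0 \<le> (\<Sum>i\<in>UNIV. lam i * m i)"
proof -
  have "{I :: 'n set. card I = q} \<noteq> {}" using obtain_subset_with_card_n[OF assms(2)] by blast
  then obtain I :: "'n set" where I: "card I = q" "\<And>J. card J = q \<Longrightarrow> sum lam I \<le> sum lam J"
    using ex_is_arg_min_if_finite[of "{I :: 'n set. card I = q}" "sum lam"]
    by (auto simp: is_arg_min_linorder)
  have exch: "lam i \<le> lam j" if "i \<in> I" "j \<notin> I" for i j
  proof -
    have "card (insert j (I - {i})) = q" using that I by (simp add: card.insert_remove) (metis Suc_pred card_gt_0_iff empty_iff finite)
    from I(2)[OF this] have "sum lam I \<le> lam j + sum lam (I - {i})" using that by simp
    then show ?thesis using sum.remove[of I i lam] that by simp
  qed
  have ne: "I \<noteq> {}" using I assms(1) by auto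
  \<comment> \<open>A threshold between the selected coefficients and the others. After subtracting
    it, replacing m by N on \<open>I\<close> and by 0 elsewhere can only decrease the sum, and the
    prescribed total mass shows that the subtraction cancels.\<close>
  define c where "c = Max (lam ` I)"
  have c1: "lam i \<le> c" if "i \<in> I" for i using that by (simp add: c_def)
  have c2: "c \<le> lam j" if "j \<notin> I" for j using that ne exch by (simp add: c_def)
  have "(\<Sum>i\<in>UNIV. lam i * m i) = (\<Sum>i\<in>UNIV. (lam i - c) * m i) + c * (\<Sum>i\<in>UNIV. m i)"
    by (simp add: algebra_simps sum_subtractf sum_distrib_left)
  also have "(\<Sum>i\<in>UNIV. (lam i - c) * m i) \<ge> (\<Sum>i\<in>UNIV. if i \<in> I then (lam i - c) * N else 0)"
    using c1 c2 assms(4,5) by (intro sum_mono) (auto intro!: mult_left_mono_neg mult_nonneg_nonneg)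
  moreover have "(\<Sum>i\<in>UNIV. if i \<in> I then (lam i - c) * N else 0) = N * sum lam I - c * (real q * N)"
    using I(1) by (simp add: sum.If_cases algebra_simps sum_subtractf sum_distrib_left)
  ultimately have "N * sum lam I \<le> (\<Sum>i\<in>UNIV. lam i * m i)" using assms(6) by simp
  moreover have "0 \<le> N * sum lam I"
    using assms(3)[OF I(1)] assms(4,5) by (meson mult_nonneg_nonneg order_trans)
  ultimately show ?thesis by linarith
qed

text \<open>In an eigenbasis the form is \<Sum> lam_i m_i, where m_i is the square norm of the
  contraction of w along e_i. Contraction along a unit vector gives 0 \<le> m_i \<le> |w|^2, and the
  m_i add up to (p + 1) |w|^2, so that exactly sums of p + 1 eigenvalues matter.\<close>

lemma levi_form_nonneg:
  fixes A :: "complex ^ 'n::{finite,linorder} ^ 'n::{finite,linorder}"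
  assumes A: "\<And>k l. cnj (A $ k $ l) = A $ l $ k"
    and q: "Suc p \<le> CARD('n)" "any_q_eigenvalues_sum_nonneg (Suc p) A"
  shows "0 \<le> Re (\<Sum>K | card K = p. \<Sum>j\<in>UNIV. \<Sum>k\<in>UNIV. A $ j $ k * (contraction w j K * cnj (contraction w k K)))"
proof -
  obtain e lam where e: "\<And>k l. (\<Sum>i\<in>UNIV. e i k * cnj (e i l)) = (if k = l then 1 else 0)"
    "\<And>i. (\<Sum>k\<in>UNIV. (cmod (e i k))\<^sup>2) = 1"
    "\<And>k l. A $ k $ l = (\<Sum>i\<in>UNIV. complex_of_real (lam i) * e i k * cnj (e i l))"
    "eigenvalue_family A (\<lambda>i. complex_of_real (lam i))"
    by (rule hermitian_spectral[OF A]) (rule that)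
  define m where "m i = (\<Sum>K | card K = p. (cmod (\<Sum>j\<in>UNIV. e i j * contraction w j K))\<^sup>2)" for i
  define N where "N = (\<Sum>J | card J = Suc p. (cmod (w J))\<^sup>2)"
  have sq: "complex_of_real ((cmod (\<Sum>j\<in>UNIV. e i j * contraction w j K))\<^sup>2) =
     (\<Sum>j\<in>UNIV. \<Sum>k\<in>UNIV. e i j * cnj (e i k) * (contraction w j K * cnj (contraction w k K)))" for i K
    by (simp add: complex_norm_square sum_product mult_ac del: of_real_power)
  have "(\<Sum>K | card K = p. \<Sum>j\<in>UNIV. \<Sum>k\<in>UNIV. A $ j $ k * (contraction w j K * cnj (contraction w k K)))
    = (\<Sum>K | card K = p. \<Sum>j\<in>UNIV. \<Sum>k\<in>UNIV. \<Sum>i\<in>UNIV. of_real (lam i) * (e i j * cnj (e i k) * (contraction w j K * cnj (contraction w k K))))"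
    by (simp add: e(3) sum_distrib_right sum_distrib_left mult_ac)
  also have "\<dots> = (\<Sum>K | card K = p. \<Sum>i\<in>UNIV. \<Sum>j\<in>UNIV. \<Sum>k\<in>UNIV. of_real (lam i) * (e i j * cnj (e i k) * (contraction w j K * cnj (contraction w k K))))"
    by (subst (2) sum.swap, subst (1) sum.swap) (rule refl)
  also have "\<dots> = (\<Sum>K | card K = p. \<Sum>i\<in>UNIV. of_real (lam i) * complex_of_real ((cmod (\<Sum>j\<in>UNIV. e i j * contraction w j K))\<^sup>2))"
    unfolding sq by (simp only: sum_distrib_left)
  also have "\<dots> = (\<Sum>i\<in>UNIV. \<Sum>K | card K = p. of_real (lam i) * complex_of_real ((cmod (\<Sum>j\<in>UNIV. e i j * contraction w j K))\<^sup>2))"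
    by (rule sum.swap)
  also have "\<dots> = of_real (\<Sum>i\<in>UNIV. lam i * m i)"
    by (simp add: m_def sum_distrib_left)
  finally have eq: "(\<Sum>K | card K = p. \<Sum>j\<in>UNIV. \<Sum>k\<in>UNIV. A $ j $ k * (contraction w j K * cnj (contraction w k K)))
    = of_real (\<Sum>i\<in>UNIV. lam i * m i)" .
  have "0 \<le> (\<Sum>i\<in>UNIV. lam i * m i)"
  proof (rule weighted_sum_nonneg[OF _ q(1)])
    show "0 \<le> (\<Sum>i\<in>I. lam i)" if "card I = Suc p" for I
    proof -
      have "(\<Sum>i\<in>I. complex_of_real (lam i)) \<in> \<real>\<^sub>\<ge>\<^sub>0"
        using q(2) e(4) that unfolding any_q_eigenvalues_sum_nonneg_def by blast
      then show ?thesis by (simp flip: of_real_sum add: complex_nonneg_Reals_iff)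
    qed
    show "0 \<le> m i" for i by (auto simp: m_def intro: sum_nonneg)
    show "m i \<le> N" for i
      using contraction_le[where p=p and w=w and \<xi>="e i"] e(2)[of i] by (simp add: m_def N_def)
    have "complex_of_real (\<Sum>i\<in>UNIV. m i) = (\<Sum>i\<in>UNIV. \<Sum>K | card K = p. \<Sum>j\<in>UNIV. \<Sum>k\<in>UNIV. e i j * cnj (e i k) * (contraction w j K * cnj (contraction w k K)))"
      by (simp add: m_def sq del: of_real_power)
    also have "\<dots> = (\<Sum>K | card K = p. \<Sum>j\<in>UNIV. \<Sum>k\<in>UNIV. \<Sum>i\<in>UNIV. e i j * cnj (e i k) * (contraction w j K * cnj (contraction w k K)))"
      by (subst sum.swap, subst (2) sum.swap, subst (3) sum.swap) (rule refl)
    also have "\<dots> = (\<Sum>K | card K = p. \<Sum>j\<in>UNIV. \<Sum>k\<in>UNIV. (if j = k then 1 else 0) * (contraction w j K * cnj (contraction w k K)))"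
      by (simp only: sum_distrib_right[symmetric] e(1))
    also have "\<dots> = complex_of_real (\<Sum>K | card K = p. \<Sum>j\<in>UNIV. (cmod (contraction w j K))\<^sup>2)"
      by (simp add: complex_norm_square if_distrib if_distribR cong: if_cong del: of_real_power)
    finally show "(\<Sum>i\<in>UNIV. m i) = real (Suc p) * N"
      by (simp only: of_real_eq_iff contraction_norm_sum N_def)
  qed simp
  then show ?thesis unfolding eq by simp
qed

section \<open>Square integrable functions\<close>

text \<open>Weierstrass approximation on the compact support passes from polynomials to continuous
  functions, cut-offs of the distance function pass to closed sets, and a Dynkin argument passes to
  Borel sets.\<close>

lemma AE_eq_0_if_polynomial_moments_eq_0:
  fixes h :: "'a::euclidean_space \<Rightarrow> real"
  assumes h: "integrable lborel h" and K: "compact K" "\<And>z. z \<notin> K \<Longrightarrow> h z = 0"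
    and mom: "\<And>P. real_polynomial_function P \<Longrightarrow> (\<integral>z. P z * h z \<partial>lborel) = 0"
  shows "AE z in lborel. h z = 0"
proof -
  have Fint: "integrable lborel (\<lambda>z. F z * h z)" if "continuous_on UNIV F" for F :: "'a \<Rightarrow> real"
  proof -
    have "continuous_on K F" using that continuous_on_subset by blast
    then obtain B where B: "\<And>z. z \<in> K \<Longrightarrow> \<bar>F z\<bar> \<le> B" "B > 0"
      using compact_imp_bounded[OF compact_continuous_image[OF _ K(1)], of F] by (auto simp: bounded_pos)
    show ?thesis
    proof (rule Bochner_Integration.integrable_bound)
      show "integrable lborel (\<lambda>z. B * h z)" using h by simp
      show "(\<lambda>z. F z * h z) \<in> borel_measurable lborel"
        using borel_measurable_continuous_onI[OF that] borel_measurable_integrable[OF h] by simp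
      show "AE z in lborel. norm (F z * h z) \<le> norm (B * h z)"
      proof (rule AE_I2)
        fix z show "norm (F z * h z) \<le> norm (B * h z)"
          using B K(2) by (cases "z \<in> K") (auto simp: abs_mult intro!: mult_right_mono)
      qed
    qed
  qed
  have cont: "(\<integral>z. F z * h z \<partial>lborel) = 0" if F: "continuous_on UNIV F" for F :: "'a \<Rightarrow> real"
  proof -
    define M where "M = (\<integral>z. \<bar>h z\<bar> \<partial>lborel)"
    have M: "M \<ge> 0" by (simp add: M_def)
    have "\<bar>\<integral>z. F z * h z \<partial>lborel\<bar> \<le> e" if "e > 0" for e
    proof -
      have "continuous_on K F" using F continuous_on_subset by blast
      moreover have "0 < e / (M + 1)" using that M by simp
      ultimately obtain P where P: "real_polynomial_function P" "\<And>x. x \<in> K \<Longrightarrow> \<bar>F x - P x\<bar> < e / (M + 1)"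
        using Stone_Weierstrass_real_polynomial_function[OF K(1)] by metis
      have cP: "continuous_on UNIV P"
        using continuous_real_polymonial_function[OF P(1)] by (simp add: continuous_on_eq_continuous_at)
      have "\<bar>\<integral>z. F z * h z \<partial>lborel\<bar> = \<bar>\<integral>z. F z * h z - P z * h z \<partial>lborel\<bar>"
        using mom[OF P(1)] by (simp add: Fint F cP)
      also have "\<dots> \<le> (\<integral>z. \<bar>F z * h z - P z * h z\<bar> \<partial>lborel)"
        by (rule integral_abs_bound)
      also have "\<dots> \<le> (\<integral>z. e / (M + 1) * \<bar>h z\<bar> \<partial>lborel)"
      proof (rule integral_mono)
        show "\<bar>F z * h z - P z * h z\<bar> \<le> e / (M + 1) * \<bar>h z\<bar>" for z
          using mult_right_mono[OF less_imp_le[OF P(2)[of z]] abs_ge_zero[of "h z"]] K(2)[of z]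
          by (cases "z \<in> K") (auto simp: left_diff_distrib[symmetric] abs_mult)
      qed (use h Fint F cP in auto)
      also have "\<dots> = e * (M / (M + 1))" by (simp add: M_def)
      also have "\<dots> \<le> e" using that M by (simp add: field_simps)
      finally show ?thesis .
    qed
    then have "\<bar>\<integral>z. F z * h z \<partial>lborel\<bar> \<le> 0" by (rule field_le_epsilon) simp
    then show ?thesis by simp
  qed
  have Iint: "integrable lborel (\<lambda>z. indicat_real A z * h z)" if "A \<in> sets borel" for A
    using integrable_mult_indicator[OF _ h, of A] that by simp
  have clo: "(\<integral>z. indicat_real C z * h z \<partial>lborel) = 0" if C: "closed C" for C
  proof (cases "C = {}")
    case False
    \<comment> \<open>Continuous functions with values in [0, 1] that decrease to the indicator of
      the closed set \<open>C\<close>.\<close>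
    define F where "F n z = max 0 (1 - real n * infdist z C)" for n z
    have Fc: "continuous_on UNIV (F n)" for n unfolding F_def by (intro continuous_intros)
    have "(\<lambda>n. \<integral>z. F n z * h z \<partial>lborel) \<longlonglongrightarrow> (\<integral>z. indicat_real C z * h z \<partial>lborel)"
    proof (rule integral_dominated_convergence[where w="\<lambda>z. \<bar>h z\<bar>"])
      show "AE z in lborel. (\<lambda>n. F n z * h z) \<longlonglongrightarrow> indicat_real C z * h z"
      proof (rule AE_I2)
        fix z
        have "(\<lambda>n. F n z) \<longlonglongrightarrow> indicat_real C z"
        proof (cases "z \<in> C")
          case False
          then have pos: "infdist z C > 0"
            using in_closed_iff_infdist_zero[OF C \<open>C \<noteq> {}\<close>] infdist_nonneg[of z C] by (metis less_eq_real_def)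
          obtain N where N: "real N * infdist z C > 1" using ex_less_of_nat_mult[OF pos] by metis
          have "\<forall>\<^sub>F n in sequentially. 0 = F n z"
            using eventually_ge_at_top[of N]
          proof eventually_elim
            case (elim n)
            have "real N * infdist z C \<le> real n * infdist z C" using elim pos by simp
            then show ?case using N by (simp add: F_def)
          qed
          then show ?thesis using False by (simp add: Lim_transform_eventually[OF tendsto_const])
        qed (simp add: F_def)
        then show "(\<lambda>n. F n z * h z) \<longlonglongrightarrow> indicat_real C z * h z" by (intro tendsto_intros)
      qed
      show "AE z in lborel. norm (F n z * h z) \<le> \<bar>h z\<bar>" for n
        by (auto simp: abs_mult F_def infdist_nonneg intro!: mult_left_le_one_le)
      show "(\<lambda>z. indicat_real C z * h z) \<in> borel_measurable lborel"
        using Iint[of C] C borel_measurable_integrable by auto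
      show "(\<lambda>z. F n z * h z) \<in> borel_measurable lborel" for n
        using Fint[OF Fc] borel_measurable_integrable by blast
    qed (use h in auto)
    then show ?thesis by (simp add: cont[OF Fc] LIMSEQ_const_iff)
  qed simp
  \<comment> \<open>The closed sets are stable under intersection and generate the Borel
    sets.\<close>
  have all: "(\<integral>z. indicat_real A z * h z \<partial>lborel) = 0" if "A \<in> sets borel" for A
  proof -
    have A: "A \<in> sigma_sets UNIV (Collect closed)" using that by (simp add: borel_eq_closed)
    have sb: "sigma_sets UNIV (Collect closed) = sets (borel :: 'a measure)" by (simp add: borel_eq_closed)
    have "Int_stable (Collect closed :: 'a set set)" by (auto simp: Int_stable_def)
    moreover have "(Collect closed :: 'a set set) \<subseteq> Pow UNIV" by simp
    ultimately show ?thesis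
      using A
    proof (induction rule: sigma_sets_induct_disjoint)
      case (compl A)
      have "(\<integral>z. indicat_real (UNIV - A) z * h z \<partial>lborel)
          = (\<integral>z. indicat_real UNIV z * h z - indicat_real A z * h z \<partial>lborel)"
        by (intro Bochner_Integration.integral_cong) (auto simp: indicator_def)
      also have "\<dots> = (\<integral>z. indicat_real UNIV z * h z \<partial>lborel) - (\<integral>z. indicat_real A z * h z \<partial>lborel)"
        using compl sb by (intro Bochner_Integration.integral_diff Iint) auto
      finally show ?case using clo[of UNIV] compl by simp
    next
      case (union A)
      have Am: "A i \<in> sets lborel" for i using union sb by auto
      have "(LINT z:(\<Union>i. A i)|lborel. h z) = (\<Sum>i. (LINT z:A i|lborel. h z))"
      proof (rule lebesgue_integral_countable_add[OF Am])
        show "set_integrable lborel (\<Union>i. A i) h"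
          using Iint[of "\<Union>i. A i"] Am by (simp add: set_integrable_def)
      qed (use union in \<open>auto simp: disjoint_family_on_def\<close>)
      then show ?case using union by (simp add: set_lebesgue_integral_def)
    qed (use clo in auto)
  qed
  show ?thesis
    using density_unique_real[OF h, of "\<lambda>_. 0"] all by (simp add: set_lebesgue_integral_def)
qed

definition sq_integrable_on :: "'a::euclidean_space set \<Rightarrow> ('a \<Rightarrow> complex) \<Rightarrow> bool" where
  "sq_integrable_on \<Omega> f \<longleftrightarrow>
     set_borel_measurable lborel \<Omega> f \<and> set_integrable lborel \<Omega> (\<lambda>z. (cmod (f z))\<^sup>2)"

lemma set_borel_measurable_mult:
  fixes f g :: "'a \<Rightarrow> complex"
  assumes "set_borel_measurable M A f" "set_borel_measurable M A g"
  shows "set_borel_measurable M A (\<lambda>z. f z * g z)"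
proof -
  have "(\<lambda>x. indicat_real A x *\<^sub>R (f x * g x)) = (\<lambda>x. (indicat_real A x *\<^sub>R f x) * (indicat_real A x *\<^sub>R g x))"
    by (auto simp: indicator_def)
  then show ?thesis using assms unfolding set_borel_measurable_def by (simp only: borel_measurable_times)
qed

lemma set_borel_measurable_add:
  fixes f g :: "'a \<Rightarrow> complex"
  assumes "set_borel_measurable M A f" "set_borel_measurable M A g"
  shows "set_borel_measurable M A (\<lambda>z. f z + g z)"
  using assms unfolding set_borel_measurable_def scaleR_add_right by simp

lemma set_borel_measurable_norm_sq:
  fixes f :: "'a \<Rightarrow> complex"
  assumes "set_borel_measurable M A f"
  shows "set_borel_measurable M A (\<lambda>z. (cmod (f z))\<^sup>2)"
proof -
  have "(\<lambda>x. indicat_real A x *\<^sub>R (cmod (f x))\<^sup>2) = (\<lambda>x. (cmod (indicat_real A x *\<^sub>R f x))\<^sup>2)"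
    by (auto simp: indicator_def)
  moreover have "(\<lambda>x. (cmod (indicat_real A x *\<^sub>R f x))\<^sup>2) \<in> borel_measurable M"
    using measurable_compose[OF assms[unfolded set_borel_measurable_def] borel_measurable_norm]
    by (rule borel_measurable_power)
  ultimately show ?thesis unfolding set_borel_measurable_def by simp
qed

lemma two_mult_norm_le: "2 * (cmod a * cmod b) \<le> (cmod a)\<^sup>2 + (cmod b)\<^sup>2"
  using zero_le_power2[of "cmod a - cmod b"] by (simp add: power2_diff)

lemma sq_integrable_mult:
  assumes "sq_integrable_on \<Omega> f" "sq_integrable_on \<Omega> g"
  shows "set_integrable lborel \<Omega> (\<lambda>z. f z * g z)"
proof (rule set_integrable_bound[where f="\<lambda>z. (cmod (f z))\<^sup>2 + (cmod (g z))\<^sup>2"])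
  show "AE z in lborel. z \<in> \<Omega> \<longrightarrow> norm (f z * g z) \<le> norm ((cmod (f z))\<^sup>2 + (cmod (g z))\<^sup>2)"
  proof (intro AE_I2 impI)
    fix z
    have "cmod (f z) * cmod (g z) \<le> (cmod (f z))\<^sup>2 + (cmod (g z))\<^sup>2"
      using two_mult_norm_le[of "f z" "g z"] mult_nonneg_nonneg[OF norm_ge_zero[of "f z"] norm_ge_zero[of "g z"]]
      by linarith
    then show "norm (f z * g z) \<le> norm ((cmod (f z))\<^sup>2 + (cmod (g z))\<^sup>2)" by (simp add: norm_mult)
  qed
qed (use assms in \<open>auto simp: sq_integrable_on_def intro: set_borel_measurable_mult\<close>)

lemma sq_integrable_add:
  assumes "sq_integrable_on \<Omega> f" "sq_integrable_on \<Omega> g"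
  shows "sq_integrable_on \<Omega> (\<lambda>z. f z + g z)"
  unfolding sq_integrable_on_def
proof
  show m: "set_borel_measurable lborel \<Omega> (\<lambda>z. f z + g z)"
    using assms by (auto simp: sq_integrable_on_def intro: set_borel_measurable_add)
  show "set_integrable lborel \<Omega> (\<lambda>z. (cmod (f z + g z))\<^sup>2)"
  proof (rule set_integrable_bound[where f="\<lambda>z. 2 * (cmod (f z))\<^sup>2 + 2 * (cmod (g z))\<^sup>2"])
    show "AE z in lborel. z \<in> \<Omega> \<longrightarrow> norm ((cmod (f z + g z))\<^sup>2) \<le> norm (2 * (cmod (f z))\<^sup>2 + 2 * (cmod (g z))\<^sup>2)"
    proof (intro AE_I2 impI)
      fix z
      have "(cmod (f z + g z))\<^sup>2 \<le> (cmod (f z) + cmod (g z))\<^sup>2" by (intro power_mono norm_triangle_ineq) auto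
      also have "\<dots> \<le> 2 * (cmod (f z))\<^sup>2 + 2 * (cmod (g z))\<^sup>2"
        using two_mult_norm_le[of "f z" "g z"] by (simp add: power2_sum)
      finally show "norm ((cmod (f z + g z))\<^sup>2) \<le> norm (2 * (cmod (f z))\<^sup>2 + 2 * (cmod (g z))\<^sup>2)" by simp
    qed
  qed (use assms m in \<open>auto simp: sq_integrable_on_def intro: set_borel_measurable_norm_sq\<close>)
qed

lemma sq_integrable_zero: "sq_integrable_on \<Omega> (\<lambda>z. 0)"
  by (simp add: sq_integrable_on_def set_borel_measurable_def set_integrable_def)

lemma sq_integrable_sum:
  "(\<And>i. i \<in> I \<Longrightarrow> sq_integrable_on \<Omega> (f i)) \<Longrightarrow> sq_integrable_on \<Omega> (\<lambda>z. \<Sum>i\<in>I. f i z)"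
  by (induction I rule: infinite_finite_induct) (auto intro: sq_integrable_add sq_integrable_zero)

lemma sq_integrable_cnj: "sq_integrable_on \<Omega> f \<Longrightarrow> sq_integrable_on \<Omega> (\<lambda>z. cnj (f z))"
proof -
  assume a: "sq_integrable_on \<Omega> f"
  have eq: "(\<lambda>x. indicat_real \<Omega> x *\<^sub>R cnj (f x)) = (\<lambda>x. cnj (indicat_real \<Omega> x *\<^sub>R f x))" by auto
  have "(\<lambda>x. cnj (indicat_real \<Omega> x *\<^sub>R f x)) \<in> borel_measurable borel"
    using a by (intro borel_measurable_continuous_on[of cnj] continuous_intros)
      (simp add: sq_integrable_on_def set_borel_measurable_def)
  then show ?thesis
    using a by (simp add: sq_integrable_on_def set_borel_measurable_def flip: eq)
qed

lemma sq_integrable_continuous: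
  assumes "open \<Omega>" "bounded \<Omega>" "continuous_on (closure \<Omega>) f"
  shows "sq_integrable_on \<Omega> f"
  unfolding sq_integrable_on_def
proof
  show "set_integrable lborel \<Omega> (\<lambda>z. (cmod (f z))\<^sup>2)"
    by (intro set_integrable_continuous_closure assms continuous_intros)
  show "set_borel_measurable lborel \<Omega> f"
    using borel_measurable_integrable[OF set_integrable_continuous_closure[OF assms, unfolded set_integrable_def]]
    by (simp add: set_borel_measurable_def)
qed

lemma sq_integrable_mult_continuous:
  assumes "open \<Omega>" "bounded \<Omega>" "continuous_on (closure \<Omega>) c" "sq_integrable_on \<Omega> f"
  shows "sq_integrable_on \<Omega> (\<lambda>z. c z * f z)"
  unfolding sq_integrable_on_def
proof
  show m: "set_borel_measurable lborel \<Omega> (\<lambda>z. c z * f z)"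
    using assms sq_integrable_continuous[OF assms(1-3)]
    by (auto simp: sq_integrable_on_def intro: set_borel_measurable_mult)
  obtain B where B: "\<And>z. z \<in> closure \<Omega> \<Longrightarrow> cmod (c z) \<le> B"
    using compact_imp_bounded[OF compact_continuous_image[OF assms(3)]] assms(2)
    by (auto simp: bounded_iff)
  show "set_integrable lborel \<Omega> (\<lambda>z. (cmod (c z * f z))\<^sup>2)"
  proof (rule set_integrable_bound[where f="\<lambda>z. B\<^sup>2 * (cmod (f z))\<^sup>2"])
    show "AE z in lborel. z \<in> \<Omega> \<longrightarrow> norm ((cmod (c z * f z))\<^sup>2) \<le> norm (B\<^sup>2 * (cmod (f z))\<^sup>2)"
      using B closure_subset[of \<Omega>]
      by (intro AE_I2) (auto simp: norm_mult power_mult_distrib intro!: mult_right_mono power_mono)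
  qed (use assms m in \<open>auto simp: sq_integrable_on_def intro: set_borel_measurable_norm_sq\<close>)
qed

lemma set_integrable_sum:
  fixes f :: "'i \<Rightarrow> 'a \<Rightarrow> 'b::{banach,second_countable_topology}"
  assumes "\<And>i. i \<in> I \<Longrightarrow> set_integrable M A (f i)"
  shows "set_integrable M A (\<lambda>z. \<Sum>i\<in>I. f i z)"
  using assms unfolding set_integrable_def scaleR_sum_right by (intro Bochner_Integration.integrable_sum)

lemma set_lebesgue_integral_sum:
  fixes f :: "'i \<Rightarrow> 'a \<Rightarrow> 'b::{banach,second_countable_topology}"
  assumes "\<And>i. i \<in> I \<Longrightarrow> set_integrable M A (f i)"
  shows "(LINT z:A|M. \<Sum>i\<in>I. f i z) = (\<Sum>i\<in>I. LINT z:A|M. f i z)"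
  using assms unfolding set_integrable_def set_lebesgue_integral_def scaleR_sum_right
  by (intro Bochner_Integration.integral_sum)

lemma set_lebesgue_integral_cong':
  "(\<And>z. z \<in> A \<Longrightarrow> f z = g z) \<Longrightarrow> (LINT z:A|M. f z) = (LINT z:A|M. g z)"
  unfolding set_lebesgue_integral_def
  by (intro Bochner_Integration.integral_cong) (auto simp: indicator_def)

lemma set_integrable_cong':
  "(\<And>z. z \<in> A \<Longrightarrow> f z = g z) \<Longrightarrow> set_integrable M A f \<Longrightarrow> set_integrable M A g"
  unfolding set_integrable_def
  by (erule Bochner_Integration.integrable_cong[THEN iffD1, OF refl, rotated]) (auto simp: indicator_def)

lemma AE_eq_0_if_polynomial_moments_eq_0_complex:
  fixes h :: "'a::euclidean_space \<Rightarrow> complex"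
  assumes "bounded \<Omega>" and h: "set_integrable lborel \<Omega> h"
    and mom: "\<And>P. real_polynomial_function P \<Longrightarrow> (LINT z:\<Omega>|lborel. complex_of_real (P z) * h z) = 0"
    and Pint: "\<And>P. real_polynomial_function P \<Longrightarrow> set_integrable lborel \<Omega> (\<lambda>z. complex_of_real (P z) * h z)"
  shows "AE z in lborel. z \<in> \<Omega> \<longrightarrow> h z = 0"
proof -
  let ?H = "\<lambda>z. indicat_real \<Omega> z *\<^sub>R h z"
  have H: "integrable lborel ?H" using h by (simp add: set_integrable_def)
  have out: "?H z = 0" if "z \<notin> closure \<Omega>" for z using that closure_subset[of \<Omega>] by (auto simp: indicator_def)
  have cpt: "compact (closure \<Omega>)" using assms(1) by simp
  have eq: "P z *\<^sub>R ?H z = indicat_real \<Omega> z *\<^sub>R (complex_of_real (P z) * h z)" for P z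
    by (simp add: scaleR_conv_of_real)
  have PH: "(\<integral>z. P z *\<^sub>R ?H z \<partial>lborel) = 0" "integrable lborel (\<lambda>z. P z *\<^sub>R ?H z)" if "real_polynomial_function P" for P
    using mom[OF that] Pint[OF that] unfolding eq by (simp_all add: set_lebesgue_integral_def set_integrable_def)
  have Re: "AE z in lborel. Re (?H z) = 0"
  proof (rule AE_eq_0_if_polynomial_moments_eq_0[OF _ cpt])
    fix P :: "'a \<Rightarrow> real" assume "real_polynomial_function P"
    then show "(\<integral>z. P z * Re (?H z) \<partial>lborel) = 0"
      using PH[of P] integral_Re[of lborel "\<lambda>z. P z *\<^sub>R ?H z"] by (simp add: mult.assoc)
  next
    show "integrable lborel (\<lambda>z. Re (?H z))" by (rule integrable_Re[OF H])
    show "Re (?H z) = 0" if "z \<notin> closure \<Omega>" for z using out[OF that] by (simp only: zero_complex.sel)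
  qed
  have Im: "AE z in lborel. Im (?H z) = 0"
  proof (rule AE_eq_0_if_polynomial_moments_eq_0[OF _ cpt])
    fix P :: "'a \<Rightarrow> real" assume "real_polynomial_function P"
    then show "(\<integral>z. P z * Im (?H z) \<partial>lborel) = 0"
      using PH[of P] integral_Im[of lborel "\<lambda>z. P z *\<^sub>R ?H z"] by (simp add: mult.assoc)
  next
    show "integrable lborel (\<lambda>z. Im (?H z))" by (rule integrable_Im[OF H])
    show "Im (?H z) = 0" if "z \<notin> closure \<Omega>" for z using out[OF that] by (simp only: zero_complex.sel)
  qed
  from Re Im show ?thesis
    by eventually_elim (auto simp: complex_eq_iff indicator_def)
qed

lemma smooth_real_polynomial_function:
  "real_polynomial_function P \<Longrightarrow> smooth P"
  by (induction rule: real_polynomial_function.induct)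
    (auto intro: smooth_linear smooth_add smooth_mult)

section \<open>The adjoint of \<open>dbar\<close> on forms smooth up to the boundary\<close>

text \<open>From here on multi-indices are handled as sets, so that the exterior algebra developed
  above applies to the operators of the statement.\<close>

lemma weak_dbar_sets:
  fixes f g :: "'n::{finite,linorder} form"
  shows "weak_dbar \<Omega> p f g \<longleftrightarrow>
    (\<forall>J. card J = p \<longrightarrow> sq_integrable_on \<Omega> (f (sorted_list_of_set J))) \<and>
    (\<forall>S. card S = Suc p \<longrightarrow> sq_integrable_on \<Omega> (g (sorted_list_of_set S))) \<and>
    (\<forall>S. card S = Suc p \<longrightarrow> (\<forall>\<phi>. test_function \<Omega> \<phi> \<longrightarrow>
      (LINT z:\<Omega>|lborel. g (sorted_list_of_set S) z * \<phi> z) =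
      - (LINT z:\<Omega>|lborel. \<Sum>k\<in>S. eps k S * (f (sorted_list_of_set (S - {k})) z * d_zbar k \<phi> z))))"
proof -
  have "(\<Sum>i<Suc p. (-1) ^ i * f (omit i (sorted_list_of_set S)) z * d_zbar (sorted_list_of_set S ! i) \<phi> z)
    = (\<Sum>k\<in>S. eps k S * (f (sorted_list_of_set (S - {k})) z * d_zbar k \<phi> z))"
    if "card S = Suc p" for S :: "'n set" and \<phi> z
    using sum_omit[of S "\<lambda>k J. f J z * d_zbar k \<phi> z"] that by (simp add: mult.assoc)
  then show ?thesis
    unfolding weak_dbar_def L2_form_def sq_integrable_on_def[symmetric] ball_increasing by auto
qed

lemma is_dbar_star_sets:
  fixes u v :: "'n::{finite,linorder} form"
  shows "is_dbar_star \<Omega> (Suc p) u v \<longleftrightarrow>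
    (\<forall>S. card S = Suc p \<longrightarrow> sq_integrable_on \<Omega> (u (sorted_list_of_set S))) \<and>
    (\<forall>K. card K = p \<longrightarrow> sq_integrable_on \<Omega> (v (sorted_list_of_set K))) \<and>
    (\<forall>f g. weak_dbar \<Omega> p f g \<longrightarrow>
      (LINT z:\<Omega>|lborel. \<Sum>S | card S = Suc p. g (sorted_list_of_set S) z * cnj (u (sorted_list_of_set S) z)) =
      (LINT z:\<Omega>|lborel. \<Sum>K | card K = p. f (sorted_list_of_set K) z * cnj (v (sorted_list_of_set K) z)))"
  unfolding is_dbar_star_def L2_form_def L2_inner_def sq_integrable_on_def[symmetric] ball_increasing sum_increasing
  by simp

text \<open>Contraction is the adjoint of exterior multiplication. The separate factor
  \<open>a\<close> allows both uses: a = 1 with derivatives in \<open>f\<close>, and a the gradient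
  of \<rho> with a form \<open>f\<close> that is merely square integrable.\<close>

lemma sum_wedge_cnj:
  fixes w :: "'n::{finite,linorder} set \<Rightarrow> complex"
  shows "(\<Sum>S | card S = Suc p. wedge (\<lambda>k J. a k * f k J) S * cnj (w S))
    = (\<Sum>K | card K = p. \<Sum>k\<in>UNIV. a k * f k K * cnj (contraction w k K))"
proof -
  have "(\<Sum>S | card S = Suc p. wedge (\<lambda>k J. a k * f k J) S * cnj (w S))
    = (\<Sum>S | card S = Suc p. \<Sum>k\<in>S. eps k S * (a k * f k (S - {k})) * cnj (w S))"
    by (simp add: wedge_def sum_distrib_right)
  also have "\<dots> = (\<Sum>K | card K = p. \<Sum>k\<in>-K. eps k (insert k K) * (a k * f k (insert k K - {k})) * cnj (w (insert k K)))"
    by (rule sum_subsets_swap)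
  also have "\<dots> = (\<Sum>K | card K = p. \<Sum>k\<in>UNIV. a k * f k K * cnj (contraction w k K))"
    by (intro sum.cong refl sum.mono_neutral_cong_left)
      (auto simp: contraction_def eps_insert insert_Diff_if)
  finally show ?thesis .
qed

locale smooth_domain =
  fixes \<Omega> :: "(complex ^ 'n::{finite,linorder}) set" and \<rho> :: "(complex, 'n) vec \<Rightarrow> real"
  assumes open_domain: "open \<Omega>" and bounded_domain: "bounded \<Omega>" and defining: "defining_function \<Omega> \<rho>"
begin

abbreviation R :: "(complex, 'n) vec \<Rightarrow> complex" where "R z \<equiv> complex_of_real (\<rho> z)"

lemma smooth_rho: "smooth \<rho>" and domain_eq: "\<Omega> = {z. \<rho> z < 0}"
  and grad_nz: "\<rho> z = 0 \<Longrightarrow> frechet_derivative \<rho> (at z) \<noteq> (\<lambda>h. 0)"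
  using defining by (auto simp: defining_function_def)

lemma smooth_R: "smooth R" by (rule smooth_of_real[OF smooth_rho])

lemma rho_closure: "z \<in> closure \<Omega> \<Longrightarrow> \<rho> z \<le> 0"
proof -
  have "closed {z. \<rho> z \<le> 0}"
    by (intro closed_Collect_le continuous_intros smooth_continuous_on smooth_rho)
  then have "closure \<Omega> \<subseteq> {z. \<rho> z \<le> 0}" by (intro closure_minimal) (auto simp: domain_eq)
  then show "z \<in> closure \<Omega> \<Longrightarrow> \<rho> z \<le> 0" by auto
qed

lemma rho_frontier: "z \<in> frontier \<Omega> \<Longrightarrow> \<rho> z = 0"
  using rho_closure[of z] open_domain by (auto simp: frontier_def interior_open domain_eq)

lemma frontier_null: "frontier \<Omega> \<in> null_sets lborel"
  by (rule null_sets_subset[OF null_sets_zero_set[OF smooth_rho grad_nz]]) (auto simp: rho_frontier)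

lemma compact_closure: "compact (closure \<Omega>)" using bounded_domain by simp

lemma domain_subset_closure: "z \<in> \<Omega> \<Longrightarrow> z \<in> closure \<Omega>" using closure_subset by blast

lemmas sq_int_cont = sq_integrable_continuous[OF open_domain bounded_domain]
lemmas int_cont = set_integrable_continuous_closure[OF open_domain bounded_domain]
lemmas div_thm = integral_d_z_eq_0[OF open_domain bounded_domain frontier_null]
lemmas sq_int_mult_cont = sq_integrable_mult_continuous[OF open_domain bounded_domain]

lemma integration_by_parts:
  assumes "closure \<Omega> \<subseteq> U" "C1_on U f" "C1_on U g" "\<And>x. x \<in> frontier \<Omega> \<Longrightarrow> f x * g x = 0"
  shows "(LINT z:\<Omega>|lborel. f z * d_z k g z) = - (LINT z:\<Omega>|lborel. d_z k f z * g z)"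
    "(LINT z:\<Omega>|lborel. f z * d_zbar k g z) = - (LINT z:\<Omega>|lborel. d_zbar k f z * g z)"
proof -
  have c: "continuous_on (closure \<Omega>) h" if "continuous_on U h" for h :: "(complex, 'n) vec \<Rightarrow> complex"
    using that assms(1) continuous_on_subset by blast
  note cs = c[OF C1_onD(3)[OF assms(2)]] c[OF C1_onD(3)[OF assms(3)]]
    c[OF C1_on_continuous_d_z(1)[OF assms(2)]] c[OF C1_on_continuous_d_z(1)[OF assms(3)]]
    c[OF C1_on_continuous_d_z(2)[OF assms(2)]] c[OF C1_on_continuous_d_z(2)[OF assms(3)]]
  have d: "f differentiable (at z)" "g differentiable (at z)" if "z \<in> \<Omega>" for z
    using C1_onD(1)[OF assms(2)] C1_onD(1)[OF assms(3)] that assms(1) domain_subset_closure by blast+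
  have "0 = (LINT z:\<Omega>|lborel. d_z k (\<lambda>x. f x * g x) z)"
    by (rule div_thm(1)[OF assms(1) C1_on_mult[OF assms(2,3)] assms(4), symmetric])
  also have "\<dots> = (LINT z:\<Omega>|lborel. f z * d_z k g z + d_z k f z * g z)"
    by (rule set_lebesgue_integral_cong') (simp add: d_z_mult d)
  also have "\<dots> = (LINT z:\<Omega>|lborel. f z * d_z k g z) + (LINT z:\<Omega>|lborel. d_z k f z * g z)"
    by (intro set_integral_add int_cont continuous_intros cs)
  finally show "(LINT z:\<Omega>|lborel. f z * d_z k g z) = - (LINT z:\<Omega>|lborel. d_z k f z * g z)"
    by (simp add: eq_neg_iff_add_eq_0)
  have "0 = (LINT z:\<Omega>|lborel. d_zbar k (\<lambda>x. f x * g x) z)"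
    by (rule div_thm(2)[OF assms(1) C1_on_mult[OF assms(2,3)] assms(4), symmetric])
  also have "\<dots> = (LINT z:\<Omega>|lborel. f z * d_zbar k g z + d_zbar k f z * g z)"
    by (rule set_lebesgue_integral_cong') (simp add: d_z_mult d)
  also have "\<dots> = (LINT z:\<Omega>|lborel. f z * d_zbar k g z) + (LINT z:\<Omega>|lborel. d_zbar k f z * g z)"
    by (intro set_integral_add int_cont continuous_intros cs)
  finally show "(LINT z:\<Omega>|lborel. f z * d_zbar k g z) = - (LINT z:\<Omega>|lborel. d_zbar k f z * g z)"
    by (simp add: eq_neg_iff_add_eq_0)
qed

lemma test_function_frontier:
  assumes "test_function \<Omega> \<phi>" "x \<in> frontier \<Omega>" shows "\<phi> x = 0"
  using assms open_domain closure_subset[of "{z. \<phi> z \<noteq> 0}"]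
  by (auto simp: test_function_def frontier_def interior_open)

text \<open>Test functions vanish on the frontier, so integration by parts shows that the classical
  dbar is the distributional one. Such forms, whatever their boundary values, may therefore be
  inserted into the adjoint relation.\<close>

lemma weak_dbar_C1:
  assumes U: "closure \<Omega> \<subseteq> U" and f: "\<And>J. card J = p \<Longrightarrow> C1_on U (f J)"
  shows "weak_dbar \<Omega> p (\<lambda>J. f (set J)) (\<lambda>S z. wedge (\<lambda>k J. d_zbar k (f J) z) (set S))"
proof -
  have fc: "continuous_on (closure \<Omega>) (f J)" "continuous_on (closure \<Omega>) (d_zbar k (f J))" if "card J = p" for J k
    using C1_onD(3)[OF f[OF that]] C1_on_continuous_d_z(2)[OF f[OF that]] U continuous_on_subset by blast+
  have card: "card (S - {k}) = p" if "card S = Suc p" "k \<in> S" for S :: "'n set" and k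
    using that by simp
  have wc: "continuous_on (closure \<Omega>) (\<lambda>z. wedge (\<lambda>k J. d_zbar k (f J) z) S)" if "card S = Suc p" for S
    unfolding wedge_def using that by (intro continuous_intros fc card)
  have "(LINT z:\<Omega>|lborel. wedge (\<lambda>k J. d_zbar k (f J) z) S * \<phi> z) =
      - (LINT z:\<Omega>|lborel. \<Sum>k\<in>S. eps k S * (f (S - {k}) z * d_zbar k \<phi> z))"
    if S: "card S = Suc p" and \<phi>: "test_function \<Omega> \<phi>" for S \<phi>
  proof -
    have s: "smooth \<phi>" using \<phi> by (simp add: test_function_def)
    have pc: "continuous_on (closure \<Omega>) \<phi>" "continuous_on (closure \<Omega>) (d_zbar k \<phi>)" for k
      using smooth_continuous_on[OF s] smooth_continuous_on[OF smooth_d_z(2)[OF s]] .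
    have "(LINT z:\<Omega>|lborel. wedge (\<lambda>k J. d_zbar k (f J) z) S * \<phi> z)
       = (LINT z:\<Omega>|lborel. \<Sum>k\<in>S. eps k S * (d_zbar k (f (S - {k})) z * \<phi> z))"
      by (simp add: wedge_def sum_distrib_right mult.assoc)
    also have "\<dots> = (\<Sum>k\<in>S. LINT z:\<Omega>|lborel. eps k S * (d_zbar k (f (S - {k})) z * \<phi> z))"
      using S by (intro set_lebesgue_integral_sum int_cont continuous_intros pc fc card)
    also have "\<dots> = (\<Sum>k\<in>S. - (LINT z:\<Omega>|lborel. eps k S * (f (S - {k}) z * d_zbar k \<phi> z)))"
    proof (intro sum.cong refl)
      fix k assume "k \<in> S"
      have "(LINT z:\<Omega>|lborel. f (S - {k}) z * d_zbar k \<phi> z) = - (LINT z:\<Omega>|lborel. d_zbar k (f (S - {k})) z * \<phi> z)"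
        using test_function_frontier[OF \<phi>]
        by (intro integration_by_parts(2)[OF U f[OF card[OF S \<open>k \<in> S\<close>]] C1_on_smooth[OF s]]) auto
      then show "(LINT z:\<Omega>|lborel. eps k S * (d_zbar k (f (S - {k})) z * \<phi> z)) =
          - (LINT z:\<Omega>|lborel. eps k S * (f (S - {k}) z * d_zbar k \<phi> z))"
        by simp
    qed
    also have "\<dots> = - (LINT z:\<Omega>|lborel. \<Sum>k\<in>S. eps k S * (f (S - {k}) z * d_zbar k \<phi> z))"
      using S by (subst set_lebesgue_integral_sum) (auto simp: sum_negf intro!: int_cont continuous_intros pc fc card)
    finally show ?thesis .
  qed
  then show ?thesis
    unfolding weak_dbar_sets using sq_int_cont[OF fc(1)] sq_int_cont[OF wc] by simp
qed

text \<open>The parameter \<open>p\<close> is one less than the degree: \<open>u\<close> is a \<open>(0, p + 1)\<close>-form.\<close>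

definition extends :: "nat \<Rightarrow> 'n form \<Rightarrow> ('n set \<Rightarrow> (complex, 'n) vec \<Rightarrow> complex) \<Rightarrow> bool" where
  "extends p u w \<longleftrightarrow> (\<forall>S. smooth (w S)) \<and>
     (\<forall>S. card S = Suc p \<longrightarrow> (\<forall>z\<in>closure \<Omega>. u (sorted_list_of_set S) z = w S z)) \<and>
     u \<in> dom_dbar_star \<Omega> (Suc p)"

lemma D_forms_extends: "u \<in> D_forms \<Omega> (Suc p) \<Longrightarrow> \<exists>w. extends p u w"
proof -
  assume u: "u \<in> D_forms \<Omega> (Suc p)"
  have "\<exists>g. smooth g \<and> (card S = Suc p \<longrightarrow> (\<forall>z\<in>closure \<Omega>. u (sorted_list_of_set S) z = g z))" for S
  proof (cases "card S = Suc p")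
    case True
    then show ?thesis using u
      unfolding D_forms_def ball_increasing smooth_up_to_boundary_def by auto
  qed (auto intro: smooth_const)
  then obtain w where "\<forall>S. smooth (w S) \<and> (card S = Suc p \<longrightarrow> (\<forall>z\<in>closure \<Omega>. u (sorted_list_of_set S) z = w S z))"
    by metis
  then show ?thesis using u unfolding extends_def D_forms_def by auto
qed

definition con :: "('n set \<Rightarrow> (complex, 'n) vec \<Rightarrow> complex) \<Rightarrow> 'n \<Rightarrow> 'n set \<Rightarrow> (complex, 'n) vec \<Rightarrow> complex" where
  "con w k K z = contraction (\<lambda>S. w S z) k K"

text \<open>The formal adjoint of dbar without its minus sign.\<close>

definition divergence :: "('n set \<Rightarrow> (complex, 'n) vec \<Rightarrow> complex) \<Rightarrow> 'n set \<Rightarrow> (complex, 'n) vec \<Rightarrow> complex" where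
  "divergence w K z = (\<Sum>j\<in>UNIV. d_z j (con w j K) z)"

text \<open>Contraction with the gradient \<partial>\<rho>; its vanishing on the boundary is the
  classical description of the domain of the adjoint.\<close>

definition normal_part :: "('n set \<Rightarrow> (complex, 'n) vec \<Rightarrow> complex) \<Rightarrow> 'n set \<Rightarrow> (complex, 'n) vec \<Rightarrow> complex" where
  "normal_part w K z = (\<Sum>k\<in>UNIV. d_z k R z * con w k K z)"

lemma smooth_con: "(\<And>S. smooth (w S)) \<Longrightarrow> smooth (con w k K)"
  unfolding con_def[abs_def] contraction_def by (cases "k \<in> K") (auto intro: smooth_cmult)

lemma smooth_divergence: "(\<And>S. smooth (w S)) \<Longrightarrow> smooth (divergence w K)"
  unfolding divergence_def[abs_def] by (intro smooth_sum smooth_d_z smooth_con)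

lemma smooth_normal_part: "(\<And>S. smooth (w S)) \<Longrightarrow> smooth (normal_part w K)"
  unfolding normal_part_def[abs_def] by (intro smooth_sum smooth_mult smooth_d_z smooth_con smooth_R)

lemma cnj_d_z_R: "cnj (d_z k R z) = d_zbar k R z"
  by (rule d_z_of_real[OF smooth_differentiable[OF smooth_rho]])

lemma dbar_star_works:
  assumes "extends p u w"
  shows "is_dbar_star \<Omega> (Suc p) u (dbar_star \<Omega> (Suc p) u)"
  using assms unfolding extends_def dom_dbar_star_def dbar_star_def by (metis (mono_tags, lifting) mem_Collect_eq someI)

text \<open>The adjoint relation with explicit test forms. Boundary values of \<open>f\<close> are
  arbitrary; this freedom replaces an integration by parts in the twisted identity and encodes the
  boundary condition on \<open>u\<close>.\<close>

lemma adjoint_C1: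
  assumes u: "extends p u w" and U: "closure \<Omega> \<subseteq> U" and f: "\<And>J. card J = p \<Longrightarrow> C1_on U (f J)"
  shows "(LINT z:\<Omega>|lborel. \<Sum>K | card K = p. \<Sum>k\<in>UNIV. d_zbar k (f K) z * cnj (con w k K z)) =
    (LINT z:\<Omega>|lborel. \<Sum>K | card K = p. f K z * cnj (dbar_star \<Omega> (Suc p) u (sorted_list_of_set K) z))"
proof -
  have "(LINT z:\<Omega>|lborel. \<Sum>K | card K = p. f K z * cnj (dbar_star \<Omega> (Suc p) u (sorted_list_of_set K) z))
    = (LINT z:\<Omega>|lborel. \<Sum>S | card S = Suc p. wedge (\<lambda>k J. d_zbar k (f J) z) S * cnj (u (sorted_list_of_set S) z))"
    using dbar_star_works[OF u] weak_dbar_C1[OF U f] unfolding is_dbar_star_sets by fastforce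
  also have "\<dots> = (LINT z:\<Omega>|lborel. \<Sum>K | card K = p. \<Sum>k\<in>UNIV. d_zbar k (f K) z * cnj (con w k K z))"
  proof (rule set_lebesgue_integral_cong')
    fix z assume "z \<in> \<Omega>"
    then have "(\<Sum>S | card S = Suc p. wedge (\<lambda>k J. d_zbar k (f J) z) S * cnj (u (sorted_list_of_set S) z))
        = (\<Sum>S | card S = Suc p. wedge (\<lambda>k J. d_zbar k (f J) z) S * cnj (w S z))"
      using u domain_subset_closure unfolding extends_def by (intro sum.cong refl) auto
    also have "\<dots> = (\<Sum>K | card K = p. \<Sum>k\<in>UNIV. d_zbar k (f K) z * cnj (con w k K z))"
      using sum_wedge_cnj[where p=p and a="\<lambda>_. 1" and f="\<lambda>k J. d_zbar k (f J) z" and w="\<lambda>S. w S z"] by (simp add: con_def)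
    finally show "(\<Sum>S | card S = Suc p. wedge (\<lambda>k J. d_zbar k (f J) z) S * cnj (u (sorted_list_of_set S) z))
      = (\<Sum>K | card K = p. \<Sum>k\<in>UNIV. d_zbar k (f K) z * cnj (con w k K z))" .
  qed
  finally show ?thesis by simp
qed

text \<open>Testing with \<open>\<rho>\<close> times a polynomial avoids boundary terms; \<open>\<rho>\<close> has no zero in \<open>\<Omega>\<close>.\<close>

lemma dbar_star_eq_divergence:
  assumes u: "extends p u w" and K0: "card K0 = p"
  shows "AE z in lborel. z \<in> \<Omega> \<longrightarrow> dbar_star \<Omega> (Suc p) u (sorted_list_of_set K0) z = - divergence w K0 z"
proof -
  let ?v = "dbar_star \<Omega> (Suc p) u (sorted_list_of_set K0)"
  have w: "smooth (w S)" for S using u by (simp add: extends_def)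
  have v: "sq_integrable_on \<Omega> ?v"
    using dbar_star_works[OF u] K0 unfolding is_dbar_star_sets by blast
  have dc: "continuous_on A (divergence w K0)" for A by (rule smooth_continuous_on[OF smooth_divergence[OF w]])
  have Rc: "continuous_on A R" for A by (rule smooth_continuous_on[OF smooth_R])
  \<comment> \<open>The conjugated difference of the two candidates, multiplied by \<rho>. Its
    moment against a polynomial P is the adjoint relation tested with P \<rho>.\<close>
  define h where "h z = R z * cnj (?v z + divergence w K0 z)" for z
  have h: "sq_integrable_on \<Omega> h"
    unfolding h_def by (intro sq_int_mult_cont Rc sq_integrable_cnj sq_integrable_add v sq_int_cont dc)
  have Pint: "set_integrable lborel \<Omega> (\<lambda>z. complex_of_real (P z) * h z)" if "continuous_on (closure \<Omega>) P" for P
    by (intro sq_integrable_mult h sq_int_cont continuous_intros that)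
  have Pc: "continuous_on A P" if "real_polynomial_function P" for P and A :: "((complex, 'n) vec) set"
    using smooth_continuous_on[OF smooth_real_polynomial_function[OF that]] .
  have "AE z in lborel. z \<in> \<Omega> \<longrightarrow> h z = 0"
  proof (rule AE_eq_0_if_polynomial_moments_eq_0_complex[OF bounded_domain])
    show "set_integrable lborel \<Omega> h" using Pint[of "\<lambda>_. 1"] by simp
    fix P :: "(complex, 'n) vec \<Rightarrow> real" assume P: "real_polynomial_function P"
    show "set_integrable lborel \<Omega> (\<lambda>z. complex_of_real (P z) * h z)" by (rule Pint[OF Pc[OF P]])
    define F where "F z = complex_of_real (P z) * R z" for z
    have sF: "smooth F" unfolding F_def
      by (intro smooth_mult smooth_of_real smooth_real_polynomial_function P smooth_rho)
    have F0: "F x = 0" if "x \<in> frontier \<Omega>" for x using rho_frontier[OF that] by (simp add: F_def)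
    \<comment> \<open>A test form with a single nonzero coefficient isolates the component
      \<open>K0\<close>.\<close>
    define f where "f K = (if K = K0 then F else (\<lambda>z. 0))" for K
    have fC: "C1_on UNIV (f J)" for J unfolding f_def using C1_on_smooth[OF sF] by (auto simp: C1_on_const)
    have Fc: "continuous_on A F" "continuous_on A (d_zbar k F)" for A k
      by (intro smooth_continuous_on smooth_d_z sF)+
    have cc: "continuous_on A (con w k K0)" "continuous_on A (d_z k (con w k K0))" for A k
      by (intro smooth_continuous_on smooth_d_z smooth_con w)+
    have only: "(\<Sum>K | card K = p. f K z * g K) = F z * g K0" for z and g :: "'n set \<Rightarrow> complex"
      by (subst sum.remove[of _ K0]) (auto simp: K0 f_def)
    have only': "(\<Sum>K | card K = p. \<Sum>k\<in>UNIV. d_zbar k (f K) z * g k K) = (\<Sum>k\<in>UNIV. d_zbar k F z * g k K0)"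
      for z and g :: "'n \<Rightarrow> 'n set \<Rightarrow> complex"
      by (subst sum.remove[of _ K0]) (auto simp: K0 f_def d_z_const)
    have "(LINT z:\<Omega>|lborel. F z * cnj (?v z)) = (LINT z:\<Omega>|lborel. \<Sum>k\<in>UNIV. d_zbar k F z * cnj (con w k K0 z))"
      using adjoint_C1[OF u subset_UNIV, of f, OF fC] unfolding only only' by simp
    also have "\<dots> = (\<Sum>k\<in>UNIV. LINT z:\<Omega>|lborel. d_zbar k F z * cnj (con w k K0 z))"
      by (intro set_lebesgue_integral_sum int_cont continuous_intros Fc cc)
    also have "\<dots> = (\<Sum>k\<in>UNIV. - (LINT z:\<Omega>|lborel. F z * cnj (d_z k (con w k K0) z)))"
    proof (intro sum.cong refl)
      fix k
      have "(LINT z:\<Omega>|lborel. F z * d_zbar k (\<lambda>z. cnj (con w k K0 z)) z) = - (LINT z:\<Omega>|lborel. d_zbar k F z * cnj (con w k K0 z))"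
        by (rule integration_by_parts(2)[of UNIV])
          (auto intro!: C1_on_smooth sF smooth_cnj smooth_con w simp: F0)
      moreover have "d_zbar k (\<lambda>z. cnj (con w k K0 z)) z = cnj (d_z k (con w k K0) z)" for z
        by (rule d_z_cnj(2)[OF smooth_differentiable[OF smooth_con[OF w]]])
      ultimately show "(LINT z:\<Omega>|lborel. d_zbar k F z * cnj (con w k K0 z)) = - (LINT z:\<Omega>|lborel. F z * cnj (d_z k (con w k K0) z))"
        by simp
    qed
    also have "\<dots> = - (LINT z:\<Omega>|lborel. \<Sum>k\<in>UNIV. F z * cnj (d_z k (con w k K0) z))"
      by (subst set_lebesgue_integral_sum) (auto simp: sum_negf intro!: int_cont continuous_intros Fc cc)
    also have "(\<lambda>z. \<Sum>k\<in>UNIV. F z * cnj (d_z k (con w k K0) z)) = (\<lambda>z. F z * cnj (divergence w K0 z))"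
      by (simp add: divergence_def sum_distrib_left)
    finally have e: "(LINT z:\<Omega>|lborel. F z * cnj (?v z)) = - (LINT z:\<Omega>|lborel. F z * cnj (divergence w K0 z))" .
    have "(LINT z:\<Omega>|lborel. complex_of_real (P z) * h z) = (LINT z:\<Omega>|lborel. F z * cnj (?v z) + F z * cnj (divergence w K0 z))"
      by (simp add: h_def F_def algebra_simps)
    also have "\<dots> = (LINT z:\<Omega>|lborel. F z * cnj (?v z)) + (LINT z:\<Omega>|lborel. F z * cnj (divergence w K0 z))"
      by (intro set_integral_add sq_integrable_mult sq_int_cont Fc sq_integrable_cnj v dc)
    finally show "(LINT z:\<Omega>|lborel. complex_of_real (P z) * h z) = 0" using e by simp
  qed
  then show ?thesis
    by eventually_elim (auto simp: h_def domain_eq add_eq_0_iff2 simp del: complex_cnj_add)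
qed


lemma con_mult: "con (\<lambda>S z. c z * w S z) k K = (\<lambda>z. c z * con w k K z)"
  by (auto simp: con_def contraction_def)

lemma divergence_mult_R:
  assumes "\<And>S. smooth (w S)"
  shows "divergence (\<lambda>S z. R z * w S z) K z = R z * divergence w K z + normal_part w K z"
  by (simp add: divergence_def normal_part_def con_mult d_z_mult smooth_differentiable smooth_R
      smooth_con assms sum.distrib sum_distrib_left)

lemma test_function_mult_R:
  assumes "test_function \<Omega> \<phi>" shows "test_function \<Omega> (\<lambda>z. R z * \<phi> z)"
proof -
  have sub: "closure {z. R z * \<phi> z \<noteq> 0} \<subseteq> closure {z. \<phi> z \<noteq> 0}"
    by (rule closure_mono) auto
  then have "compact (closure {z. R z * \<phi> z \<noteq> 0})"
    using assms compact_Int_closed[of "closure {z. \<phi> z \<noteq> 0}" "closure {z. R z * \<phi> z \<noteq> 0}"]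
    by (simp add: test_function_def Int_absorb1)
  then show ?thesis using assms sub smooth_mult[OF smooth_R] by (auto simp: test_function_def)
qed

text \<open>The Leibniz rule for the distributional dbar: \<open>R * \<phi>\<close> is again a test
  function, and the derivative of \<open>R\<close> in its product rule is moved to the other side as
  the wedge term.\<close>

lemma weak_dbar_mult_R:
  assumes fg: "weak_dbar \<Omega> p f g"
  shows "weak_dbar \<Omega> p (\<lambda>J z. R z * f J z)
    (\<lambda>S z. R z * g S z + wedge (\<lambda>k J. d_zbar k R z * f (sorted_list_of_set J) z) (set S))"
proof -
  have f: "sq_integrable_on \<Omega> (f (sorted_list_of_set J))" if "card J = p" for J
    using fg that by (simp add: weak_dbar_sets)
  have g: "sq_integrable_on \<Omega> (g (sorted_list_of_set S))" if "card S = Suc p" for S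
    using fg that by (simp add: weak_dbar_sets)
  have Rc: "continuous_on A R" "continuous_on A (d_zbar k R)" for A k
    using smooth_continuous_on smooth_R smooth_d_z(2) by blast+
  have card: "card (S - {k}) = p" if "card S = Suc p" "k \<in> S" for S :: "'n set" and k
    using that by simp
  have wsq: "sq_integrable_on \<Omega> (\<lambda>z. wedge (\<lambda>k J. d_zbar k R z * f (sorted_list_of_set J) z) S)" if "card S = Suc p" for S
    unfolding wedge_def using that
    by (intro sq_integrable_sum sq_int_mult_cont continuous_on_const Rc f card)
  have "(LINT z:\<Omega>|lborel. (R z * g (sorted_list_of_set S) z + wedge (\<lambda>k J. d_zbar k R z * f (sorted_list_of_set J) z) S) * \<phi> z)
      = - (LINT z:\<Omega>|lborel. \<Sum>k\<in>S. eps k S * (R z * f (sorted_list_of_set (S - {k})) z * d_zbar k \<phi> z))"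
    if S: "card S = Suc p" and \<phi>: "test_function \<Omega> \<phi>" for S \<phi>
  proof -
    have s: "smooth \<phi>" using \<phi> by (simp add: test_function_def)
    have pc: "continuous_on A \<phi>" "continuous_on A (d_zbar k \<phi>)" for k A
      using smooth_continuous_on[OF s] smooth_continuous_on[OF smooth_d_z(2)[OF s]] .
    have i1: "set_integrable lborel \<Omega> (\<lambda>z. (g (sorted_list_of_set S) z) * (R z * \<phi> z))"
      by (intro sq_integrable_mult g[OF S] sq_int_cont continuous_intros Rc pc)
    have i2: "set_integrable lborel \<Omega> (\<lambda>z. wedge (\<lambda>k J. d_zbar k R z * f (sorted_list_of_set J) z) S * \<phi> z)"
      by (intro sq_integrable_mult wsq[OF S] sq_int_cont pc)
    have i3: "set_integrable lborel \<Omega> (\<lambda>z. \<Sum>k\<in>S. eps k S * (R z * f (sorted_list_of_set (S - {k})) z * d_zbar k \<phi> z))"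
      using S by (intro set_integrable_sum set_integrable_mult_right sq_integrable_mult sq_int_mult_cont sq_int_cont Rc pc f card)
    have "(LINT z:\<Omega>|lborel. (R z * g (sorted_list_of_set S) z + wedge (\<lambda>k J. d_zbar k R z * f (sorted_list_of_set J) z) S) * \<phi> z)
      = (LINT z:\<Omega>|lborel. g (sorted_list_of_set S) z * (R z * \<phi> z) + wedge (\<lambda>k J. d_zbar k R z * f (sorted_list_of_set J) z) S * \<phi> z)"
      by (simp add: algebra_simps)
    also have "\<dots> = (LINT z:\<Omega>|lborel. g (sorted_list_of_set S) z * (R z * \<phi> z)) + (LINT z:\<Omega>|lborel. wedge (\<lambda>k J. d_zbar k R z * f (sorted_list_of_set J) z) S * \<phi> z)"
      by (rule set_integral_add[OF i1 i2])
    also have "(LINT z:\<Omega>|lborel. g (sorted_list_of_set S) z * (R z * \<phi> z)) =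
       - (LINT z:\<Omega>|lborel. \<Sum>k\<in>S. eps k S * (f (sorted_list_of_set (S - {k})) z * d_zbar k (\<lambda>z. R z * \<phi> z) z))"
      using fg S test_function_mult_R[OF \<phi>] unfolding weak_dbar_sets by blast
    also have "(\<lambda>z. \<Sum>k\<in>S. eps k S * (f (sorted_list_of_set (S - {k})) z * d_zbar k (\<lambda>z. R z * \<phi> z) z)) =
      (\<lambda>z. (\<Sum>k\<in>S. eps k S * (R z * f (sorted_list_of_set (S - {k})) z * d_zbar k \<phi> z))
        + wedge (\<lambda>k J. d_zbar k R z * f (sorted_list_of_set J) z) S * \<phi> z)"
      using d_z_mult(2)[OF smooth_differentiable[OF smooth_R] smooth_differentiable[OF s]]
      by (simp add: wedge_def sum_distrib_right sum_distrib_left sum.distrib algebra_simps)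
    also have "(LINT z:\<Omega>|lborel. \<dots> z) = (LINT z:\<Omega>|lborel. \<Sum>k\<in>S. eps k S * (R z * f (sorted_list_of_set (S - {k})) z * d_zbar k \<phi> z))
       + (LINT z:\<Omega>|lborel. wedge (\<lambda>k J. d_zbar k R z * f (sorted_list_of_set J) z) S * \<phi> z)"
      by (rule set_integral_add[OF i3 i2])
    finally show ?thesis by simp
  qed
  then show ?thesis
    unfolding weak_dbar_sets using f g wsq Rc by (auto intro!: sq_int_mult_cont sq_integrable_add)
qed

text \<open>\<open>dbar_star\<close> is a choice, so the commutator is meaningful only once \<rho> u
  is known to lie in the domain. Duality moves \<rho> from u to the test form, and the Leibniz rule
  there produces the normal part.\<close>

lemma extends_mult_R:
  assumes u: "extends p u w"
  shows "extends p (mult_form \<rho> u) (\<lambda>S z. R z * w S z)"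
proof -
  let ?v = "dbar_star \<Omega> (Suc p) u"
  have w: "smooth (w S)" for S using u by (simp add: extends_def)
  have uw: "u (sorted_list_of_set S) z = w S z" if "card S = Suc p" "z \<in> \<Omega>" for S z
    using u that domain_subset_closure by (auto simp: extends_def)
  have usq: "sq_integrable_on \<Omega> (u (sorted_list_of_set S))" if "card S = Suc p" for S
    using dbar_star_works[OF u] that by (simp add: is_dbar_star_sets)
  have vsq: "sq_integrable_on \<Omega> (?v (sorted_list_of_set K))" if "card K = p" for K
    using dbar_star_works[OF u] that by (simp add: is_dbar_star_sets)
  have Rc: "continuous_on A R" "continuous_on A (d_zbar k R)" for A k
    using smooth_continuous_on smooth_R smooth_d_z(2) by blast+
  have cc: "continuous_on A (con w k K)" for A k K by (intro smooth_continuous_on smooth_con w)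
  have nc: "continuous_on A (normal_part w K)" for A K by (intro smooth_continuous_on smooth_normal_part w)
  \<comment> \<open>The extra term is the pairing of the wedge product of the conjugate gradient of
    \<rho> with f against u, rewritten as a pairing of f with a contraction of u.\<close>
  define v' where "v' = (\<lambda>J z. R z * ?v J z + - normal_part w (set J) z)"
  have "is_dbar_star \<Omega> (Suc p) (mult_form \<rho> u) v'"
    unfolding is_dbar_star_sets
  proof (intro conjI allI impI)
    show "sq_integrable_on \<Omega> (mult_form \<rho> u (sorted_list_of_set S))" if "card S = Suc p" for S
      unfolding mult_form_def by (intro sq_int_mult_cont Rc usq that)
    show "sq_integrable_on \<Omega> (v' (sorted_list_of_set K))" if "card K = p" for K
      unfolding v'_def by (intro sq_integrable_add sq_int_mult_cont Rc vsq that sq_int_cont continuous_intros nc)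
    fix f g :: "'n form" assume fg: "weak_dbar \<Omega> p f g"
    have f: "sq_integrable_on \<Omega> (f (sorted_list_of_set J))" if "card J = p" for J
      using fg that by (simp add: weak_dbar_sets)
    have g: "sq_integrable_on \<Omega> (g (sorted_list_of_set S))" if "card S = Suc p" for S
      using fg that by (simp add: weak_dbar_sets)
    let ?gu = "\<lambda>z. \<Sum>S | card S = Suc p. g (sorted_list_of_set S) z * cnj (mult_form \<rho> u (sorted_list_of_set S) z)"
    let ?fn = "\<lambda>z. \<Sum>K | card K = p. f (sorted_list_of_set K) z * cnj (normal_part w K z)"
    let ?fv = "\<lambda>z. \<Sum>K | card K = p. (R z * f (sorted_list_of_set K) z) * cnj (?v (sorted_list_of_set K) z)"
    have i1: "set_integrable lborel \<Omega> ?gu"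
      unfolding mult_form_def
      by (intro set_integrable_sum sq_integrable_mult g sq_integrable_cnj sq_int_mult_cont Rc usq) auto
    have i2: "set_integrable lborel \<Omega> ?fn"
      by (intro set_integrable_sum sq_integrable_mult f sq_int_cont continuous_intros nc) auto
    have i3: "set_integrable lborel \<Omega> ?fv"
      by (intro set_integrable_sum sq_integrable_mult f sq_integrable_cnj sq_int_mult_cont Rc vsq) auto
    have pt: "(\<Sum>S | card S = Suc p. (R z * g (sorted_list_of_set S) z +
        wedge (\<lambda>k J. d_zbar k R z * f (sorted_list_of_set J) z) (set (sorted_list_of_set S))) * cnj (u (sorted_list_of_set S) z))
      = ?gu z + ?fn z" if z: "z \<in> \<Omega>" for z
    proof -
      have "(\<Sum>S | card S = Suc p. wedge (\<lambda>k J. d_zbar k R z * f (sorted_list_of_set J) z) S * cnj (u (sorted_list_of_set S) z))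
        = (\<Sum>S | card S = Suc p. wedge (\<lambda>k J. d_zbar k R z * f (sorted_list_of_set J) z) S * cnj (w S z))"
        using uw z by simp
      also have "\<dots> = (\<Sum>K | card K = p. \<Sum>k\<in>UNIV. d_zbar k R z * f (sorted_list_of_set K) z * cnj (con w k K z))"
        using sum_wedge_cnj[where p=p and a="\<lambda>k. d_zbar k R z" and f="\<lambda>k J. f (sorted_list_of_set J) z" and w="\<lambda>S. w S z"]
        by (simp add: con_def)
      also have "\<dots> = ?fn z"
        by (simp add: normal_part_def cnj_d_z_R sum_distrib_left mult_ac)
      finally have 1: "(\<Sum>S | card S = Suc p. wedge (\<lambda>k J. d_zbar k R z * f (sorted_list_of_set J) z) S * cnj (u (sorted_list_of_set S) z)) = ?fn z" .
      have 2: "(\<Sum>S | card S = Suc p. R z * g (sorted_list_of_set S) z * cnj (u (sorted_list_of_set S) z)) = ?gu z"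
        by (simp add: mult_form_def mult_ac)
      show ?thesis by (simp add: distrib_right sum.distrib 1 2)
    qed
    have "(LINT z:\<Omega>|lborel. ?gu z) + (LINT z:\<Omega>|lborel. ?fn z) = (LINT z:\<Omega>|lborel. ?gu z + ?fn z)"
      by (rule set_integral_add(2)[OF i1 i2, symmetric])
    also have "\<dots> = (LINT z:\<Omega>|lborel. \<Sum>S | card S = Suc p. (R z * g (sorted_list_of_set S) z +
        wedge (\<lambda>k J. d_zbar k R z * f (sorted_list_of_set J) z) (set (sorted_list_of_set S))) * cnj (u (sorted_list_of_set S) z))"
      by (rule set_lebesgue_integral_cong'[OF pt[symmetric]])
    also have "\<dots> = (LINT z:\<Omega>|lborel. ?fv z)"
      using dbar_star_works[OF u] weak_dbar_mult_R[OF fg] unfolding is_dbar_star_sets by blast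
    finally have "(LINT z:\<Omega>|lborel. ?gu z) = (LINT z:\<Omega>|lborel. ?fv z) - (LINT z:\<Omega>|lborel. ?fn z)"
      by (simp only: eq_diff_eq)
    also have "\<dots> = (LINT z:\<Omega>|lborel. ?fv z - ?fn z)" by (rule set_integral_diff(2)[OF i3 i2, symmetric])
    also have "(\<lambda>z. ?fv z - ?fn z) = (\<lambda>z. \<Sum>K | card K = p. f (sorted_list_of_set K) z * cnj (v' (sorted_list_of_set K) z))"
      by (simp add: v'_def sum_subtractf[symmetric] algebra_simps)
    finally show "(LINT z:\<Omega>|lborel. ?gu z) = (LINT z:\<Omega>|lborel. \<Sum>K | card K = p. f (sorted_list_of_set K) z * cnj (v' (sorted_list_of_set K) z))" .
  qed
  then show ?thesis
    using u smooth_mult[OF smooth_R] unfolding extends_def dom_dbar_star_def mult_form_def by auto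
qed

lemma AE_all_subsets:
  fixes P :: "'n set \<Rightarrow> 'a \<Rightarrow> bool"
  assumes "\<And>K. card K = p \<Longrightarrow> AE z in M. P K z"
  shows "AE z in M. \<forall>K. card K = p \<longrightarrow> P K z"
  using assms by (subst AE_all_countable) (auto intro: AE_I2)

text \<open>The link between the chosen representatives and smooth functions. Finitely many
  components share one exceptional null set.\<close>

lemma AE_dbar_star:
  assumes u: "extends p u w"
  shows "AE z in lborel. z \<in> \<Omega> \<longrightarrow> (\<forall>K. card K = p \<longrightarrow>
     dbar_star \<Omega> (Suc p) u (sorted_list_of_set K) z = - divergence w K z \<and>
     dbar_star_commutator \<Omega> (Suc p) \<rho> u (sorted_list_of_set K) z = - normal_part w K z)"
proof -
  have w: "smooth (w S)" for S using u by (simp add: extends_def)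
  have "AE z in lborel. \<forall>K. card K = p \<longrightarrow> (z \<in> \<Omega> \<longrightarrow> dbar_star \<Omega> (Suc p) u (sorted_list_of_set K) z = - divergence w K z)"
    by (rule AE_all_subsets[OF dbar_star_eq_divergence[OF u]])
  moreover have "AE z in lborel. \<forall>K. card K = p \<longrightarrow> (z \<in> \<Omega> \<longrightarrow>
      dbar_star \<Omega> (Suc p) (mult_form \<rho> u) (sorted_list_of_set K) z = - divergence (\<lambda>S z. R z * w S z) K z)"
    by (rule AE_all_subsets[OF dbar_star_eq_divergence[OF extends_mult_R[OF u]]])
  ultimately show ?thesis
    by eventually_elim (simp add: dbar_star_commutator_def mult_form_def divergence_mult_R[OF w] algebra_simps)
qed

section \<open>The twisted Kohn--Morrey--Hoermander identity\<close>

definition grad_sq :: "nat \<Rightarrow> ('n set \<Rightarrow> (complex, 'n) vec \<Rightarrow> complex) \<Rightarrow> (complex, 'n) vec \<Rightarrow> real" where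
  "grad_sq p w z = (\<Sum>k\<in>UNIV. \<Sum>J | card J = Suc p. (cmod (d_zbar k (w J) z))\<^sup>2)"

definition dbar_sq :: "nat \<Rightarrow> ('n set \<Rightarrow> (complex, 'n) vec \<Rightarrow> complex) \<Rightarrow> (complex, 'n) vec \<Rightarrow> real" where
  "dbar_sq p w z = (\<Sum>L | card L = Suc (Suc p). (cmod (wedge (\<lambda>k J. d_zbar k (w J) z) L))\<^sup>2)"

definition norm_sq :: "nat \<Rightarrow> ('n set \<Rightarrow> (complex, 'n) vec \<Rightarrow> complex) \<Rightarrow> (complex, 'n) vec \<Rightarrow> real" where
  "norm_sq p w z = (\<Sum>K | card K = p. (cmod (w K z))\<^sup>2)"

lemma d_zbar_con:
  assumes "\<And>S. smooth (w S)"
  shows "contraction (\<lambda>J. d_zbar k (w J) z) j K = d_zbar k (con w j K) z"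
proof (cases "j \<in> K")
  case False
  then have "con w j K = (\<lambda>z. eps j K * w (insert j K) z)" by (auto simp: con_def contraction_def)
  then show ?thesis using False
    by (simp add: contraction_def d_z_mult d_z_const smooth_differentiable[OF assms])
qed (auto simp: con_def[abs_def] contraction_def d_z_const)

lemma dbar_sq_eq:
  assumes "\<And>S. smooth (w S)"
  shows "dbar_sq p w z = grad_sq p w z -
    Re (\<Sum>K | card K = p. \<Sum>j\<in>UNIV. \<Sum>k\<in>UNIV. d_zbar k (con w j K) z * cnj (d_zbar j (con w k K) z))"
proof -
  have "complex_of_real (dbar_sq p w z) = complex_of_real (grad_sq p w z) -
    (\<Sum>K | card K = p. \<Sum>j\<in>UNIV. \<Sum>k\<in>UNIV. d_zbar k (con w j K) z * cnj (d_zbar j (con w k K) z))"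
    using wedge_norm_identity[of "\<lambda>k J. d_zbar k (w J) z" p]
    by (simp add: dbar_sq_def grad_sq_def complex_norm_square d_zbar_con[OF assms] del: of_real_power)
  from arg_cong[OF this, of Re] show ?thesis by simp
qed

text \<open>The norm identity for dbar u leaves the mixed term with the two derivatives
  interchanged. Weighted by \<open>a\<close>, it is integrated by parts in z_j, without boundary
  term since a = 0 there; commuting the derivatives then exposes the conjugate derivatives of
  \<open>f\<close>, the form \<Sum> \<partial>(a u_j)/\<partial>z_j, to which the adjoint relation
  applies.\<close>

lemma kohn_morrey_hoermander:
  assumes u: "extends p u w" and U: "open U" "closure \<Omega> \<subseteq> U"
    and a1: "C1_on U (\<lambda>z. complex_of_real (a z))"
    and a2: "\<And>j. C1_on U (d_z j (\<lambda>z. complex_of_real (a z)))"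
    and a0: "\<And>z. z \<in> frontier \<Omega> \<Longrightarrow> a z = 0"
  shows "(LINT z:\<Omega>|lborel. a z * (dbar_sq p w z + norm_sq p (divergence w) z - grad_sq p w z)
     + 2 * Re (\<Sum>K | card K = p. (\<Sum>j\<in>UNIV. d_z j (\<lambda>z. complex_of_real (a z)) z * con w j K z) * cnj (divergence w K z))
     + Re (\<Sum>K | card K = p. \<Sum>j\<in>UNIV. \<Sum>k\<in>UNIV.
         d_zbar k (d_z j (\<lambda>z. complex_of_real (a z))) z * (con w j K z * cnj (con w k K z)))) = 0"
proof -
  let ?A = "\<lambda>z. complex_of_real (a z)"
  let ?X = "\<lambda>z. \<Sum>K | card K = p. \<Sum>j\<in>UNIV. \<Sum>k\<in>UNIV. d_zbar k (con w j K) z * cnj (d_zbar j (con w k K) z)"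
  let ?H = "\<lambda>z. \<Sum>K | card K = p. \<Sum>j\<in>UNIV. \<Sum>k\<in>UNIV. d_zbar k (d_z j ?A) z * (con w j K z * cnj (con w k K z))"
  define \<alpha> where "\<alpha> K z = (\<Sum>j\<in>UNIV. d_z j ?A z * con w j K z)" for K z
  define F where "F j K z = ?A z * d_z j (con w j K) z + d_z j ?A z * con w j K z" for j K z
  \<comment> \<open>On the boundary \<open>f\<close> equals \<open>\<alpha>\<close>, which is in
    general not zero; its conjugate derivatives are therefore removed by duality instead of Stokes'
    theorem.\<close>
  define f where "f K z = (\<Sum>j\<in>UNIV. F j K z)" for K z
  have w: "smooth (w S)" for S using u by (simp add: extends_def)
  note sc = smooth_con[OF w]
  have cU: "continuous_on (closure \<Omega>) h" if "continuous_on U h" for h :: "(complex, 'n) vec \<Rightarrow> complex"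
    using that U(2) continuous_on_subset by blast
  have Ac: "continuous_on (closure \<Omega>) ?A" by (rule cU[OF C1_onD(3)[OF a1]])
  have A1c: "continuous_on (closure \<Omega>) (d_z j ?A)" for j by (rule cU[OF C1_onD(3)[OF a2]])
  have A2c: "continuous_on (closure \<Omega>) (d_zbar k (d_z j ?A))" for j k by (rule cU[OF C1_on_continuous_d_z(2)[OF a2]])
  have cc: "continuous_on (closure \<Omega>) (con w j K)" "continuous_on (closure \<Omega>) (d_z k (con w j K))"
    "continuous_on (closure \<Omega>) (d_zbar k (con w j K))" "continuous_on (closure \<Omega>) (d_z i (d_zbar k (con w j K)))" for i j k K
    by (intro smooth_continuous_on smooth_d_z sc)+
  have dc: "continuous_on (closure \<Omega>) (divergence w K)" for K by (intro smooth_continuous_on smooth_divergence w)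
  have \<alpha>c: "continuous_on (closure \<Omega>) (\<alpha> K)" for K unfolding \<alpha>_def[abs_def] by (intro continuous_intros A1c cc)
  have FC: "C1_on U (F j K)" for j K
    unfolding F_def by (intro C1_on_add C1_on_mult a1 a2 C1_on_smooth smooth_d_z sc)
  have fC: "C1_on U (f K)" for K unfolding f_def by (intro C1_on_sum FC)
  have fc: "continuous_on (closure \<Omega>) (f K)" for K by (rule cU[OF C1_onD(3)[OF fC]])
  have fdc: "continuous_on (closure \<Omega>) (d_zbar k (f K))" for k K by (rule cU[OF C1_on_continuous_d_z(2)[OF fC]])
  have f_eq: "f K z = ?A z * divergence w K z + \<alpha> K z" for K z
    by (simp add: f_def F_def divergence_def \<alpha>_def sum.distrib sum_distrib_left)
  have Ud: "z \<in> U" if "z \<in> \<Omega>" for z using that U(2) domain_subset_closure by blast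
  have dA: "?A differentiable (at z)" if "z \<in> \<Omega>" for z by (rule C1_onD(1)[OF a1 Ud[OF that]])
  have da: "a differentiable (at z)" if "z \<in> \<Omega>" for z
    using differentiable_bounded_linear[OF bounded_linear_Re dA[OF that]] by simp
  \<comment> \<open>The two corrections are the commutator terms of \<open>a\<close>: its gradient
    times the divergence becomes the second copy of the cross term, and its complex Hessian becomes
    the curvature term.\<close>
  have pt: "(\<Sum>j\<in>UNIV. d_z j (\<lambda>z. ?A z * d_zbar k (con w j K) z) z) =
     d_zbar k (f K) z - cnj (d_z k ?A z) * divergence w K z - (\<Sum>j\<in>UNIV. d_zbar k (d_z j ?A) z * con w j K z)"
    if z: "z \<in> \<Omega>" for z k K
  proof -
    have "d_zbar k (f K) z = (\<Sum>j\<in>UNIV. d_zbar k (F j K) z)"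
      unfolding f_def[abs_def] by (rule d_z_sum(2)) (use C1_onD(1)[OF FC Ud[OF z]] in auto)
    moreover have "d_zbar k (F j K) z = ?A z * d_zbar k (d_z j (con w j K)) z + cnj (d_z k ?A z) * d_z j (con w j K) z
        + (d_z j ?A z * d_zbar k (con w j K) z + d_zbar k (d_z j ?A) z * con w j K z)" for j
    proof -
      have 1: "d_z j (con w j K) differentiable (at z)" "con w j K differentiable (at z)"
        by (intro smooth_differentiable smooth_d_z sc)+
      have 2: "d_z j ?A differentiable (at z)" by (rule C1_onD(1)[OF a2 Ud[OF z]])
      show ?thesis unfolding F_def[abs_def]
        by (subst d_z_add(2)) (use 1 2 dA[OF z] in \<open>auto simp: d_z_mult d_z_of_real[OF da[OF z]] intro!: differentiable_mult\<close>)
    qed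
    moreover have "d_z j (\<lambda>z. ?A z * d_zbar k (con w j K) z) z =
        ?A z * d_zbar k (d_z j (con w j K)) z + d_z j ?A z * d_zbar k (con w j K) z" for j
      using d_z_mult(1)[OF dA[OF z] smooth_differentiable[OF smooth_d_z(2)[OF sc]]]
      by (simp add: d_z_d_zbar_commute[OF sc])
    ultimately show ?thesis
      by (simp add: divergence_def sum.distrib sum_distrib_left sum_subtractf)
  qed
  have "(LINT z:\<Omega>|lborel. ?A z * ?X z) = (LINT z:\<Omega>|lborel. \<Sum>K | card K = p. \<Sum>j\<in>UNIV. \<Sum>k\<in>UNIV. (?A z * d_zbar k (con w j K) z) * cnj (d_zbar j (con w k K) z))"
    by (simp add: sum_distrib_left mult.assoc)
  also have "\<dots> = (\<Sum>K | card K = p. \<Sum>j\<in>UNIV. \<Sum>k\<in>UNIV. LINT z:\<Omega>|lborel. (?A z * d_zbar k (con w j K) z) * cnj (d_zbar j (con w k K) z))"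
    by (subst set_lebesgue_integral_sum, (intro int_cont continuous_intros Ac cc)[1])+ (rule refl)
  also have "\<dots> = (\<Sum>K | card K = p. \<Sum>j\<in>UNIV. \<Sum>k\<in>UNIV. - (LINT z:\<Omega>|lborel. d_z j (\<lambda>z. ?A z * d_zbar k (con w j K) z) z * cnj (con w k K z)))"
  proof (intro sum.cong refl)
    fix K j k
    have "(LINT z:\<Omega>|lborel. (?A z * d_zbar k (con w j K) z) * d_z j (\<lambda>z. cnj (con w k K z)) z)
      = - (LINT z:\<Omega>|lborel. d_z j (\<lambda>z. ?A z * d_zbar k (con w j K) z) z * cnj (con w k K z))"
      by (rule integration_by_parts(1)[OF U(2) C1_on_mult[OF a1 C1_on_smooth] C1_on_smooth])
        (auto intro!: smooth_d_z smooth_cnj sc simp: a0)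
    moreover have "d_z j (\<lambda>z. cnj (con w k K z)) z = cnj (d_zbar j (con w k K) z)" for z
      by (rule d_z_cnj(1)[OF smooth_differentiable[OF sc]])
    ultimately show "(LINT z:\<Omega>|lborel. (?A z * d_zbar k (con w j K) z) * cnj (d_zbar j (con w k K) z))
      = - (LINT z:\<Omega>|lborel. d_z j (\<lambda>z. ?A z * d_zbar k (con w j K) z) z * cnj (con w k K z))" by simp
  qed
  also have "\<dots> = - (\<Sum>K | card K = p. \<Sum>j\<in>UNIV. \<Sum>k\<in>UNIV. (LINT z:\<Omega>|lborel. d_z j (\<lambda>z. ?A z * d_zbar k (con w j K) z) z * cnj (con w k K z)))"
    by (simp add: sum_negf)
  also have "(\<Sum>K | card K = p. \<Sum>j\<in>UNIV. \<Sum>k\<in>UNIV. (LINT z:\<Omega>|lborel. d_z j (\<lambda>z. ?A z * d_zbar k (con w j K) z) z * cnj (con w k K z)))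
    = (LINT z:\<Omega>|lborel. \<Sum>K | card K = p. \<Sum>j\<in>UNIV. \<Sum>k\<in>UNIV. d_z j (\<lambda>z. ?A z * d_zbar k (con w j K) z) z * cnj (con w k K z))"
  proof -
    have "continuous_on (closure \<Omega>) (d_z j (\<lambda>z. ?A z * d_zbar k (con w j K) z))" for j k K
      by (intro cU C1_on_continuous_d_z(1) C1_on_mult a1 C1_on_smooth smooth_d_z sc)
    then show ?thesis
      by (subst set_lebesgue_integral_sum, (intro int_cont continuous_intros cc)[1], assumption)+ (rule refl)
  qed
  also have "\<dots> = (LINT z:\<Omega>|lborel. (\<Sum>K | card K = p. \<Sum>k\<in>UNIV. d_zbar k (f K) z * cnj (con w k K z))
       - ((\<Sum>K | card K = p. divergence w K z * cnj (\<alpha> K z)) + ?H z))"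
  proof (rule set_lebesgue_integral_cong')
    fix z assume z: "z \<in> \<Omega>"
    have "(\<Sum>K | card K = p. \<Sum>j\<in>UNIV. \<Sum>k\<in>UNIV. d_z j (\<lambda>z. ?A z * d_zbar k (con w j K) z) z * cnj (con w k K z))
      = (\<Sum>K | card K = p. \<Sum>k\<in>UNIV. \<Sum>j\<in>UNIV. d_z j (\<lambda>z. ?A z * d_zbar k (con w j K) z) z * cnj (con w k K z))"
      by (intro sum.cong refl sum.swap)
    also have "\<dots> = (\<Sum>K | card K = p. \<Sum>k\<in>UNIV. (\<Sum>j\<in>UNIV. d_z j (\<lambda>z. ?A z * d_zbar k (con w j K) z) z) * cnj (con w k K z))"
      by (simp only: sum_distrib_right)
    also have "\<dots> = (\<Sum>K | card K = p. \<Sum>k\<in>UNIV. d_zbar k (f K) z * cnj (con w k K z))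
       - ((\<Sum>K | card K = p. \<Sum>k\<in>UNIV. divergence w K z * (cnj (d_z k ?A z) * cnj (con w k K z)))
       + (\<Sum>K | card K = p. \<Sum>k\<in>UNIV. \<Sum>j\<in>UNIV. d_zbar k (d_z j ?A) z * (con w j K z * cnj (con w k K z))))"
    proof -
      have "(\<Sum>j\<in>UNIV. d_z j (\<lambda>z. ?A z * d_zbar k (con w j K) z) z) * cnj (con w k K z) =
          d_zbar k (f K) z * cnj (con w k K z) - (divergence w K z * (cnj (d_z k ?A z) * cnj (con w k K z))
           + (\<Sum>j\<in>UNIV. d_zbar k (d_z j ?A) z * (con w j K z * cnj (con w k K z))))" for K k
      proof -
        have "(\<Sum>j\<in>UNIV. d_zbar k (d_z j ?A) z * (con w j K z * cnj (con w k K z)))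
          = (\<Sum>j\<in>UNIV. d_zbar k (d_z j ?A) z * con w j K z) * cnj (con w k K z)"
          by (simp add: sum_distrib_right mult.assoc)
        then show ?thesis unfolding pt[OF z] by (simp add: algebra_simps)
      qed
      then show ?thesis by (simp only: sum_subtractf sum.distrib)
    qed
    also have "(\<Sum>K | card K = p. \<Sum>k\<in>UNIV. \<Sum>j\<in>UNIV. d_zbar k (d_z j ?A) z * (con w j K z * cnj (con w k K z))) = ?H z"
      by (intro sum.cong refl sum.swap)
    also have "(\<Sum>K | card K = p. \<Sum>k\<in>UNIV. divergence w K z * (cnj (d_z k ?A z) * cnj (con w k K z))) = (\<Sum>K | card K = p. divergence w K z * cnj (\<alpha> K z))"
      by (simp add: \<alpha>_def sum_distrib_left)
    finally show "(\<Sum>K | card K = p. \<Sum>j\<in>UNIV. \<Sum>k\<in>UNIV. d_z j (\<lambda>z. ?A z * d_zbar k (con w j K) z) z * cnj (con w k K z))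
      = (\<Sum>K | card K = p. \<Sum>k\<in>UNIV. d_zbar k (f K) z * cnj (con w k K z))
       - ((\<Sum>K | card K = p. divergence w K z * cnj (\<alpha> K z)) + ?H z)" .
  qed
  also have "\<dots> = (LINT z:\<Omega>|lborel. \<Sum>K | card K = p. \<Sum>k\<in>UNIV. d_zbar k (f K) z * cnj (con w k K z))
       - (LINT z:\<Omega>|lborel. (\<Sum>K | card K = p. divergence w K z * cnj (\<alpha> K z)) + ?H z)"
    by (intro set_integral_diff int_cont continuous_intros fdc cc dc \<alpha>c A2c)
  \<comment> \<open>Duality takes the place of the second integration by parts.\<close>
  also have "(LINT z:\<Omega>|lborel. \<Sum>K | card K = p. \<Sum>k\<in>UNIV. d_zbar k (f K) z * cnj (con w k K z))
      = (LINT z:\<Omega>|lborel. \<Sum>K | card K = p. f K z * cnj (dbar_star \<Omega> (Suc p) u (sorted_list_of_set K) z))"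
    by (rule adjoint_C1[OF u U(2) fC])
  also have "\<dots> = (LINT z:\<Omega>|lborel. - (\<Sum>K | card K = p. f K z * cnj (divergence w K z)))"
  proof (unfold set_lebesgue_integral_def, rule integral_cong_AE)
    have "sq_integrable_on \<Omega> (dbar_star \<Omega> (Suc p) u (sorted_list_of_set K))" if "card K = p" for K
      using dbar_star_works[OF u] that by (simp add: is_dbar_star_sets)
    then have "set_integrable lborel \<Omega> (\<lambda>z. \<Sum>K | card K = p. f K z * cnj (dbar_star \<Omega> (Suc p) u (sorted_list_of_set K) z))"
      by (intro set_integrable_sum sq_integrable_mult[OF sq_int_cont[OF fc] sq_integrable_cnj]) auto
    then show "(\<lambda>z. indicat_real \<Omega> z *\<^sub>R (\<Sum>K | card K = p. f K z * cnj (dbar_star \<Omega> (Suc p) u (sorted_list_of_set K) z))) \<in> borel_measurable lborel"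
      unfolding set_integrable_def by (rule borel_measurable_integrable)
    have "set_integrable lborel \<Omega> (\<lambda>z. - (\<Sum>K | card K = p. f K z * cnj (divergence w K z)))"
      by (intro int_cont continuous_intros fc dc)
    then show "(\<lambda>z. indicat_real \<Omega> z *\<^sub>R - (\<Sum>K | card K = p. f K z * cnj (divergence w K z))) \<in> borel_measurable lborel"
      unfolding set_integrable_def by (rule borel_measurable_integrable)
    show "AE z in lborel. indicat_real \<Omega> z *\<^sub>R (\<Sum>K | card K = p. f K z * cnj (dbar_star \<Omega> (Suc p) u (sorted_list_of_set K) z)) =
        indicat_real \<Omega> z *\<^sub>R - (\<Sum>K | card K = p. f K z * cnj (divergence w K z))"
      using AE_dbar_star[OF u] by eventually_elim (auto simp: indicator_def sum_negf)
  qed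
  finally have "(LINT z:\<Omega>|lborel. ?A z * ?X z) = - ((LINT z:\<Omega>|lborel. - (\<Sum>K | card K = p. f K z * cnj (divergence w K z)))
      - (LINT z:\<Omega>|lborel. (\<Sum>K | card K = p. divergence w K z * cnj (\<alpha> K z)) + ?H z))" .
  also have "\<dots> = (LINT z:\<Omega>|lborel. (\<Sum>K | card K = p. divergence w K z * cnj (\<alpha> K z)) + ?H z)
     - (LINT z:\<Omega>|lborel. - (\<Sum>K | card K = p. f K z * cnj (divergence w K z)))" by simp
  also have "\<dots> = (LINT z:\<Omega>|lborel. ((\<Sum>K | card K = p. divergence w K z * cnj (\<alpha> K z)) + ?H z)
      - (- (\<Sum>K | card K = p. f K z * cnj (divergence w K z))))"
    by (intro set_integral_diff(2)[symmetric] int_cont continuous_intros fc dc \<alpha>c A2c cc)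
  finally have eq: "(LINT z:\<Omega>|lborel. ?A z * ?X z) = (LINT z:\<Omega>|lborel. ((\<Sum>K | card K = p. divergence w K z * cnj (\<alpha> K z)) + ?H z)
      - (- (\<Sum>K | card K = p. f K z * cnj (divergence w K z))))" .
  \<comment> \<open>All terms are collected in one continuous integrand, so that a single real part
    of a vanishing integral gives the identity.\<close>
  define Z where "Z z = ((\<Sum>K | card K = p. divergence w K z * cnj (\<alpha> K z)) + ?H z)
      - (- (\<Sum>K | card K = p. f K z * cnj (divergence w K z))) - ?A z * ?X z" for z
  have Zc: "continuous_on (closure \<Omega>) Z"
    unfolding Z_def by (intro continuous_intros fc dc \<alpha>c A2c cc Ac)
  have "(LINT z:\<Omega>|lborel. Z z) = 0"
    unfolding Z_def
    by (subst set_integral_diff(2)) (auto simp: eq intro!: int_cont continuous_intros fc dc \<alpha>c A2c cc Ac)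
  then have "(LINT z:\<Omega>|lborel. Re (Z z)) = 0"
    using integral_Re[OF int_cont[OF Zc, unfolded set_integrable_def]]
    by (simp add: set_lebesgue_integral_def)
  moreover have "Re (Z z) = a z * (dbar_sq p w z + norm_sq p (divergence w) z - grad_sq p w z)
     + 2 * Re (\<Sum>K | card K = p. \<alpha> K z * cnj (divergence w K z)) + Re (?H z)" for z
  proof -
    have 1: "a z * (dbar_sq p w z - grad_sq p w z) = - Re (?A z * ?X z)" by (simp add: dbar_sq_eq[OF w])
    have 2: "Re (\<Sum>K | card K = p. divergence w K z * cnj (\<alpha> K z)) = Re (\<Sum>K | card K = p. \<alpha> K z * cnj (divergence w K z))"
      by (simp add: algebra_simps)
    have "(\<Sum>K | card K = p. f K z * cnj (divergence w K z)) = complex_of_real (a z * norm_sq p (divergence w) z) + (\<Sum>K | card K = p. \<alpha> K z * cnj (divergence w K z))"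
      by (simp add: f_eq norm_sq_def complex_norm_square distrib_right sum.distrib sum_distrib_left mult.assoc del: of_real_power)
    then have 3: "Re (\<Sum>K | card K = p. f K z * cnj (divergence w K z)) = a z * norm_sq p (divergence w) z + Re (\<Sum>K | card K = p. \<alpha> K z * cnj (divergence w K z))"
      by simp
    have "Re (Z z) = Re (\<Sum>K | card K = p. divergence w K z * cnj (\<alpha> K z)) + Re (?H z)
       + Re (\<Sum>K | card K = p. f K z * cnj (divergence w K z)) - Re (?A z * ?X z)"
      unfolding Z_def by (simp only: minus_complex.sel plus_complex.sel uminus_complex.sel diff_minus_eq_add)
    then show ?thesis using 1 2 3 by (simp only: algebra_simps)
  qed
  ultimately show ?thesis unfolding \<alpha>_def by simp
qed

end

section \<open>Limits of weighted integrals and weights that are functions of \<rho>\<close>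

text \<open>Integrability of the limit is part of the conclusion. The Bochner integral of a
  non-integrable function is 0, so the inequality alone would be no information.\<close>

lemma fatou_set_integral:
  fixes f :: "nat \<Rightarrow> 'a \<Rightarrow> real"
  assumes A: "A \<in> sets M" and f: "\<And>n. set_integrable M A (f n)" "\<And>n z. z \<in> A \<Longrightarrow> 0 \<le> f n z"
    and lim: "\<And>z. z \<in> A \<Longrightarrow> (\<lambda>n. f n z) \<longlonglongrightarrow> F z"
    and le: "\<And>n. (LINT z:A|M. f n z) \<le> c n" and c: "c \<longlonglongrightarrow> C"
  shows "set_integrable M A F" "(LINT z:A|M. F z) \<le> C"
proof -
  define g where "g n z = indicat_real A z * f n z" for n z
  define G where "G z = indicat_real A z * F z" for z
  have g: "integrable M (g n)" "g n \<in> borel_measurable M" for n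
    using f(1)[of n] by (simp_all add: g_def[abs_def] set_integrable_def borel_measurable_integrable)
  have g0: "0 \<le> g n z" for n z using f(2) by (auto simp: g_def indicator_def)
  have gl: "(\<lambda>n. g n z) \<longlonglongrightarrow> G z" for z
    using lim by (auto simp: g_def G_def indicator_def)
  have G0: "0 \<le> G z" for z by (rule LIMSEQ_le_const[OF gl]) (use g0 in auto)
  have Gm: "G \<in> borel_measurable M" by (rule borel_measurable_LIMSEQ_real[OF gl g(2)])
  have le': "integral\<^sup>L M (g n) \<le> c n" for n
    using le[of n] by (simp add: g_def[abs_def] set_lebesgue_integral_def)
  have "(\<integral>\<^sup>+ z. ennreal (G z) \<partial>M) = (\<integral>\<^sup>+ z. liminf (\<lambda>n. ennreal (g n z)) \<partial>M)"
    by (intro nn_integral_cong lim_imp_Liminf[symmetric] tendsto_ennrealI gl) simp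
  also have "\<dots> \<le> liminf (\<lambda>n. \<integral>\<^sup>+ z. ennreal (g n z) \<partial>M)"
    by (rule nn_integral_liminf) (use g in auto)
  also have "\<dots> = liminf (\<lambda>n. ennreal (integral\<^sup>L M (g n)))"
    using g g0 by (simp add: nn_integral_eq_integral)
  also have "\<dots> \<le> liminf (\<lambda>n. ennreal (c n))"
    by (intro Liminf_mono always_eventually allI ennreal_leI le')
  also have "\<dots> = ennreal C" by (intro lim_imp_Liminf tendsto_ennrealI c) simp
  finally have b: "(\<integral>\<^sup>+ z. ennreal (G z) \<partial>M) \<le> ennreal C" .
  have GI: "integrable M G"
    by (rule integrableI_nonneg[OF Gm]) (use G0 b le_less_trans[OF b ennreal_less_top] in auto)
  then show "set_integrable M A F" by (simp add: G_def[abs_def] set_integrable_def)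
  have "0 \<le> integral\<^sup>L M (g n)" for n using g0 by simp
  then have "0 \<le> c n" for n using le'[of n] by (meson order_trans)
  then have "0 \<le> C" by (intro LIMSEQ_le_const[OF c]) auto
  moreover have "ennreal (integral\<^sup>L M G) \<le> ennreal C"
    using b GI G0 by (simp add: nn_integral_eq_integral)
  ultimately have "integral\<^sup>L M G \<le> C" by simp
  then show "(LINT z:A|M. F z) \<le> C" by (simp add: G_def[abs_def] set_lebesgue_integral_def)
qed

lemma set_integral_tendsto:
  fixes f :: "nat \<Rightarrow> 'a \<Rightarrow> real"
  assumes f: "\<And>n. set_integrable M A (f n)" and F: "set_integrable M A F" and w: "set_integrable M A w"
    and lim: "\<And>z. z \<in> A \<Longrightarrow> (\<lambda>n. f n z) \<longlonglongrightarrow> F z"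
    and bd: "\<And>n z. z \<in> A \<Longrightarrow> \<bar>f n z\<bar> \<le> w z"
  shows "(\<lambda>n. LINT z:A|M. f n z) \<longlonglongrightarrow> (LINT z:A|M. F z)"
  unfolding set_lebesgue_integral_def
proof (rule integral_dominated_convergence)
  show "integrable M (\<lambda>z. indicat_real A z *\<^sub>R w z)" using w by (simp add: set_integrable_def)
  show "(\<lambda>z. indicat_real A z *\<^sub>R F z) \<in> borel_measurable M"
    using F unfolding set_integrable_def by (rule borel_measurable_integrable)
  show "(\<lambda>z. indicat_real A z *\<^sub>R f n z) \<in> borel_measurable M" for n
    using f unfolding set_integrable_def by (rule borel_measurable_integrable)
  show "AE z in M. (\<lambda>n. indicat_real A z *\<^sub>R f n z) \<longlonglongrightarrow> indicat_real A z *\<^sub>R F z"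
    using lim by (intro AE_I2) (auto simp: indicator_def)
  show "AE z in M. norm (indicat_real A z *\<^sub>R f n z) \<le> indicat_real A z *\<^sub>R w z" for n
    using bd by (intro AE_I2) (auto simp: indicator_def)
qed

lemma two_mult_le_weighted:
  fixes x y t :: real assumes "0 < t" shows "2 * (x * y) \<le> x\<^sup>2 * t + y\<^sup>2 / t"
proof -
  have "0 \<le> (x * t - y)\<^sup>2 / t" using assms by simp
  also have "\<dots> = x\<^sup>2 * t + y\<^sup>2 / t - 2 * (x * y)" using assms by (simp add: field_simps power2_eq_square)
  finally show ?thesis by simp
qed

context smooth_domain
begin

lemma rho_neg: "z \<in> \<Omega> \<Longrightarrow> \<rho> z < 0" by (simp add: domain_eq)

lemma measurable_domain: "\<Omega> \<in> sets lborel" using open_domain by simp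

lemma rho_continuous: "continuous_on A \<rho>" by (rule smooth_continuous_on[OF smooth_rho])

definition levi :: "nat \<Rightarrow> ('n set \<Rightarrow> (complex, 'n) vec \<Rightarrow> complex) \<Rightarrow> (complex, 'n) vec \<Rightarrow> real" where
  "levi p w z = Re (\<Sum>K | card K = p. \<Sum>j\<in>UNIV. \<Sum>k\<in>UNIV.
     d_zbar k (d_z j R) z * (con w j K z * cnj (con w k K z)))"

lemma levi_nonneg:
  assumes "Suc p \<le> CARD('n)" "any_q_eigenvalues_sum_nonneg (Suc p) (complex_hessian \<rho> z)"
  shows "0 \<le> levi p w z"
proof -
  have c: "d_zbar k (d_z j R) z = complex_hessian \<rho> z $ j $ k" for j k
    by (simp add: complex_hessian_def d_z_d_zbar_commute[OF smooth_R])
  have "cnj (complex_hessian \<rho> z $ k $ l) = complex_hessian \<rho> z $ l $ k" for k l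
  proof -
    have "cnj (d_z k (d_zbar l R) z) = d_zbar k (\<lambda>z. cnj (d_zbar l R z)) z"
      by (rule d_z_cnj(2)[OF smooth_differentiable[OF smooth_d_z(2)[OF smooth_R]], symmetric])
    also have "(\<lambda>z. cnj (d_zbar l R z)) = d_z l R" by (simp flip: cnj_d_z_R)
    finally show ?thesis by (simp add: complex_hessian_def d_z_d_zbar_commute[OF smooth_R])
  qed
  from levi_form_nonneg[OF this assms, of "\<lambda>S. w S z"] show ?thesis
    by (simp add: levi_def c con_def)
qed

lemma norm_sq_nonneg: "0 \<le> norm_sq p w z" "0 \<le> grad_sq p w z" "0 \<le> dbar_sq p w z"
  by (auto simp: norm_sq_def grad_sq_def dbar_sq_def intro!: sum_nonneg)

lemma continuous_norm_sq:
  assumes "\<And>S. smooth (w S)"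
  shows "continuous_on A (norm_sq p w)" "continuous_on A (grad_sq p w)" "continuous_on A (dbar_sq p w)"
  unfolding norm_sq_def[abs_def] grad_sq_def[abs_def] dbar_sq_def[abs_def] wedge_def
  by (intro continuous_intros smooth_continuous_on assms smooth_d_z)+

lemma continuous_levi:
  assumes "\<And>S. smooth (w S)" shows "continuous_on A (levi p w)"
  unfolding levi_def[abs_def]
  by (intro continuous_intros smooth_continuous_on smooth_con assms smooth_d_z smooth_R)

text \<open>The weight is a = h(\<rho>) b: the profile \<open>h\<close> with h(0) = 0 governs the
  behaviour at the boundary, and \<open>b\<close> is a smooth multiplier. By the chain rule the
  Hessian of \<open>a\<close> splits into h'' b on the normal part, h' b on the Levi form, mixed
  terms, and h on the Hessian of \<open>b\<close>.\<close>

lemma twisted_identity: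
  fixes h h1 h2 :: "real \<Rightarrow> real" and b :: "(complex, 'n) vec \<Rightarrow> real"
  defines "B \<equiv> \<lambda>z. complex_of_real (b z)"
  assumes u: "extends p u w" and T: "open T" "\<And>z. z \<in> closure \<Omega> \<Longrightarrow> \<rho> z \<in> T" and b: "smooth b"
    and h: "\<And>x. x \<in> T \<Longrightarrow> (h has_real_derivative h1 x) (at x)"
      "\<And>x. x \<in> T \<Longrightarrow> (h1 has_real_derivative h2 x) (at x)" "continuous_on T h2" "h 0 = 0"
  shows "(LINT z:\<Omega>|lborel. h (\<rho> z) * b z * (dbar_sq p w z + norm_sq p (divergence w) z - grad_sq p w z)
     + 2 * (\<Sum>K | card K = p. Re ((of_real (h1 (\<rho> z) * b z) * normal_part w K z
          + of_real (h (\<rho> z)) * (\<Sum>j\<in>UNIV. d_z j B z * con w j K z)) * cnj (divergence w K z)))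
     + h2 (\<rho> z) * b z * norm_sq p (normal_part w) z + h1 (\<rho> z) * b z * levi p w z
     + 2 * h1 (\<rho> z) * (\<Sum>K | card K = p. Re (normal_part w K z * cnj (\<Sum>j\<in>UNIV. d_z j B z * con w j K z)))
     + h (\<rho> z) * Re (\<Sum>K | card K = p. \<Sum>j\<in>UNIV. \<Sum>k\<in>UNIV. d_zbar k (d_z j B) z * (con w j K z * cnj (con w k K z)))) = 0"
proof -
  \<comment> \<open>The neighbourhood of the closure on which h(\<rho>) is defined and
    differentiable.\<close>
  define U where "U = \<rho> -` T"
  have U: "open U" "closure \<Omega> \<subseteq> U"
    using T rho_continuous[of UNIV] by (auto simp: U_def intro: open_vimage)
  have UT: "z \<in> U \<Longrightarrow> \<rho> z \<in> T" for z by (simp add: U_def)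
  let ?h = "\<lambda>z. complex_of_real (h (\<rho> z))" and ?h1 = "\<lambda>z. complex_of_real (h1 (\<rho> z))"
    and ?h2 = "\<lambda>z. complex_of_real (h2 (\<rho> z))"
  define a where "a z = h (\<rho> z) * b z" for z
  let ?A = "\<lambda>z. complex_of_real (a z)"
  have w: "smooth (w S)" for S using u by (simp add: extends_def)
  have sB: "smooth B" unfolding B_def by (rule smooth_of_real[OF b])
  have ch1: "continuous_on T h1"
    using h(2) by (meson DERIV_continuous continuous_at_imp_continuous_on)
  have Cr: "C1_on U \<rho>" by (rule C1_on_smooth[OF smooth_rho])
  have Ch: "C1_on U ?h" by (intro C1_on_of_real C1_on_real_comp[OF Cr UT h(1) ch1])
  have Ch1: "C1_on U ?h1" by (intro C1_on_of_real C1_on_real_comp[OF Cr UT h(2) h(3)])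
  have CA: "C1_on U ?A" unfolding a_def of_real_mult
    using C1_on_mult[OF Ch C1_on_smooth[OF sB]] by (simp add: B_def)
  \<comment> \<open>A second derivative depends on the germ of the first one, so the formula for the
    first derivative is established on the whole open set \<open>U\<close>.\<close>
  define A1 where "A1 j z = ?h1 z * d_z j R z * B z + ?h z * d_z j B z" for j z
  have dr: "\<rho> differentiable (at z)" for z by (rule smooth_differentiable[OF smooth_rho])
  have dh: "?h differentiable (at z)" "?h1 differentiable (at z)" if "z \<in> U" for z
    using C1_onD(1)[OF Ch that] C1_onD(1)[OF Ch1 that] .
  have hd: "d_z j ?h z = ?h1 z * d_z j R z" "d_zbar j ?h z = ?h1 z * d_zbar j R z"
    "d_zbar j ?h1 z = ?h2 z * d_zbar j R z" if "z \<in> U" for z j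
    using d_z_real_comp[OF dr h(1)[OF UT[OF that]]] d_z_real_comp(2)[OF dr h(2)[OF UT[OF that]]] by auto
  have A1: "A1 j z = d_z j ?A z" if "z \<in> U" for j z
    using d_z_mult(1)[OF dh(1)[OF that] smooth_differentiable[OF sB], of j] that
    by (simp add: a_def A1_def hd B_def)
  have CA1': "C1_on U (A1 j)" for j
    unfolding A1_def by (intro C1_on_add C1_on_mult Ch Ch1 C1_on_smooth smooth_d_z smooth_R sB)
  have CA1: "C1_on U (d_z j ?A)" for j
    by (rule C1_on_cong[OF U(1) A1 CA1'])
  have A2: "d_zbar k (d_z j ?A) z = ?h2 z * b z * (d_z j R z * d_zbar k R z) + ?h1 z * b z * d_zbar k (d_z j R) z
     + ?h1 z * (d_z j R z * cnj (d_z k B z)) + ?h1 z * (d_z j B z * d_zbar k R z) + ?h z * d_zbar k (d_z j B) z"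
    if z: "z \<in> U" for j k z
  proof -
    have "d_zbar k (d_z j ?A) z = d_zbar k (A1 j) z"
      by (rule d_z_cong(2)[OF U(1) z]) (simp add: A1)
    also have "\<dots> = ?h2 z * b z * (d_z j R z * d_zbar k R z) + ?h1 z * b z * d_zbar k (d_z j R) z
     + ?h1 z * (d_z j R z * cnj (d_z k B z)) + ?h1 z * (d_z j B z * d_zbar k R z) + ?h z * d_zbar k (d_z j B) z"
    proof -
      note D = smooth_differentiable[OF smooth_d_z(1)[OF smooth_R]] smooth_differentiable[OF smooth_d_z(1)[OF sB]]
        smooth_differentiable[OF sB] dh[OF z]
      have cB: "cnj (d_z k B z) = d_zbar k B z"
        unfolding B_def by (rule d_z_of_real[OF smooth_differentiable[OF b]])
      have "d_zbar k (A1 j) z = (?h1 z * d_z j R z) * d_zbar k B z + d_zbar k (\<lambda>z. ?h1 z * d_z j R z) z * B z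
          + (?h z * d_zbar k (d_z j B) z + d_zbar k ?h z * d_z j B z)"
        unfolding A1_def[abs_def] using D by (simp add: d_z_add d_z_mult)
      then show ?thesis using D by (simp add: d_z_mult hd[OF z] cB algebra_simps) (simp add: B_def)
    qed
    finally show ?thesis .
  qed
  have "(LINT z:\<Omega>|lborel. a z * (dbar_sq p w z + norm_sq p (divergence w) z - grad_sq p w z)
     + 2 * Re (\<Sum>K | card K = p. (\<Sum>j\<in>UNIV. d_z j ?A z * con w j K z) * cnj (divergence w K z))
     + Re (\<Sum>K | card K = p. \<Sum>j\<in>UNIV. \<Sum>k\<in>UNIV.
         d_zbar k (d_z j ?A) z * (con w j K z * cnj (con w k K z)))) = 0"
    by (rule kohn_morrey_hoermander[OF u U CA CA1]) (simp add: a_def rho_frontier h(4))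
  also have "(LINT z:\<Omega>|lborel. a z * (dbar_sq p w z + norm_sq p (divergence w) z - grad_sq p w z)
     + 2 * Re (\<Sum>K | card K = p. (\<Sum>j\<in>UNIV. d_z j ?A z * con w j K z) * cnj (divergence w K z))
     + Re (\<Sum>K | card K = p. \<Sum>j\<in>UNIV. \<Sum>k\<in>UNIV.
         d_zbar k (d_z j ?A) z * (con w j K z * cnj (con w k K z)))) = 
    (LINT z:\<Omega>|lborel. h (\<rho> z) * b z * (dbar_sq p w z + norm_sq p (divergence w) z - grad_sq p w z)
     + 2 * (\<Sum>K | card K = p. Re ((of_real (h1 (\<rho> z) * b z) * normal_part w K z
          + of_real (h (\<rho> z)) * (\<Sum>j\<in>UNIV. d_z j B z * con w j K z)) * cnj (divergence w K z)))
     + h2 (\<rho> z) * b z * norm_sq p (normal_part w) z + h1 (\<rho> z) * b z * levi p w z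
     + 2 * h1 (\<rho> z) * (\<Sum>K | card K = p. Re (normal_part w K z * cnj (\<Sum>j\<in>UNIV. d_z j B z * con w j K z)))
     + h (\<rho> z) * Re (\<Sum>K | card K = p. \<Sum>j\<in>UNIV. \<Sum>k\<in>UNIV. d_zbar k (d_z j B) z * (con w j K z * cnj (con w k K z))))"
  proof (rule set_lebesgue_integral_cong')
    fix z assume "z \<in> \<Omega>"
    then have z: "z \<in> U" using U(2) domain_subset_closure by blast
    define N where "N K = normal_part w K z" for K
    define Y where "Y K = (\<Sum>j\<in>UNIV. d_z j B z * con w j K z)" for K
    have e1: "(\<Sum>j\<in>UNIV. d_z j ?A z * con w j K z) = of_real (h1 (\<rho> z) * b z) * N K + of_real (h (\<rho> z)) * Y K" for K
      unfolding A1[OF z, symmetric] A1_def N_def Y_def normal_part_def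
      by (simp add: sum_distrib_left sum.distrib[symmetric] algebra_simps B_def)
    have nn: "(\<Sum>j\<in>UNIV. \<Sum>k\<in>UNIV. d_z j R z * d_zbar k R z * (con w j K z * cnj (con w k K z))) = N K * cnj (N K)" for K
      by (simp add: N_def normal_part_def sum_product cnj_d_z_R mult_ac)
    have ny: "(\<Sum>j\<in>UNIV. \<Sum>k\<in>UNIV. d_z j R z * cnj (d_z k B z) * (con w j K z * cnj (con w k K z))) = N K * cnj (Y K)" for K
      by (subst sum.swap) (simp add: N_def Y_def normal_part_def sum_product mult_ac)
    have yn: "(\<Sum>j\<in>UNIV. \<Sum>k\<in>UNIV. d_z j B z * d_zbar k R z * (con w j K z * cnj (con w k K z))) = Y K * cnj (N K)" for K
      by (simp add: N_def Y_def normal_part_def sum_product cnj_d_z_R mult_ac)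
    have "(\<Sum>K | card K = p. \<Sum>j\<in>UNIV. \<Sum>k\<in>UNIV. d_zbar k (d_z j ?A) z * (con w j K z * cnj (con w k K z)))
      = (\<Sum>K | card K = p. ?h2 z * b z * (\<Sum>j\<in>UNIV. \<Sum>k\<in>UNIV. d_z j R z * d_zbar k R z * (con w j K z * cnj (con w k K z)))
        + ?h1 z * b z * (\<Sum>j\<in>UNIV. \<Sum>k\<in>UNIV. d_zbar k (d_z j R) z * (con w j K z * cnj (con w k K z)))
        + ?h1 z * (\<Sum>j\<in>UNIV. \<Sum>k\<in>UNIV. d_z j R z * cnj (d_z k B z) * (con w j K z * cnj (con w k K z)))
        + ?h1 z * (\<Sum>j\<in>UNIV. \<Sum>k\<in>UNIV. d_z j B z * d_zbar k R z * (con w j K z * cnj (con w k K z)))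
        + ?h z * (\<Sum>j\<in>UNIV. \<Sum>k\<in>UNIV. d_zbar k (d_z j B) z * (con w j K z * cnj (con w k K z))))"
      unfolding A2[OF z] by (simp only: sum_distrib_left distrib_right sum.distrib mult.assoc)
    also have "\<dots> = ?h2 z * b z * (\<Sum>K | card K = p. N K * cnj (N K))
        + ?h1 z * b z * (\<Sum>K | card K = p. \<Sum>j\<in>UNIV. \<Sum>k\<in>UNIV. d_zbar k (d_z j R) z * (con w j K z * cnj (con w k K z)))
        + ?h1 z * (\<Sum>K | card K = p. N K * cnj (Y K) + Y K * cnj (N K))
        + ?h z * (\<Sum>K | card K = p. \<Sum>j\<in>UNIV. \<Sum>k\<in>UNIV. d_zbar k (d_z j B) z * (con w j K z * cnj (con w k K z)))"
      unfolding nn ny yn by (simp only: sum.distrib sum_distrib_left distrib_left) (simp only: add_ac)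
    finally have E: "(\<Sum>K | card K = p. \<Sum>j\<in>UNIV. \<Sum>k\<in>UNIV. d_zbar k (d_z j ?A) z * (con w j K z * cnj (con w k K z)))
      = ?h2 z * b z * (\<Sum>K | card K = p. N K * cnj (N K))
        + ?h1 z * b z * (\<Sum>K | card K = p. \<Sum>j\<in>UNIV. \<Sum>k\<in>UNIV. d_zbar k (d_z j R) z * (con w j K z * cnj (con w k K z)))
        + ?h1 z * (\<Sum>K | card K = p. N K * cnj (Y K) + Y K * cnj (N K))
        + ?h z * (\<Sum>K | card K = p. \<Sum>j\<in>UNIV. \<Sum>k\<in>UNIV. d_zbar k (d_z j B) z * (con w j K z * cnj (con w k K z)))" .
    have e2: "Re (\<Sum>K | card K = p. \<Sum>j\<in>UNIV. \<Sum>k\<in>UNIV. d_zbar k (d_z j ?A) z * (con w j K z * cnj (con w k K z)))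
      = h2 (\<rho> z) * b z * norm_sq p (normal_part w) z + h1 (\<rho> z) * b z * levi p w z
        + h1 (\<rho> z) * (2 * (\<Sum>K | card K = p. Re (N K * cnj (Y K))))
        + h (\<rho> z) * Re (\<Sum>K | card K = p. \<Sum>j\<in>UNIV. \<Sum>k\<in>UNIV. d_zbar k (d_z j B) z * (con w j K z * cnj (con w k K z)))"
    proof -
      have 1: "(\<Sum>K | card K = p. N K * cnj (N K)) = of_real (norm_sq p (normal_part w) z)"
        by (simp add: norm_sq_def N_def complex_norm_square del: of_real_power)
      have "Re (N K * cnj (Y K) + Y K * cnj (N K)) = 2 * Re (N K * cnj (Y K))" for K
        by (simp add: algebra_simps)
      then have 2: "Re (\<Sum>K | card K = p. N K * cnj (Y K) + Y K * cnj (N K)) = 2 * (\<Sum>K | card K = p. Re (N K * cnj (Y K)))"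
        unfolding Re_sum sum_distrib_left by (simp only:)
      have 3: "Re (of_real x * c) = x * Re c" for x c by simp
      show ?thesis
        unfolding E 1 levi_def
        by (simp only: plus_complex.sel 3 of_real_mult[symmetric] Re_complex_of_real 2)
    qed
    show "a z * (dbar_sq p w z + norm_sq p (divergence w) z - grad_sq p w z)
     + 2 * Re (\<Sum>K | card K = p. (\<Sum>j\<in>UNIV. d_z j ?A z * con w j K z) * cnj (divergence w K z))
     + Re (\<Sum>K | card K = p. \<Sum>j\<in>UNIV. \<Sum>k\<in>UNIV.
         d_zbar k (d_z j ?A) z * (con w j K z * cnj (con w k K z))) =
     h (\<rho> z) * b z * (dbar_sq p w z + norm_sq p (divergence w) z - grad_sq p w z)
     + 2 * (\<Sum>K | card K = p. Re ((of_real (h1 (\<rho> z) * b z) * normal_part w K z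
          + of_real (h (\<rho> z)) * (\<Sum>j\<in>UNIV. d_z j B z * con w j K z)) * cnj (divergence w K z)))
     + h2 (\<rho> z) * b z * norm_sq p (normal_part w) z + h1 (\<rho> z) * b z * levi p w z
     + 2 * h1 (\<rho> z) * (\<Sum>K | card K = p. Re (normal_part w K z * cnj (\<Sum>j\<in>UNIV. d_z j B z * con w j K z)))
     + h (\<rho> z) * Re (\<Sum>K | card K = p. \<Sum>j\<in>UNIV. \<Sum>k\<in>UNIV. d_zbar k (d_z j B) z * (con w j K z * cnj (con w k K z)))"
      unfolding e2 e1
      unfolding Re_sum[of "\<lambda>K. _ K * cnj (divergence w K z)"] N_def[symmetric] Y_def[symmetric] a_def
      by (simp only: mult.assoc mult.left_commute[of 2] add.assoc)
  qed
  finally show ?thesis .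
qed

end

section \<open>Derivatives of the squared distance and of shifted powers\<close>

lemma smooth_coord: "smooth (\<lambda>z :: complex ^ 'n::finite. z $ i)"
  by (rule smooth_linear) (rule bounded_linear_vec_nth)

lemma d_z_coord:
  fixes z :: "complex ^ 'n::finite"
  shows "d_z j (\<lambda>z. z $ i) z = (if i = j then 1 else 0)" "d_zbar j (\<lambda>z. z $ i) z = 0"
proof -
  have "dir_deriv v (\<lambda>z. z $ i) z = v $ i" for v :: "complex ^ 'n"
    by (rule dir_deriv_eqI[OF bounded_linear_imp_has_derivative[OF bounded_linear_vec_nth]])
  then show "d_z j (\<lambda>z. z $ i) z = (if i = j then 1 else 0)" "d_zbar j (\<lambda>z. z $ i) z = 0"
    by (auto simp: d_z_def d_zbar_def axis_def)
qed

lemma norm_sq_coord: "complex_of_real ((norm (z - x))\<^sup>2) = (\<Sum>i\<in>UNIV. (z $ i - x $ i) * cnj (z $ i - x $ i))"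
proof -
  have "(norm (z - x))\<^sup>2 = (\<Sum>i\<in>UNIV. (cmod (z $ i - x $ i))\<^sup>2)"
    by (simp add: norm_vec_def L2_set_def sum_nonneg)
  then show ?thesis by (simp add: complex_norm_square del: of_real_power complex_cnj_diff)
qed

lemma smooth_shift: "smooth (\<lambda>z :: complex ^ 'n::finite. z $ i - x $ i)"
  using smooth_add[OF smooth_coord smooth_const[of "- x $ i"], of i] by simp

lemma d_z_shift:
  fixes z :: "complex ^ 'n::finite"
  shows "d_z j (\<lambda>z. z $ i - x $ i) z = (if i = j then 1 else 0)" "d_zbar j (\<lambda>z. z $ i - x $ i) z = 0"
proof -
  have "d_z j (\<lambda>z. z $ i + - x $ i) z = d_z j (\<lambda>z. z $ i) z + d_z j (\<lambda>z. - x $ i) z"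
    "d_zbar j (\<lambda>z. z $ i + - x $ i) z = d_zbar j (\<lambda>z. z $ i) z + d_zbar j (\<lambda>z. - x $ i) z"
    by (rule d_z_add[OF smooth_differentiable[OF smooth_coord] differentiable_const])+
  then show "d_z j (\<lambda>z. z $ i - x $ i) z = (if i = j then 1 else 0)" "d_zbar j (\<lambda>z. z $ i - x $ i) z = 0"
    by (simp_all add: d_z_coord d_z_const)
qed

lemma smooth_norm_sq: "smooth (\<lambda>z :: complex ^ 'n::finite. (norm (z - x))\<^sup>2)"
proof -
  have "smooth (\<lambda>z. complex_of_real ((norm (z - x))\<^sup>2))"
    unfolding norm_sq_coord by (intro smooth_sum smooth_mult smooth_shift smooth_cnj)
  from smooth_bounded_linear[OF bounded_linear_Re this] show ?thesis by simp
qed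

lemma d_z_norm_sq:
  fixes z :: "complex ^ 'n::finite"
  shows "d_z j (\<lambda>z. complex_of_real ((norm (z - x))\<^sup>2)) z = cnj (z $ j - x $ j)"
  "d_zbar j (\<lambda>z. complex_of_real ((norm (z - x))\<^sup>2)) z = z $ j - x $ j"
proof -
  have s: "(\<lambda>z. z $ i - x $ i) differentiable (at z)" for i
    by (rule smooth_differentiable[OF smooth_shift])
  have "d_z j (\<lambda>z. (z $ i - x $ i) * cnj (z $ i - x $ i)) z = (if i = j then cnj (z $ i - x $ i) else 0)"
    "d_zbar j (\<lambda>z. (z $ i - x $ i) * cnj (z $ i - x $ i)) z = (if i = j then z $ i - x $ i else 0)" for i
    using d_z_mult[OF s differentiable_cnj[OF s], of j i i] d_z_cnj[OF s, of j i]
    by (simp_all add: d_z_shift del: complex_cnj_diff)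
  then show "d_z j (\<lambda>z. complex_of_real ((norm (z - x))\<^sup>2)) z = cnj (z $ j - x $ j)"
    "d_zbar j (\<lambda>z. complex_of_real ((norm (z - x))\<^sup>2)) z = z $ j - x $ j"
    unfolding norm_sq_coord
    using d_z_sum[of UNIV "\<lambda>i z. (z $ i - x $ i) * cnj (z $ i - x $ i)" z j] differentiable_mult[OF s differentiable_cnj[OF s]]
    by (simp_all del: complex_cnj_diff)
qed

lemma has_real_derivative_shifted_powr:
  fixes x c r :: real
  assumes "x < c"
  shows "((\<lambda>x. (c - x) powr r) has_real_derivative - (r * (c - x) powr (r - 1))) (at x)"
proof -
  have "((\<lambda>x. c - x) has_real_derivative - 1) (at x)" by (auto intro!: derivative_eq_intros)
  from DERIV_chain2[OF has_real_derivative_powr this, of r] assms show ?thesis by simp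
qed

lemma Re_scaled_le: "Re (of_real c * a * cnj d) \<le> \<bar>c\<bar> * (cmod a * cmod d)"
  using complex_Re_le_cmod[of "of_real c * a * cnj d"]
  by (simp only: norm_mult norm_of_real complex_mod_cnj mult.assoc)

context smooth_domain
begin

section \<open>The estimate for positive \<open>s\<close>\<close>

text \<open>With t = \<epsilon> - \<rho> the second derivative of the profile gives - s (1 - s) t^(s
  - 2) on the normal part. The cross term has coefficient s t^(s - 1), whose square is t^s times
  t^(s - 2) up to constants, so half of the good term absorbs it at the price of t^s times the
  divergence.\<close>

lemma weighted_estimate:
  assumes s: "0 < s" "s < 1" and u: "extends p u w" and p: "Suc p \<le> CARD('n)"
    and psh: "\<And>z. z \<in> closure \<Omega> \<Longrightarrow> any_q_eigenvalues_sum_nonneg (Suc p) (complex_hessian \<rho> z)"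
  shows "set_integrable lborel \<Omega> (\<lambda>z. (s * (1 - s) / 2) * ((- \<rho> z) powr (s - 2) * norm_sq p (normal_part w) z))"
    "(LINT z:\<Omega>|lborel. (s * (1 - s) / 2) * ((- \<rho> z) powr (s - 2) * norm_sq p (normal_part w) z))
      \<le> (1 + 2 * s / (1 - s)) * (LINT z:\<Omega>|lborel. (- \<rho> z) powr s * (dbar_sq p w z + norm_sq p (divergence w) z))"
proof -
  have w: "smooth (w S)" for S using u by (simp add: extends_def)
  \<comment> \<open>The 1 comes from the zeroth order terms; 2 s / (1 - s) is the quotient s^2 /
    \<open>\<kappa>\<close> from the absorbed cross term.\<close>
  define C1 where "C1 = 1 + 2 * s / (1 - s)"
  have C1: "C1 \<ge> 1" using s by (simp add: C1_def)
  \<comment> \<open>Half of the available coefficient s (1 - s); the other half is used up by the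
    cross term.\<close>
  define \<kappa> where "\<kappa> = s * (1 - s) / 2"
  have \<kappa>: "\<kappa> > 0" using s by (simp add: \<kappa>_def)
  let ?N = "norm_sq p (normal_part w)" and ?D = "norm_sq p (divergence w)"
    and ?Q = "dbar_sq p w" and ?G = "grad_sq p w"
  define e where "e n = inverse (real (Suc n))" for n
  have e: "0 < e n" "e n \<le> 1" for n by (auto simp: e_def field_simps)
  have e_lim: "e \<longlonglongrightarrow> 0" using LIMSEQ_inverse_real_of_nat by (simp add: e_def[abs_def])
  have Nc: "continuous_on A ?N" "continuous_on A ?D" "continuous_on A ?Q" "continuous_on A ?G" "continuous_on A (levi p w)" for A
    by (intro continuous_norm_sq continuous_levi smooth_normal_part smooth_divergence w)+
  have KNc: "continuous_on A (normal_part w K)" "continuous_on A (divergence w K)" for A K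
    by (intro smooth_continuous_on smooth_normal_part smooth_divergence w)+
  have pc: "continuous_on (closure \<Omega>) (\<lambda>z. (e n - \<rho> z) powr r)" for n r
  proof -
    have "e n - \<rho> z > 0" if "z \<in> closure \<Omega>" for z using rho_closure[OF that] e[of n] by linarith
    then show ?thesis by (intro continuous_intros rho_continuous) (auto simp: less_imp_neq[symmetric])
  qed
  have est: "(LINT z:\<Omega>|lborel. \<kappa> * ((e n - \<rho> z) powr (s - 2) * ?N z)) \<le> C1 * (LINT z:\<Omega>|lborel. (e n - \<rho> z) powr s * (?Q z + ?D z))" for n
  proof -
    \<comment> \<open>Subtracting the constant makes the profile vanish on the boundary without
      changing derivatives; it also keeps 0 \<le> h(\<rho>) \<le> t^s.\<close>
    define h where "h x = (e n - x) powr s - e n powr s" for x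
    define h1 where "h1 x = - (s * (e n - x) powr (s - 1))" for x
    define h2 where "h2 x = s * (s - 1) * (e n - x) powr (s - 2)" for x
    define I where "I z = h (\<rho> z) * (?Q z + ?D z - ?G z)
       + 2 * (\<Sum>K | card K = p. Re (of_real (h1 (\<rho> z)) * normal_part w K z * cnj (divergence w K z)))
       + h2 (\<rho> z) * ?N z + h1 (\<rho> z) * levi p w z" for z
    have id: "(LINT z:\<Omega>|lborel. h (\<rho> z) * 1 * (dbar_sq p w z + norm_sq p (divergence w) z - grad_sq p w z)
     + 2 * (\<Sum>K | card K = p. Re ((of_real (h1 (\<rho> z) * 1) * normal_part w K z
          + of_real (h (\<rho> z)) * (\<Sum>j\<in>UNIV. d_z j (\<lambda>z. complex_of_real 1) z * con w j K z)) * cnj (divergence w K z)))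
     + h2 (\<rho> z) * 1 * norm_sq p (normal_part w) z + h1 (\<rho> z) * 1 * levi p w z
     + 2 * h1 (\<rho> z) * (\<Sum>K | card K = p. Re (normal_part w K z * cnj (\<Sum>j\<in>UNIV. d_z j (\<lambda>z. complex_of_real 1) z * con w j K z)))
     + h (\<rho> z) * Re (\<Sum>K | card K = p. \<Sum>j\<in>UNIV. \<Sum>k\<in>UNIV. d_zbar k (d_z j (\<lambda>z. complex_of_real 1)) z * (con w j K z * cnj (con w k K z)))) = 0"
    proof (rule twisted_identity[OF u, of "{..<e n}"])
      show "(h has_real_derivative h1 x) (at x)" if "x \<in> {..<e n}" for x
        using DERIV_diff[OF has_real_derivative_shifted_powr[of x "e n" s] DERIV_const] that
        by (simp add: h_def[abs_def] h1_def)
      show "(h1 has_real_derivative h2 x) (at x)" if "x \<in> {..<e n}" for x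
      proof -
        have "x < e n" using that by simp
        from DERIV_cmult[OF has_real_derivative_shifted_powr[OF this, of "s - 1"], of "- s"]
        show ?thesis by (simp add: h1_def[abs_def] h2_def algebra_simps)
      qed
      show "continuous_on {..<e n} h2" unfolding h2_def by (intro continuous_intros) auto
    qed (use rho_closure e[of n] in \<open>auto simp: h_def intro: le_less_trans smooth_const\<close>)
    have "d_z j (\<lambda>z :: (complex, 'n) vec. 1) = (\<lambda>z. 0)" for j by (auto simp: d_z_const)
    then have int0: "(LINT z:\<Omega>|lborel. I z) = 0"
      using id by (simp add: d_z_const I_def[abs_def])
    have hc: "continuous_on (closure \<Omega>) (\<lambda>z. h (\<rho> z))" "continuous_on (closure \<Omega>) (\<lambda>z. h1 (\<rho> z))" "continuous_on (closure \<Omega>) (\<lambda>z. h2 (\<rho> z))"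
      unfolding h_def h1_def h2_def by (intro continuous_intros pc)+
    have Ic: "continuous_on (closure \<Omega>) I"
      unfolding I_def by (intro continuous_intros hc Nc KNc)
    have le: "I z \<le> C1 * ((e n - \<rho> z) powr s * (?Q z + ?D z)) - \<kappa> * ((e n - \<rho> z) powr (s - 2) * ?N z)" if z: "z \<in> \<Omega>" for z
    proof -
      define t where "t = e n - \<rho> z"
      have t: "t > 0" "e n < t" using rho_neg[OF z] e[of n] by (auto simp: t_def)
      \<comment> \<open>The good term is -2 T times the normal part: one T goes to the cross term,
        one T remains as the left side.\<close>
      define T where "T = \<kappa> * t powr (s - 2)"
      have T: "T > 0" using \<kappa> t by (simp add: T_def)
      have h0: "0 \<le> h (\<rho> z)" "h (\<rho> z) \<le> t powr s"
        using powr_mono2[of s "e n" t] e[of n] t s by (auto simp: h_def t_def[symmetric] less_imp_le)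
      have h1: "h1 (\<rho> z) = - (s * t powr (s - 1))" "h1 (\<rho> z) \<le> 0" using s by (auto simp: h1_def t_def)
      have h2: "h2 (\<rho> z) = - 2 * T" by (simp add: h2_def T_def \<kappa>_def t_def field_simps)
      have quot: "(s * t powr (s - 1))\<^sup>2 / T = 2 * s / (1 - s) * t powr s"
      proof -
        have "(t powr (s - 1))\<^sup>2 = t powr s * t powr (s - 2)"
          by (simp add: power2_eq_square powr_add[symmetric])
        then show ?thesis using t s by (simp add: T_def \<kappa>_def power_mult_distrib field_simps power2_eq_square)
      qed
      have cross: "2 * Re (of_real (h1 (\<rho> z)) * normal_part w K z * cnj (divergence w K z))
          \<le> (cmod (normal_part w K z))\<^sup>2 * T + 2 * s / (1 - s) * t powr s * (cmod (divergence w K z))\<^sup>2" for K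
      proof -
        have "Re (of_real (h1 (\<rho> z)) * normal_part w K z * cnj (divergence w K z)) \<le>
            cmod (normal_part w K z) * (s * t powr (s - 1) * cmod (divergence w K z))"
          using Re_scaled_le[of "h1 (\<rho> z)" "normal_part w K z" "divergence w K z"] s
          by (simp add: h1(1) abs_mult mult_ac)
        then have "2 * Re (of_real (h1 (\<rho> z)) * normal_part w K z * cnj (divergence w K z)) \<le>
            2 * (cmod (normal_part w K z) * (s * t powr (s - 1) * cmod (divergence w K z)))" by linarith
        also have "\<dots> \<le> (cmod (normal_part w K z))\<^sup>2 * T + (s * t powr (s - 1) * cmod (divergence w K z))\<^sup>2 / T"
          by (rule two_mult_le_weighted[OF T])
        also have "(s * t powr (s - 1) * cmod (divergence w K z))\<^sup>2 / T = 2 * s / (1 - s) * t powr s * (cmod (divergence w K z))\<^sup>2"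
          unfolding power_mult_distrib[of "s * t powr (s - 1)"] quot[symmetric] by simp
        finally show ?thesis .
      qed
      have "2 * (\<Sum>K | card K = p. Re (of_real (h1 (\<rho> z)) * normal_part w K z * cnj (divergence w K z)))
          \<le> (\<Sum>K | card K = p. (cmod (normal_part w K z))\<^sup>2 * T + 2 * s / (1 - s) * t powr s * (cmod (divergence w K z))\<^sup>2)"
        unfolding sum_distrib_left by (rule sum_mono) (rule cross)
      also have "\<dots> = T * ?N z + 2 * s / (1 - s) * t powr s * ?D z"
        by (simp add: norm_sq_def sum.distrib sum_distrib_left mult_ac)
      finally have S: "2 * (\<Sum>K | card K = p. Re (of_real (h1 (\<rho> z)) * normal_part w K z * cnj (divergence w K z)))
         \<le> T * ?N z + 2 * s / (1 - s) * t powr s * ?D z" .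
      have L: "h1 (\<rho> z) * levi p w z \<le> 0"
        using h1(2) levi_nonneg[OF p psh[OF domain_subset_closure[OF z]]] by (simp add: mult_nonpos_nonneg)
      have "h (\<rho> z) * (?Q z + ?D z - ?G z) \<le> h (\<rho> z) * (?Q z + ?D z)"
        using h0 norm_sq_nonneg by (intro mult_left_mono) auto
      also have "\<dots> \<le> t powr s * (?Q z + ?D z)"
        using h0 norm_sq_nonneg by (intro mult_right_mono) (auto intro: add_nonneg_nonneg)
      finally have 1: "h (\<rho> z) * (?Q z + ?D z - ?G z) \<le> t powr s * (?Q z + ?D z)" .
      have "2 * s / (1 - s) * t powr s * ?D z \<le> 2 * s / (1 - s) * t powr s * (?Q z + ?D z)"
        using s norm_sq_nonneg by (intro mult_left_mono) auto
      then have "I z \<le> t powr s * (?Q z + ?D z) + 2 * s / (1 - s) * t powr s * (?Q z + ?D z) + T * ?N z - 2 * T * ?N z"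
        using S L 1 unfolding I_def h2 by linarith
      then show ?thesis by (simp add: C1_def T_def t_def algebra_simps add_divide_distrib)
    qed
    have i1: "set_integrable lborel \<Omega> (\<lambda>z. (e n - \<rho> z) powr s * (?Q z + ?D z))"
      "set_integrable lborel \<Omega> (\<lambda>z. \<kappa> * ((e n - \<rho> z) powr (s - 2) * ?N z))"
      by (intro int_cont continuous_intros pc Nc)+
    have "0 \<le> (LINT z:\<Omega>|lborel. C1 * ((e n - \<rho> z) powr s * (?Q z + ?D z)) - \<kappa> * ((e n - \<rho> z) powr (s - 2) * ?N z))"
      unfolding int0[symmetric] by (intro set_integral_mono int_cont[OF Ic] set_integral_diff(1) set_integrable_mult_right i1 le)
    also have "\<dots> = (LINT z:\<Omega>|lborel. C1 * ((e n - \<rho> z) powr s * (?Q z + ?D z))) - (LINT z:\<Omega>|lborel. \<kappa> * ((e n - \<rho> z) powr (s - 2) * ?N z))"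
      by (intro set_integral_diff set_integrable_mult_right i1)
    finally show ?thesis by simp
  qed
  have c0: "continuous_on (closure \<Omega>) (\<lambda>z. (- \<rho> z) powr s)"
    using s by (intro continuous_on_powr' continuous_intros rho_continuous) (auto dest: rho_closure)
  have c1: "continuous_on (closure \<Omega>) (\<lambda>z. (1 - \<rho> z) powr s)"
    using s by (intro continuous_intros rho_continuous) (force dest: rho_closure)
  have lim: "(\<lambda>n. (e n - \<rho> z) powr r) \<longlonglongrightarrow> (- \<rho> z) powr r" if "z \<in> \<Omega>" for z r
  proof -
    have "(\<lambda>n. (e n - \<rho> z) powr r) \<longlonglongrightarrow> (0 - \<rho> z) powr r"
      using rho_neg[OF that] by (intro tendsto_intros e_lim) auto
    then show ?thesis by simp
  qed
  \<comment> \<open>On the right \<epsilon> \<le> 1 gives the dominating weight (1 - \<rho>)^s. On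
    the left the limiting weight is singular, so Fatou's lemma is used there.\<close>
  have RL: "(\<lambda>n. C1 * (LINT z:\<Omega>|lborel. (e n - \<rho> z) powr s * (?Q z + ?D z))) \<longlonglongrightarrow>
     C1 * (LINT z:\<Omega>|lborel. (- \<rho> z) powr s * (?Q z + ?D z))"
  proof (intro tendsto_mult tendsto_const set_integral_tendsto[where w="\<lambda>z. (1 - \<rho> z) powr s * (?Q z + ?D z)"])
    show "\<bar>(e n - \<rho> z) powr s * (?Q z + ?D z)\<bar> \<le> (1 - \<rho> z) powr s * (?Q z + ?D z)" if "z \<in> \<Omega>" for n z
      using rho_neg[OF that] e[of n] s norm_sq_nonneg
      by (auto simp: abs_mult abs_of_nonneg add_nonneg_nonneg intro!: mult_right_mono powr_mono2)
  qed (intro int_cont continuous_intros pc c0 c1 Nc lim; assumption)+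
  have F: "set_integrable lborel \<Omega> (\<lambda>z. \<kappa> * ((- \<rho> z) powr (s - 2) * ?N z))"
    "(LINT z:\<Omega>|lborel. \<kappa> * ((- \<rho> z) powr (s - 2) * ?N z)) \<le> C1 * (LINT z:\<Omega>|lborel. (- \<rho> z) powr s * (?Q z + ?D z))"
  proof (atomize(full), rule conjI)
    note A = fatou_set_integral[OF measurable_domain _ _ _ est RL, of "\<lambda>z. \<kappa> * ((- \<rho> z) powr (s - 2) * ?N z)"]
    have 1: "set_integrable lborel \<Omega> (\<lambda>z. \<kappa> * ((e n - \<rho> z) powr (s - 2) * ?N z))" for n
      by (intro int_cont continuous_intros pc Nc)
    have 2: "0 \<le> \<kappa> * ((e n - \<rho> z) powr (s - 2) * ?N z)" for n z using \<kappa> norm_sq_nonneg by simp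
    have 3: "(\<lambda>n. \<kappa> * ((e n - \<rho> z) powr (s - 2) * ?N z)) \<longlonglongrightarrow> \<kappa> * ((- \<rho> z) powr (s - 2) * ?N z)" if "z \<in> \<Omega>" for z
      by (intro tendsto_intros lim that)
    show "set_integrable lborel \<Omega> (\<lambda>z. \<kappa> * ((- \<rho> z) powr (s - 2) * ?N z))" by (rule A(1)[OF 1 2 3])
    show "(LINT z:\<Omega>|lborel. \<kappa> * ((- \<rho> z) powr (s - 2) * ?N z)) \<le> C1 * (LINT z:\<Omega>|lborel. (- \<rho> z) powr s * (?Q z + ?D z))"
      by (rule A(2)[OF 1 2 3])
  qed
  show "set_integrable lborel \<Omega> (\<lambda>z. (s * (1 - s) / 2) * ((- \<rho> z) powr (s - 2) * norm_sq p (normal_part w) z))"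
    "(LINT z:\<Omega>|lborel. (s * (1 - s) / 2) * ((- \<rho> z) powr (s - 2) * norm_sq p (normal_part w) z))
      \<le> (1 + 2 * s / (1 - s)) * (LINT z:\<Omega>|lborel. (- \<rho> z) powr s * (dbar_sq p w z + norm_sq p (divergence w) z))"
    using F unfolding \<kappa>_def C1_def .
qed

section \<open>The unweighted basic estimate\<close>

text \<open>With the profile h = 1 - exp(\<rho>/\<epsilon>) the weight tends to b on the whole
  domain, while h' and h'' live in a boundary layer. Dropping the nonpositive Levi term and letting
  the layer shrink leaves an unweighted bound; the Hessian of b = M - |z|^2 supplies the square norm
  of u.\<close>

lemma basic_estimate:
  assumes u: "extends p u w" and p: "Suc p \<le> CARD('n)"
    and psh: "\<And>z. z \<in> closure \<Omega> \<Longrightarrow> any_q_eigenvalues_sum_nonneg (Suc p) (complex_hessian \<rho> z)"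
    and M: "1 \<le> M" "\<And>z. z \<in> closure \<Omega> \<Longrightarrow> (norm z)\<^sup>2 + 1 \<le> M"
  shows "(LINT z:\<Omega>|lborel. grad_sq p w z + norm_sq (Suc p) w z / 2)
    \<le> 3 * M * (LINT z:\<Omega>|lborel. dbar_sq p w z + norm_sq p (divergence w) z)"
proof -
  have w: "smooth (w S)" for S using u by (simp add: extends_def)
  let ?N = "norm_sq p (normal_part w)" and ?D = "norm_sq p (divergence w)"
    and ?Q = "dbar_sq p w" and ?G = "grad_sq p w" and ?W = "norm_sq (Suc p) w"
  define e where "e n = inverse (real (Suc n))" for n
  have e: "0 < e n" for n by (auto simp: e_def)
  \<comment> \<open>The choice of M gives 1 \<le> b \<le> M on the closure and |\<partial>b|^2 =
    |z|^2 \<le> M.\<close>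
  define b where "b z = M - (norm (z - 0))\<^sup>2" for z :: "(complex, 'n) vec"
  have sb: "smooth b"
  proof -
    have "b = (\<lambda>z. M + (-1) * (norm (z - 0))\<^sup>2)" by (auto simp: b_def)
    moreover have "smooth (\<lambda>z. M + (-1) * (norm (z - (0 :: (complex, 'n) vec)))\<^sup>2)"
      by (intro smooth_add[OF smooth_const smooth_mult[OF smooth_const smooth_norm_sq]])
    ultimately show ?thesis by (simp only:)
  qed
  let ?B = "\<lambda>z. complex_of_real (b z)"
  have B1: "d_z j ?B = (\<lambda>z. - cnj (z $ j))" for j
  proof
    fix z :: "(complex, 'n) vec"
    define n where "n = (\<lambda>z :: (complex, 'n) vec. complex_of_real ((norm (z - 0))\<^sup>2))"
    have dn: "n differentiable (at z)"
      unfolding n_def by (intro smooth_differentiable smooth_of_real smooth_norm_sq)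
    have "?B = (\<lambda>z. complex_of_real M + (-1) * n z)" by (auto simp: b_def n_def)
    then have "d_z j ?B z = d_z j (\<lambda>z. complex_of_real M + (-1) * n z) z" by (simp only:)
    also have "\<dots> = d_z j (\<lambda>z. complex_of_real M) z + d_z j (\<lambda>z. (-1) * n z) z"
      using dn by (intro d_z_add(1) differentiable_mult differentiable_const)
    also have "d_z j (\<lambda>z. (-1) * n z) z = (-1) * d_z j n z + d_z j (\<lambda>z. -1) z * n z"
      using dn by (intro d_z_mult(1) differentiable_const)
    finally show "d_z j ?B z = - cnj (z $ j)"
      unfolding n_def d_z_norm_sq(1) d_z_const by simp
  qed
  have B2: "d_zbar k (d_z j ?B) z = (if j = k then -1 else 0)" for j k z
  proof -
    have "d_zbar k (\<lambda>z. - cnj (z $ j)) z = d_zbar k (\<lambda>z. (-1) * cnj (z $ j)) z" by simp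
    also have "\<dots> = (if j = k then -1 else 0)"
      by (subst d_z_mult(2)) (auto simp: d_z_const d_z_cnj(2)[OF smooth_differentiable[OF smooth_coord]] d_z_coord
          intro!: smooth_differentiable smooth_cnj smooth_coord)
    finally show ?thesis by (simp add: B1)
  qed
  define Y where "Y K z = (\<Sum>j\<in>UNIV. d_z j ?B z * con w j K z)" for K z
  have Y2: "(\<Sum>K | card K = p. (cmod (Y K z))\<^sup>2) \<le> M * ?W z" if "z \<in> closure \<Omega>" for z
  proof -
    have "(\<Sum>K | card K = p. (cmod (Y K z))\<^sup>2) \<le> (\<Sum>k\<in>UNIV. (cmod (d_z k ?B z))\<^sup>2) * ?W z"
      unfolding Y_def con_def norm_sq_def by (rule contraction_le)
    also have "(\<Sum>k\<in>UNIV. (cmod (d_z k ?B z))\<^sup>2) = (norm z)\<^sup>2"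
      by (simp add: B1 norm_vec_def L2_set_def sum_nonneg)
    also have "(norm z)\<^sup>2 * ?W z \<le> M * ?W z"
      using M(2)[OF that] norm_sq_nonneg by (intro mult_right_mono) auto
    finally show ?thesis .
  qed
  have hess: "Re (\<Sum>K | card K = p. \<Sum>j\<in>UNIV. \<Sum>k\<in>UNIV. d_zbar k (d_z j ?B) z * (con w j K z * cnj (con w k K z))) = - (real (Suc p) * ?W z)" for z
  proof -
    have "(\<Sum>K | card K = p. \<Sum>j\<in>UNIV. \<Sum>k\<in>UNIV. d_zbar k (d_z j ?B) z * (con w j K z * cnj (con w k K z)))
      = (\<Sum>K | card K = p. \<Sum>j\<in>UNIV. - (con w j K z * cnj (con w j K z)))"
      by (simp add: B2 if_distrib if_distribR cong: if_cong)
    also have "\<dots> = - complex_of_real (\<Sum>K | card K = p. \<Sum>j\<in>UNIV. (cmod (con w j K z))\<^sup>2)"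
      by (simp add: sum_negf complex_norm_square del: of_real_power)
    also have "(\<Sum>K | card K = p. \<Sum>j\<in>UNIV. (cmod (con w j K z))\<^sup>2) = real (Suc p) * ?W z"
      unfolding con_def norm_sq_def by (rule contraction_norm_sum)
    finally show ?thesis by simp
  qed
  have Nc: "continuous_on A ?N" "continuous_on A ?D" "continuous_on A ?Q" "continuous_on A ?G" "continuous_on A (levi p w)" "continuous_on A ?W" for A
    by (intro continuous_norm_sq continuous_levi smooth_normal_part smooth_divergence w)+
  have KNc: "continuous_on A (normal_part w K)" "continuous_on A (divergence w K)" for A K
    by (intro smooth_continuous_on smooth_normal_part smooth_divergence w)+
  have Yc: "continuous_on A (Y K)" for A K
    unfolding Y_def[abs_def] by (intro continuous_intros smooth_continuous_on smooth_d_z smooth_of_real sb smooth_con w)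
  have bc: "continuous_on A b" for A by (rule smooth_continuous_on[OF sb])
  have b1: "1 \<le> b z" "b z \<le> M" if "z \<in> closure \<Omega>" for z using M(2)[OF that] by (auto simp: b_def)
  \<comment> \<open>The whole layer error. It contains no negative power of \<epsilon>, so dominated
    convergence removes it.\<close>
  let ?r = "\<lambda>n z. exp (\<rho> z / e n) * (2 * M * ?D z + 2 * M * ?W z)"
  have rc: "continuous_on A (?r n)" for A n using e[of n] by (intro continuous_intros rho_continuous Nc) auto
  have est: "(LINT z:\<Omega>|lborel. (1 - exp (\<rho> z / e n)) * (?G z + ?W z / 2))
     \<le> 3 * M * (LINT z:\<Omega>|lborel. ?Q z + ?D z) + (LINT z:\<Omega>|lborel. ?r n z)" for n
  proof -
    define h where "h x = 1 - exp (x / e n)" for x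
    define h1 where "h1 x = - exp (x / e n) / e n" for x
    define h2 where "h2 x = - exp (x / e n) / e n / e n" for x
    define I where "I z = h (\<rho> z) * b z * (?Q z + ?D z - ?G z)
     + 2 * (\<Sum>K | card K = p. Re ((of_real (h1 (\<rho> z) * b z) * normal_part w K z + of_real (h (\<rho> z)) * Y K z) * cnj (divergence w K z)))
     + h2 (\<rho> z) * b z * ?N z + h1 (\<rho> z) * b z * levi p w z
     + 2 * h1 (\<rho> z) * (\<Sum>K | card K = p. Re (normal_part w K z * cnj (Y K z)))
     + h (\<rho> z) * - (real (Suc p) * ?W z)" for z
    have int0: "(LINT z:\<Omega>|lborel. I z) = 0"
      unfolding I_def Y_def hess[symmetric]
      by (rule twisted_identity[OF u open_UNIV _ sb])
        (use e[of n] in \<open>auto simp: h_def[abs_def] h1_def[abs_def] h2_def[abs_def] intro!: derivative_eq_intros continuous_intros\<close>)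
    have hc: "continuous_on (closure \<Omega>) (\<lambda>z. h (\<rho> z))" "continuous_on (closure \<Omega>) (\<lambda>z. h1 (\<rho> z))" "continuous_on (closure \<Omega>) (\<lambda>z. h2 (\<rho> z))"
      unfolding h_def h1_def h2_def using e[of n] by (auto intro!: continuous_intros rho_continuous)
    have Ic: "continuous_on (closure \<Omega>) I"
      unfolding I_def by (intro continuous_intros hc Nc KNc Yc bc)
    have le: "I z \<le> 3 * M * (?Q z + ?D z) - h (\<rho> z) * (?G z + ?W z / 2) + ?r n z" if z: "z \<in> \<Omega>" for z
    proof -
      have zc: "z \<in> closure \<Omega>" by (rule domain_subset_closure[OF z])
      define E where "E = exp (\<rho> z / e n)"
      have E: "0 < E" "E < 1" using rho_neg[OF z] e[of n] by (auto simp: E_def divide_neg_pos)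
      \<comment> \<open>Half of the good term h'' b. Two cross terms carry h', one with the
        divergence and one with the gradient of b; each uses one T. After absorption the powers of
        \<epsilon> cancel and only multiples of E remain.\<close>
      define T where "T = b z * E / (2 * (e n)\<^sup>2)"
      have bz: "1 \<le> b z" "b z \<le> M" using b1[OF zc] .
      have T: "0 < T" using E bz e[of n] by (simp add: T_def)
      have h: "h (\<rho> z) = 1 - E" "0 \<le> h (\<rho> z)" "h (\<rho> z) \<le> 1" using E by (auto simp: h_def E_def)
      have h1: "h1 (\<rho> z) = - (E / e n)" "h1 (\<rho> z) \<le> 0" using E e[of n] by (auto simp: h1_def E_def)
      have h2: "h2 (\<rho> z) * b z = - (2 * T)" using e[of n] by (simp add: h2_def E_def T_def power2_eq_square)
      have q1: "(E / e n * b z)\<^sup>2 / T = 2 * b z * E" using E e[of n] bz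
        by (simp add: T_def power2_eq_square field_simps)
      have q2: "(E / e n)\<^sup>2 / T \<le> 2 * E"
      proof -
        have "(E / e n)\<^sup>2 / T = 2 * E / b z" using E e[of n] bz by (simp add: T_def power2_eq_square field_simps)
        also have "\<dots> \<le> 2 * E" using E bz by (simp add: field_simps)
        finally show ?thesis .
      qed
      have cross: "2 * Re ((of_real (h1 (\<rho> z) * b z) * normal_part w K z + of_real (h (\<rho> z)) * Y K z) * cnj (divergence w K z))
         + 2 * h1 (\<rho> z) * Re (normal_part w K z * cnj (Y K z)) \<le>
         2 * T * (cmod (normal_part w K z))\<^sup>2 + (2 * b z * E + h (\<rho> z) * (2 * M)) * (cmod (divergence w K z))\<^sup>2
          + (h (\<rho> z) / (2 * M) + 2 * E) * (cmod (Y K z))\<^sup>2" for K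
      proof -
        define n1 where "n1 = cmod (normal_part w K z)"
        define d1 where "d1 = cmod (divergence w K z)"
        define y1 where "y1 = cmod (Y K z)"
        have a1: "\<bar>h1 (\<rho> z) * b z\<bar> = E / e n * b z" and a2: "\<bar>h1 (\<rho> z)\<bar> = E / e n"
          using E bz e[of n] by (auto simp: h1 abs_mult)
        have "Re (of_real (h1 (\<rho> z) * b z) * normal_part w K z * cnj (divergence w K z)) \<le> n1 * (E / e n * b z * d1)"
          using Re_scaled_le[of "h1 (\<rho> z) * b z" "normal_part w K z" "divergence w K z"]
          unfolding a1 n1_def d1_def by (simp only: mult_ac)
        moreover have "Re (of_real (h (\<rho> z)) * Y K z * cnj (divergence w K z)) \<le> h (\<rho> z) * (y1 * d1)"
          using Re_scaled_le[of "h (\<rho> z)" "Y K z" "divergence w K z"] h(2)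
          unfolding y1_def d1_def by simp
        moreover have "h1 (\<rho> z) * Re (normal_part w K z * cnj (Y K z)) \<le> n1 * (E / e n * y1)"
        proof -
          have "h1 (\<rho> z) * Re (normal_part w K z * cnj (Y K z)) = Re (of_real (h1 (\<rho> z)) * normal_part w K z * cnj (Y K z))" by (simp add: algebra_simps)
          also have "\<dots> \<le> n1 * (E / e n * y1)"
            using Re_scaled_le[of "h1 (\<rho> z)" "normal_part w K z" "Y K z"]
            unfolding a2 n1_def y1_def by (simp only: mult_ac)
          finally show ?thesis .
        qed
        moreover have "2 * (n1 * (E / e n * b z * d1)) \<le> n1\<^sup>2 * T + 2 * b z * E * d1\<^sup>2"
          using two_mult_le_weighted[OF T, of n1 "E / e n * b z * d1"]
          unfolding power_mult_distrib[of "E / e n * b z"] times_divide_eq_left[symmetric] q1 .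
        moreover have "2 * (n1 * (E / e n * y1)) \<le> n1\<^sup>2 * T + 2 * E * y1\<^sup>2"
        proof -
          have "2 * (n1 * (E / e n * y1)) \<le> n1\<^sup>2 * T + (E / e n)\<^sup>2 / T * y1\<^sup>2"
            using two_mult_le_weighted[OF T, of n1 "E / e n * y1"]
            unfolding power_mult_distrib[of "E / e n" y1] times_divide_eq_left[symmetric] .
          also have "\<dots> \<le> n1\<^sup>2 * T + 2 * E * y1\<^sup>2" by (intro add_left_mono mult_right_mono q2) auto
          finally show ?thesis .
        qed
        \<comment> \<open>The weight 2 M is chosen so that, with |Y|^2 \<le> M |u|^2, this term
          costs just half of the good term h |u|^2.\<close>
        moreover have "2 * (h (\<rho> z) * (y1 * d1)) \<le> h (\<rho> z) * (2 * M) * d1\<^sup>2 + h (\<rho> z) / (2 * M) * y1\<^sup>2"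
        proof -
          have "h (\<rho> z) * (2 * (d1 * y1)) \<le> h (\<rho> z) * (d1\<^sup>2 * (2 * M) + y1\<^sup>2 / (2 * M))"
            using M(1) h(2) by (intro mult_left_mono two_mult_le_weighted) auto
          then show ?thesis by (simp add: algebra_simps)
        qed
        ultimately show ?thesis
          unfolding n1_def[symmetric] d1_def[symmetric] y1_def[symmetric] by (simp add: algebra_simps)
      qed
      let ?Y2 = "\<Sum>K | card K = p. (cmod (Y K z))\<^sup>2"
      have "2 * (\<Sum>K | card K = p. Re ((of_real (h1 (\<rho> z) * b z) * normal_part w K z + of_real (h (\<rho> z)) * Y K z) * cnj (divergence w K z)))
         + 2 * h1 (\<rho> z) * (\<Sum>K | card K = p. Re (normal_part w K z * cnj (Y K z)))
         \<le> (\<Sum>K | card K = p. 2 * T * (cmod (normal_part w K z))\<^sup>2 + (2 * b z * E + h (\<rho> z) * (2 * M)) * (cmod (divergence w K z))\<^sup>2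
          + (h (\<rho> z) / (2 * M) + 2 * E) * (cmod (Y K z))\<^sup>2)"
        unfolding sum_distrib_left sum.distrib[symmetric] by (rule sum_mono) (rule cross)
      also have "\<dots> = 2 * T * ?N z + (2 * b z * E + h (\<rho> z) * (2 * M)) * ?D z + (h (\<rho> z) / (2 * M) + 2 * E) * ?Y2"
        by (simp only: norm_sq_def sum.distrib sum_distrib_left)
      finally have S: "2 * (\<Sum>K | card K = p. Re ((of_real (h1 (\<rho> z) * b z) * normal_part w K z + of_real (h (\<rho> z)) * Y K z) * cnj (divergence w K z)))
         + 2 * h1 (\<rho> z) * (\<Sum>K | card K = p. Re (normal_part w K z * cnj (Y K z)))
         \<le> 2 * T * ?N z + (2 * b z * E + h (\<rho> z) * (2 * M)) * ?D z + (h (\<rho> z) / (2 * M) + 2 * E) * ?Y2" .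
      have L: "h1 (\<rho> z) * b z * levi p w z \<le> 0"
        using h1(2) bz levi_nonneg[OF p psh[OF zc]] by (simp add: mult_nonpos_nonneg)
      have nn: "0 \<le> ?Q z" "0 \<le> ?D z" "0 \<le> ?G z" "0 \<le> ?W z" using norm_sq_nonneg by auto
      have y: "(h (\<rho> z) / (2 * M) + 2 * E) * ?Y2 \<le> h (\<rho> z) * ?W z / 2 + 2 * E * M * ?W z"
      proof -
        have "(h (\<rho> z) / (2 * M) + 2 * E) * ?Y2 \<le> (h (\<rho> z) / (2 * M) + 2 * E) * (M * ?W z)"
          using Y2[OF zc] h(2) M(1) E by (intro mult_left_mono) auto
        also have "\<dots> = h (\<rho> z) * ?W z / 2 + 2 * E * M * ?W z" using M(1) by (simp add: field_simps)
        finally show ?thesis .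
      qed
      have d: "(2 * b z * E + h (\<rho> z) * (2 * M)) * ?D z \<le> 2 * M * E * ?D z + 2 * M * ?D z"
      proof -
        have "2 * b z * E + h (\<rho> z) * (2 * M) \<le> 2 * M * E + 2 * M"
        proof -
          have "b z * E \<le> M * E" using bz E by (intro mult_right_mono) auto
          moreover have "h (\<rho> z) * (2 * M) \<le> 1 * (2 * M)" using h M(1) by (intro mult_right_mono) auto
          ultimately show ?thesis by linarith
        qed
        from mult_right_mono[OF this nn(2)] show ?thesis by (simp add: algebra_simps)
      qed
      have hb: "h (\<rho> z) \<le> h (\<rho> z) * b z" "h (\<rho> z) * b z \<le> M"
        using mult_left_mono[OF bz(1) h(2)] mult_mono[OF h(3) bz(2)] bz by auto
      have g: "h (\<rho> z) * b z * (?Q z + ?D z - ?G z) \<le> M * (?Q z + ?D z) - h (\<rho> z) * ?G z"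
        using mult_right_mono[OF hb(2), of "?Q z + ?D z"] mult_right_mono[OF hb(1) nn(3)] nn
        by (simp add: algebra_simps)
      have W: "h (\<rho> z) * ?W z \<le> h (\<rho> z) * (real (Suc p) * ?W z)"
        using h(2) nn by (intro mult_left_mono) (auto simp: algebra_simps)
      \<comment> \<open>The factor 3 M in the conclusion is M from h b \<le> M plus 2 M from the
        cross term of the divergence with the gradient of b.\<close>
      have "I z \<le> M * (?Q z + ?D z) - h (\<rho> z) * ?G z + (2 * M * E * ?D z + 2 * M * ?D z)
          + (h (\<rho> z) * ?W z / 2 + 2 * E * M * ?W z) - h (\<rho> z) * ?W z"
        using S L y d g W unfolding I_def h2 by (simp add: algebra_simps)
      also have "\<dots> \<le> 3 * M * (?Q z + ?D z) - h (\<rho> z) * (?G z + ?W z / 2) + ?r n z"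
        unfolding E_def[symmetric] using mult_nonneg_nonneg[OF _ nn(1), of M] nn M(1) by (simp add: algebra_simps)
      finally show ?thesis .
    qed
    have i1: "set_integrable lborel \<Omega> (\<lambda>z. 3 * M * (?Q z + ?D z))"
      "set_integrable lborel \<Omega> (\<lambda>z. h (\<rho> z) * (?G z + ?W z / 2))" "set_integrable lborel \<Omega> (?r n)"
      by (intro int_cont continuous_intros Nc hc rc; simp)+
    have "0 \<le> (LINT z:\<Omega>|lborel. 3 * M * (?Q z + ?D z) - h (\<rho> z) * (?G z + ?W z / 2) + ?r n z)"
      unfolding int0[symmetric] by (intro set_integral_mono int_cont[OF Ic] set_integral_diff(1) set_integral_add(1) i1 le)
    also have "\<dots> = (LINT z:\<Omega>|lborel. 3 * M * (?Q z + ?D z)) - (LINT z:\<Omega>|lborel. h (\<rho> z) * (?G z + ?W z / 2)) + (LINT z:\<Omega>|lborel. ?r n z)"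
      using i1 by (simp only: set_integral_diff set_integral_add)
    finally show ?thesis by (simp add: h_def)
  qed
  have e_inv: "\<rho> z / e n = real (Suc n) * \<rho> z" for n z by (simp add: e_def field_simps)
  have lim: "(\<lambda>n. exp (\<rho> z / e n)) \<longlonglongrightarrow> 0" if "z \<in> \<Omega>" for z
  proof -
    have "(\<lambda>n. exp (\<rho> z) ^ Suc n) \<longlonglongrightarrow> 0"
      using rho_neg[OF that] by (intro LIMSEQ_Suc LIMSEQ_power_zero) simp
    then show ?thesis unfolding e_inv by (simp add: exp_of_nat_mult[symmetric] del: of_nat_Suc power_Suc)
  qed
  have exp1: "exp (\<rho> z / e n) \<le> 1" if "z \<in> \<Omega>" for z n
    using rho_neg[OF that] e[of n] by (simp add: divide_neg_pos less_imp_le)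
  have "(\<lambda>n. LINT z:\<Omega>|lborel. ?r n z) \<longlonglongrightarrow> (LINT z:\<Omega>|lborel. 0 * (2 * M * ?D z + 2 * M * ?W z))"
  proof (rule set_integral_tendsto[where w="\<lambda>z. 2 * M * ?D z + 2 * M * ?W z"])
    show "\<bar>?r n z\<bar> \<le> 2 * M * ?D z + 2 * M * ?W z" if "z \<in> \<Omega>" for n z
    proof -
      have "0 \<le> 2 * M * ?D z + 2 * M * ?W z" using M(1) norm_sq_nonneg by simp
      then show ?thesis using exp1[OF that, of n] by (simp add: abs_mult mult_left_le_one_le)
    qed
  qed (intro int_cont rc continuous_intros Nc tendsto_intros lim; assumption)+
  then have R: "(\<lambda>n. 3 * M * (LINT z:\<Omega>|lborel. ?Q z + ?D z) + (LINT z:\<Omega>|lborel. ?r n z)) \<longlonglongrightarrow>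
      3 * M * (LINT z:\<Omega>|lborel. ?Q z + ?D z) + 0"
    by (intro tendsto_add tendsto_const) simp
  have "(LINT z:\<Omega>|lborel. ?G z + ?W z / 2) \<le> 3 * M * (LINT z:\<Omega>|lborel. ?Q z + ?D z) + 0"
  proof (rule fatou_set_integral(2)[OF measurable_domain _ _ _ est R])
    show "set_integrable lborel \<Omega> (\<lambda>z. (1 - exp (\<rho> z / e n)) * (?G z + ?W z / 2))" for n
      using e[of n] by (intro int_cont continuous_intros rho_continuous Nc) auto
    show "0 \<le> (1 - exp (\<rho> z / e n)) * (?G z + ?W z / 2)" if "z \<in> \<Omega>" for n z
      using exp1[OF that, of n] norm_sq_nonneg by (intro mult_nonneg_nonneg add_nonneg_nonneg) auto
    show "(\<lambda>n. (1 - exp (\<rho> z / e n)) * (?G z + ?W z / 2)) \<longlonglongrightarrow> ?G z + ?W z / 2" if "z \<in> \<Omega>" for z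
      using tendsto_mult[OF tendsto_diff[OF tendsto_const[of 1] lim[OF that]] tendsto_const[of "?G z + ?W z / 2"]] by simp
  qed
  then show ?thesis by simp
qed

end

section \<open>Tools for the boundary condition\<close>

text \<open>Squaring the positive part makes it C1, which is all that a test form in the adjoint
  relation has to be. At 0 the difference quotient is at most |h|.\<close>

lemma has_real_derivative_pos_part_sq:
  "((\<lambda>x :: real. (max 0 x)\<^sup>2) has_real_derivative 2 * max 0 t) (at t)"
proof -
  consider "t > 0" | "t < 0" | "t = 0" by linarith
  then show ?thesis
  proof cases
    case 1
    have "((\<lambda>x. x\<^sup>2) has_real_derivative 2 * max 0 t) (at t)"
      using 1 by (auto intro!: derivative_eq_intros)
    then show ?thesis
      by (rule has_field_derivative_transform_within_open[of _ _ _ "{0<..}"]) (use 1 in auto)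
  next
    case 2
    have "((\<lambda>x. 0) has_real_derivative 2 * max 0 t) (at t)"
      using 2 by simp
    then show ?thesis
      by (rule has_field_derivative_transform_within_open[of _ _ _ "{..<0}"]) (use 2 in auto)
  next
    case 3
    have "((\<lambda>h::real. (max 0 h)\<^sup>2 / h) \<longlongrightarrow> 0) (at 0)"
    proof (rule Lim_null_comparison)
      show "\<forall>\<^sub>F h in at 0. norm ((max 0 h)\<^sup>2 / h) \<le> \<bar>h :: real\<bar>"
        by (rule always_eventually) (auto simp: max_def power2_eq_square)
      show "((\<lambda>h::real. \<bar>h\<bar>) \<longlongrightarrow> 0) (at 0)"
        using tendsto_rabs[OF tendsto_ident_at, of "0::real" UNIV] by simp
    qed
    then show ?thesis using 3 by (simp add: DERIV_def)
  qed
qed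

lemma abs_Re_of_real_mult_le: "0 \<le> c \<Longrightarrow> \<bar>Re (complex_of_real c * y)\<bar> \<le> c * cmod y"
  using abs_Re_le_cmod[of "complex_of_real c * y"] by (simp only: norm_mult norm_of_real abs_of_nonneg)

lemma zero_if_set_integral_nonpos:
  fixes g :: "'a::euclidean_space \<Rightarrow> real"
  assumes \<Omega>: "open \<Omega>" "bounded \<Omega>" and g: "continuous_on (closure \<Omega>) g" "\<And>z. z \<in> \<Omega> \<Longrightarrow> 0 \<le> g z"
    and le: "(LINT z:\<Omega>|lborel. g z) \<le> 0" and z: "z \<in> \<Omega>"
  shows "g z = 0"
proof (rule ccontr)
  assume "g z \<noteq> 0"
  then have pos: "g z > 0" using g(2)[OF z] by simp
  define S where "S = \<Omega> \<inter> g -` {0<..}"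
  have "continuous_on \<Omega> g" using g(1) closure_subset continuous_on_subset by blast
  then have S: "open S" unfolding S_def using \<Omega>(1) by (intro continuous_open_preimage) auto
  have i: "integrable lborel (\<lambda>z. indicat_real \<Omega> z * g z)"
    using set_integrable_continuous_closure[OF \<Omega> g(1)] by (simp add: set_integrable_def)
  have nn: "0 \<le> indicat_real \<Omega> z * g z" for z using g(2) by (auto simp: indicator_def)
  have "0 \<le> (\<integral>z. indicat_real \<Omega> z * g z \<partial>lborel)" by (rule Bochner_Integration.integral_nonneg) (rule nn)
  then have "(\<integral>z. indicat_real \<Omega> z * g z \<partial>lborel) = 0"
    using le by (simp add: set_lebesgue_integral_def)
  then have ae: "AE z in lborel. indicat_real \<Omega> z * g z = 0"
    using integral_nonneg_eq_0_iff_AE[OF i] nn by simp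
  have "AE z in lborel. z \<notin> S" using ae by eventually_elim (auto simp: S_def indicator_def)
  then have "S \<in> null_sets lborel" using S by (subst AE_iff_null_sets) auto
  then have "negligible S" using null_sets_completionI[of S lborel] by (simp add: negligible_iff_null_sets)
  then show False using open_not_negligible[OF S] pos z by (auto simp: S_def)
qed

context smooth_domain
begin

section \<open>The boundary condition\<close>

text \<open>The test functions \<open>(\<eta> + \<rho> - |z - x|\<^sup>2)\<^sub>+\<^sup>2\<close> are supported, within the closure of the domain,
  in the ball of radius \<open>sqrt \<eta>\<close> about the boundary point \<open>x\<close>, and there their values are small
  compared with their derivatives.\<close>

lemma normal_part_frontier:
  assumes u: "extends p u w" and K0: "card K0 = p" and x: "x \<in> frontier \<Omega>"
  shows "normal_part w K0 x = 0"
proof (rule ccontr)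
  assume nz: "normal_part w K0 x \<noteq> 0"
  define \<nu> where "\<nu> = normal_part w K0 x"
  have w: "smooth (w S)" for S using u by (simp add: extends_def)
  \<comment> \<open>The pairing of the conjugate gradient of the test function with u is the
    positive part of \<open>g\<close> times \<open>\<Psi>\<close>; the 2 comes from differentiating
    the square. At x it equals twice the conjugate of \<nu>.\<close>
  define \<Psi> where "\<Psi> z = 2 * (cnj (normal_part w K0 z) - (\<Sum>k\<in>UNIV. (z $ k - x $ k) * cnj (con w k K0 z)))" for z
  have ncont: "continuous_on A (normal_part w K0)" "continuous_on A (divergence w K0)" "continuous_on A (con w k K0)" for A k
    by (intro smooth_continuous_on smooth_normal_part smooth_divergence smooth_con w)+
  have \<Psi>c: "continuous_on A \<Psi>" for A
    unfolding \<Psi>_def by (intro continuous_intros ncont)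
  have \<Psi>x: "Re (\<nu> * \<Psi> x) = 2 * (cmod \<nu>)\<^sup>2"
  proof -
    have "\<nu> * \<Psi> x = of_real (2 * (cmod \<nu>)\<^sup>2)"
      by (simp add: \<Psi>_def \<nu>_def[symmetric] complex_norm_square del: of_real_power)
    then show ?thesis by (simp only: Re_complex_of_real)
  qed
  have \<nu>pos: "(cmod \<nu>)\<^sup>2 > 0" using nz by (simp add: \<nu>_def)
  have "continuous_on UNIV (\<lambda>z. Re (\<nu> * \<Psi> z))" by (intro continuous_intros \<Psi>c)
  then have "isCont (\<lambda>z. Re (\<nu> * \<Psi> z)) x" by (simp add: continuous_on_eq_continuous_at)
  then obtain d where d: "d > 0" "\<And>z. dist z x < d \<Longrightarrow> \<bar>Re (\<nu> * \<Psi> z) - Re (\<nu> * \<Psi> x)\<bar> < (cmod \<nu>)\<^sup>2"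
    using \<nu>pos unfolding continuous_at_eps_delta dist_real_def by blast
  obtain D where D: "D > 0" "\<And>z. z \<in> closure \<Omega> \<Longrightarrow> cmod (\<nu> * cnj (divergence w K0 z)) \<le> D"
  proof -
    have "continuous_on (closure \<Omega>) (\<lambda>z. \<nu> * cnj (divergence w K0 z))" by (intro continuous_intros ncont)
    from compact_imp_bounded[OF compact_continuous_image[OF this compact_closure]] show ?thesis
      using that by (auto simp: bounded_pos)
  qed
  \<comment> \<open>The first bound confines the support to the ball on which \<open>\<Psi>\<close>
    is controlled; the second makes the divergence term at most half of the main term.\<close>
  define \<eta> where "\<eta> = min (d\<^sup>2) ((cmod \<nu>)\<^sup>2 / (2 * D))"
  have \<eta>: "0 < \<eta>" "\<eta> \<le> d\<^sup>2" "\<eta> * D \<le> (cmod \<nu>)\<^sup>2 / 2"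
  proof -
    show "0 < \<eta>" "\<eta> \<le> d\<^sup>2" using d(1) D(1) \<nu>pos by (auto simp: \<eta>_def)
    have "\<eta> * D \<le> (cmod \<nu>)\<^sup>2 / (2 * D) * D" using D(1) by (intro mult_right_mono) (auto simp: \<eta>_def)
    then show "\<eta> * D \<le> (cmod \<nu>)\<^sup>2 / 2" using D(1) by simp
  qed
  define g where "g z = \<eta> + \<rho> z + (-1) * (norm (z - x))\<^sup>2" for z
  have sg: "smooth g" unfolding g_def
    by (intro smooth_add smooth_const smooth_rho smooth_mult smooth_norm_sq)
  have gc: "continuous_on A g" for A by (rule smooth_continuous_on[OF sg])
  define \<psi> where "\<psi> z = complex_of_real ((max 0 (g z))\<^sup>2)" for z
  have \<psi>C: "C1_on UNIV \<psi>" unfolding \<psi>_def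
    by (intro C1_on_of_real C1_on_real_comp[OF C1_on_smooth[OF sg] UNIV_I has_real_derivative_pos_part_sq] continuous_intros)
  have d\<psi>: "d_zbar k \<psi> z = of_real (2 * max 0 (g z)) * (d_zbar k R z - (z $ k - x $ k))" for k z
  proof -
    define n where "n = (\<lambda>z. complex_of_real ((norm (z - x))\<^sup>2))"
    have dn: "n differentiable (at z)"
      unfolding n_def by (intro smooth_differentiable smooth_of_real smooth_norm_sq)
    have dR: "R differentiable (at z)" by (rule smooth_differentiable[OF smooth_R])
    have "(\<lambda>z. complex_of_real (g z)) = (\<lambda>z. (complex_of_real \<eta> + R z) + (-1) * n z)" by (auto simp: g_def n_def)
    then have "d_zbar k (\<lambda>z. complex_of_real (g z)) z = d_zbar k (\<lambda>z. (complex_of_real \<eta> + R z) + (-1) * n z) z" by (simp only:)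
    also have "\<dots> = d_zbar k (\<lambda>z. complex_of_real \<eta> + R z) z + d_zbar k (\<lambda>z. (-1) * n z) z"
      using dn dR by (intro d_z_add(2) differentiable_mult differentiable_const differentiable_add)
    also have "d_zbar k (\<lambda>z. complex_of_real \<eta> + R z) z = d_zbar k (\<lambda>z. complex_of_real \<eta>) z + d_zbar k R z"
      using dR by (intro d_z_add(2) differentiable_const)
    also have "d_zbar k (\<lambda>z. (-1) * n z) z = (-1) * d_zbar k n z + d_zbar k (\<lambda>z. -1) z * n z"
      using dn by (intro d_z_mult(2) differentiable_const)
    finally have "d_zbar k (\<lambda>z. complex_of_real (g z)) z = d_zbar k R z - (z $ k - x $ k)"
      unfolding n_def d_z_norm_sq(2) d_z_const by simp
    then show ?thesis
      unfolding \<psi>_def[abs_def]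
      using d_z_real_comp(2)[OF smooth_differentiable[OF sg] has_real_derivative_pos_part_sq, of k z] by simp
  qed
  define f where "f K = (if K = K0 then \<psi> else (\<lambda>z. 0))" for K
  have fC: "C1_on UNIV (f J)" for J unfolding f_def using \<psi>C by (auto simp: C1_on_const)
  have only: "(\<Sum>K | card K = p. f K z * g' K) = \<psi> z * g' K0" for z and g' :: "'n set \<Rightarrow> complex"
    by (subst sum.remove[of _ K0]) (auto simp: K0 f_def)
  have only': "(\<Sum>K | card K = p. \<Sum>k\<in>UNIV. d_zbar k (f K) z * g' k K) = (\<Sum>k\<in>UNIV. d_zbar k \<psi> z * g' k K0)"
    for z and g' :: "'n \<Rightarrow> 'n set \<Rightarrow> complex"
    by (subst sum.remove[of _ K0]) (auto simp: K0 f_def d_z_const)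
  let ?v = "dbar_star \<Omega> (Suc p) u (sorted_list_of_set K0)"
  have "(LINT z:\<Omega>|lborel. \<Sum>k\<in>UNIV. d_zbar k \<psi> z * cnj (con w k K0 z)) = (LINT z:\<Omega>|lborel. \<psi> z * cnj (?v z))"
    using adjoint_C1[OF u subset_UNIV, of f, OF fC] unfolding only only' by simp
  also have "\<dots> = (LINT z:\<Omega>|lborel. - (\<psi> z * cnj (divergence w K0 z)))"
  proof (unfold set_lebesgue_integral_def, rule integral_cong_AE)
    have v: "sq_integrable_on \<Omega> ?v"
      using dbar_star_works[OF u] K0 by (simp add: is_dbar_star_sets)
    have \<psi>c: "continuous_on A \<psi>" for A using C1_onD(3)[OF \<psi>C] continuous_on_subset by blast
    show "(\<lambda>z. indicat_real \<Omega> z *\<^sub>R (\<psi> z * cnj (?v z))) \<in> borel_measurable lborel"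
      using sq_integrable_mult[OF sq_int_cont[OF \<psi>c] sq_integrable_cnj[OF v]]
      unfolding set_integrable_def by (rule borel_measurable_integrable)
    have "set_integrable lborel \<Omega> (\<lambda>z. - (\<psi> z * cnj (divergence w K0 z)))"
      by (intro int_cont continuous_intros \<psi>c ncont)
    then show "(\<lambda>z. indicat_real \<Omega> z *\<^sub>R - (\<psi> z * cnj (divergence w K0 z))) \<in> borel_measurable lborel"
      unfolding set_integrable_def by (rule borel_measurable_integrable)
    show "AE z in lborel. indicat_real \<Omega> z *\<^sub>R (\<psi> z * cnj (?v z)) = indicat_real \<Omega> z *\<^sub>R - (\<psi> z * cnj (divergence w K0 z))"
      using dbar_star_eq_divergence[OF u K0] by eventually_elim (auto simp: indicator_def)
  qed
  finally have eq: "(LINT z:\<Omega>|lborel. \<Sum>k\<in>UNIV. d_zbar k \<psi> z * cnj (con w k K0 z)) = (LINT z:\<Omega>|lborel. - (\<psi> z * cnj (divergence w K0 z)))" .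
  define Z where "Z z = (\<Sum>k\<in>UNIV. d_zbar k \<psi> z * cnj (con w k K0 z)) - - (\<psi> z * cnj (divergence w K0 z))" for z
  have \<psi>c: "continuous_on A \<psi>" "continuous_on A (d_zbar k \<psi>)" for A k
    using C1_onD(3)[OF \<psi>C] C1_on_continuous_d_z(2)[OF \<psi>C] continuous_on_subset by blast+
  have Zc: "continuous_on (closure \<Omega>) Z" unfolding Z_def by (intro continuous_intros \<psi>c ncont)
  have "(LINT z:\<Omega>|lborel. Z z) = 0"
    unfolding Z_def by (subst set_integral_diff(2)) (auto simp: eq intro!: int_cont continuous_intros \<psi>c ncont)
  then have "(LINT z:\<Omega>|lborel. \<nu> * Z z) = 0" by simp
  moreover have "continuous_on (closure \<Omega>) (\<lambda>z. \<nu> * Z z)" by (intro continuous_intros Zc)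
  then have "(LINT z:\<Omega>|lborel. Re (\<nu> * Z z)) = Re (LINT z:\<Omega>|lborel. \<nu> * Z z)"
    using integral_Re[OF int_cont[unfolded set_integrable_def]]
    unfolding set_lebesgue_integral_def by (simp only: scaleR_complex.sel(1) real_scaleR_def)
  ultimately have int0: "(LINT z:\<Omega>|lborel. Re (\<nu> * Z z)) = 0"
    by (simp only: zero_complex.sel)
  have Zeq: "Z z = of_real (max 0 (g z)) * (\<Psi> z + of_real (max 0 (g z)) * cnj (divergence w K0 z))" for z
  proof -
    have "(\<Sum>k\<in>UNIV. d_zbar k \<psi> z * cnj (con w k K0 z)) = of_real (max 0 (g z)) * \<Psi> z"
      unfolding d\<psi> \<Psi>_def normal_part_def
      by (simp add: cnj_d_z_R sum_distrib_left sum_subtractf sum.distrib algebra_simps)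
    then show ?thesis by (simp add: Z_def \<psi>_def power2_eq_square algebra_simps)
  qed
  \<comment> \<open>The main term is at least |\<nu>|^2 by continuity and the divergence term at
    most half of that, so the integrand, whose integral is 0, dominates a nonnegative
    function.\<close>
  have low: "max 0 (g z) * ((cmod \<nu>)\<^sup>2 / 2) \<le> Re (\<nu> * Z z)" if z: "z \<in> \<Omega>" for z
  proof (cases "g z > 0")
    case True
    have zc: "z \<in> closure \<Omega>" by (rule domain_subset_closure[OF z])
    have "(norm (z - x))\<^sup>2 < \<eta>" using True rho_neg[OF z] by (simp add: g_def)
    then have "(norm (z - x))\<^sup>2 < d\<^sup>2" using \<eta>(2) by linarith
    then have "dist z x < d" using d(1) by (simp add: dist_norm power_less_imp_less_base)
    then have 1: "Re (\<nu> * \<Psi> z) \<ge> (cmod \<nu>)\<^sup>2" using d(2)[of z] \<Psi>x by linarith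
    have g\<eta>: "g z \<le> \<eta>" using rho_neg[OF z] by (simp add: g_def) (meson less_eq_real_def order_trans zero_le_power2)
    have "\<bar>Re (of_real (g z) * (\<nu> * cnj (divergence w K0 z)))\<bar> \<le> g z * cmod (\<nu> * cnj (divergence w K0 z))"
      using abs_Re_le_cmod[of "of_real (g z) * (\<nu> * cnj (divergence w K0 z))"] True by (simp add: norm_mult)
    also have "\<dots> \<le> \<eta> * D" using g\<eta> True D(2)[OF zc] by (intro mult_mono) auto
    finally have 2: "Re (of_real (g z) * (\<nu> * cnj (divergence w K0 z))) \<ge> - ((cmod \<nu>)\<^sup>2 / 2)" using \<eta>(3) by linarith
    have "\<nu> * Z z = of_real (g z) * (\<nu> * \<Psi> z + of_real (g z) * (\<nu> * cnj (divergence w K0 z)))"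
      using True by (simp add: Zeq algebra_simps)
    then have "Re (\<nu> * Z z) = g z * (Re (\<nu> * \<Psi> z) + Re (of_real (g z) * (\<nu> * cnj (divergence w K0 z))))"
      by (simp only: Re_complex_of_real Im_complex_of_real times_complex.sel(1)[of "of_real _"] plus_complex.sel mult_zero_left diff_zero)
    also have "\<dots> \<ge> g z * ((cmod \<nu>)\<^sup>2 / 2)" using 1 2 True by (intro mult_left_mono) auto
    finally show ?thesis using True by simp
  qed (simp add: Zeq max_def)
  have mc: "continuous_on (closure \<Omega>) (\<lambda>z. max 0 (g z) * ((cmod \<nu>)\<^sup>2 / 2))" by (intro continuous_intros gc)
  have "(LINT z:\<Omega>|lborel. max 0 (g z) * ((cmod \<nu>)\<^sup>2 / 2)) \<le> (LINT z:\<Omega>|lborel. Re (\<nu> * Z z))"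
    by (intro set_integral_mono int_cont mc continuous_intros Zc low)
  then have nonpos: "(LINT z:\<Omega>|lborel. max 0 (g z) * ((cmod \<nu>)\<^sup>2 / 2)) \<le> 0" using int0 by (simp only:)
  have zero: "max 0 (g z) * ((cmod \<nu>)\<^sup>2 / 2) = 0" if "z \<in> \<Omega>" for z
    by (rule zero_if_set_integral_nonpos[OF open_domain bounded_domain mc _ nonpos that]) (use \<nu>pos in simp)
  \<comment> \<open>g(x) = \<eta> since \<rho> vanishes at x; by continuity g is positive at some
    point of the domain itself, against the vanishing just obtained.\<close>
  have "g x > 0" using rho_frontier[OF x] \<eta>(1) by (simp add: g_def)
  moreover have "open {z. g z > 0}"
    by (intro open_Collect_less continuous_intros gc)
  moreover have "x \<in> closure \<Omega>" using x by (simp add: frontier_def)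
  ultimately obtain z where "z \<in> \<Omega>" "g z > 0"
    using closure_iff_nhds_not_empty[of x \<Omega>] by (metis (mono_tags, lifting) disjoint_iff mem_Collect_eq order_refl)
  with zero[of z] \<nu>pos show False by simp
qed

section \<open>Hardy's inequality\<close>

definition grad_R_sq :: "(complex, 'n) vec \<Rightarrow> real" where
  "grad_R_sq z = (\<Sum>k\<in>UNIV. (cmod (d_z k R z))\<^sup>2)"

text \<open>The real and imaginary parts of the derivatives of a real function in z_k are, up to
  factors, all its real partial derivatives.\<close>

lemma grad_R_pos:
  assumes "\<rho> z = 0" shows "grad_R_sq z > 0"
proof (rule ccontr)
  assume "\<not> grad_R_sq z > 0"
  moreover have "0 \<le> grad_R_sq z" unfolding grad_R_sq_def by (intro sum_nonneg) auto
  ultimately have "grad_R_sq z = 0" by simp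
  then have "d_z k R z = 0" for k
    unfolding grad_R_sq_def by (subst (asm) sum_nonneg_eq_0_iff) auto
  moreover have "d_z k R z = (complex_of_real (frechet_derivative \<rho> (at z) (axis k 1)) - \<i> * complex_of_real (frechet_derivative \<rho> (at z) (axis k \<i>))) / 2" for k
    unfolding d_z_def using dir_deriv_bounded_linear[OF bounded_linear_of_real smooth_differentiable[OF smooth_rho]] by metis
  ultimately have z: "frechet_derivative \<rho> (at z) (axis k 1) = 0" "frechet_derivative \<rho> (at z) (axis k \<i>) = 0" for k
    by (auto simp: complex_eq_iff)
  have "frechet_derivative \<rho> (at z) = (\<lambda>h. 0)"
  proof (rule linear_eq_stdbasis)
    show "linear (frechet_derivative \<rho> (at z))"
      by (rule linear_frechet_derivative[OF smooth_differentiable[OF smooth_rho]])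
    show "frechet_derivative \<rho> (at z) b = 0" if "b \<in> Basis" for b
      using that z by (auto simp: Basis_vec_def Basis_complex_def)
  qed (rule linear_zero)
  then show False using grad_nz[OF assms] by simp
qed

text \<open>Two integrations by parts with the commuting derivatives in between; v = 0 on the
  frontier removes both boundary terms. Thus the conjugate derivatives alone control the full
  gradient.\<close>

lemma integral_d_z_sq:
  assumes v: "smooth v" "\<And>x. x \<in> frontier \<Omega> \<Longrightarrow> v x = 0"
  shows "(LINT z:\<Omega>|lborel. (cmod (d_z k v z))\<^sup>2) = (LINT z:\<Omega>|lborel. (cmod (d_zbar k v z))\<^sup>2)"
proof -
  note sv = v(1) smooth_d_z[OF v(1)] smooth_cnj[OF v(1)]
  have dv: "v differentiable (at z)" for z by (rule smooth_differentiable[OF v(1)])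
  have "complex_of_real (LINT z:\<Omega>|lborel. (cmod (d_z k v z))\<^sup>2) = (LINT z:\<Omega>|lborel. d_z k v z * d_zbar k (\<lambda>z. cnj (v z)) z)"
    unfolding set_integral_complex_of_real[symmetric] by (simp add: d_z_cnj(2)[OF dv] complex_norm_square del: of_real_power)
  also have "\<dots> = - (LINT z:\<Omega>|lborel. d_zbar k (d_z k v) z * cnj (v z))"
    by (rule integration_by_parts(2)[of UNIV]) (auto intro: C1_on_smooth sv simp: v(2))
  also have "\<dots> = - (LINT z:\<Omega>|lborel. d_z k (d_zbar k v) z * cnj (v z))"
    by (simp add: d_z_d_zbar_commute[OF v(1)])
  also have "\<dots> = (LINT z:\<Omega>|lborel. d_zbar k v z * d_z k (\<lambda>z. cnj (v z)) z)"
    by (subst integration_by_parts(1)[of UNIV]) (auto intro: C1_on_smooth sv simp: v(2))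
  also have "\<dots> = complex_of_real (LINT z:\<Omega>|lborel. (cmod (d_zbar k v z))\<^sup>2)"
    unfolding set_integral_complex_of_real[symmetric] by (simp add: d_z_cnj(1)[OF dv] complex_norm_square del: of_real_power)
  finally show ?thesis by simp
qed

lemma continuous_bound:
  fixes f :: "(complex, 'n) vec \<Rightarrow> 'b::real_normed_vector"
  assumes "continuous_on (closure \<Omega>) f"
  obtains B where "B \<ge> 0" "\<And>z. z \<in> closure \<Omega> \<Longrightarrow> norm (f z) \<le> B"
proof -
  obtain B where "B > 0" "\<forall>y\<in>f ` closure \<Omega>. norm y \<le> B"
    using compact_imp_bounded[OF compact_continuous_image[OF assms compact_closure]] unfolding bounded_pos by blast
  then show ?thesis by (intro that[of B]) auto
qed

text \<open>Integrate the divergence of |v|^2 \<partial>\<rho> / (\<epsilon> - \<rho>), which is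
  zero since v vanishes on the boundary. Differentiating the denominator gives |\<partial>\<rho>|^2
  |v|^2 / (\<epsilon> - \<rho>)^2, the desired quantity near the boundary; all other terms carry
  only one negative power of \<epsilon> - \<rho> and are absorbed.\<close>

lemma hardy:
  obtains C where "C > 0" "\<forall>v. smooth v \<and> (\<forall>x\<in>frontier \<Omega>. v x = 0) \<longrightarrow>
    set_integrable lborel \<Omega> (\<lambda>z. (- \<rho> z) powr (- 2) * (cmod (v z))\<^sup>2) \<and>
    (LINT z:\<Omega>|lborel. (- \<rho> z) powr (- 2) * (cmod (v z))\<^sup>2)
      \<le> C * (LINT z:\<Omega>|lborel. (cmod (v z))\<^sup>2 + 2 * (\<Sum>k\<in>UNIV. (cmod (d_zbar k v z))\<^sup>2))"
proof -
  have gc: "continuous_on A grad_R_sq" for A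
    unfolding grad_R_sq_def[abs_def] by (intro continuous_intros smooth_continuous_on smooth_d_z smooth_R)
  have lapc: "continuous_on A (\<lambda>z. \<Sum>k\<in>UNIV. d_zbar k (d_z k R) z)" for A
    by (intro continuous_intros smooth_continuous_on smooth_d_z smooth_R)
  have Rkc: "continuous_on A (d_z k R)" "continuous_on A (d_zbar k R)" "continuous_on A (d_zbar k (d_z k R))" for A k
    by (intro smooth_continuous_on smooth_d_z smooth_R)+
  \<comment> \<open>The gradient may vanish inside the domain. Adding -\<rho>, which is positive
    there, gives a uniform positive lower bound.\<close>
  obtain m where m: "m > 0" "\<And>z. z \<in> closure \<Omega> \<Longrightarrow> m \<le> grad_R_sq z - \<rho> z"
  proof (cases "closure \<Omega> = {}")
    case False
    have "continuous_on (closure \<Omega>) (\<lambda>z. grad_R_sq z - \<rho> z)" by (intro continuous_intros gc rho_continuous)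
    then obtain x where x: "x \<in> closure \<Omega>" "\<And>y. y \<in> closure \<Omega> \<Longrightarrow> grad_R_sq x - \<rho> x \<le> grad_R_sq y - \<rho> y"
      using continuous_attains_inf[of "closure \<Omega>" "\<lambda>z. grad_R_sq z - \<rho> z"] compact_closure False by blast
    have "0 \<le> grad_R_sq x" unfolding grad_R_sq_def by (intro sum_nonneg) auto
    then have "grad_R_sq x - \<rho> x > 0" using rho_closure[OF x(1)] grad_R_pos[of x] by (cases "\<rho> x = 0") auto
    then show ?thesis using that x(2) by blast
  qed (use that[of 1] in simp)
  obtain B1 where B1: "B1 \<ge> 0" "\<And>z. z \<in> closure \<Omega> \<Longrightarrow> cmod (\<Sum>k\<in>UNIV. d_zbar k (d_z k R) z) \<le> B1"
    by (rule continuous_bound[OF lapc]) (rule that)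
  have "\<exists>B. \<forall>z\<in>closure \<Omega>. cmod (d_z k R z) \<le> B" for k
    by (rule continuous_bound[OF Rkc(1)]) blast
  then obtain Bk where Bk: "\<And>k z. z \<in> closure \<Omega> \<Longrightarrow> cmod (d_z k R z) \<le> Bk k" by metis
  define B where "B = B1 + (\<Sum>k\<in>UNIV. \<bar>Bk k\<bar>)"
  have B: "B \<ge> 0" "\<And>z. z \<in> closure \<Omega> \<Longrightarrow> cmod (\<Sum>k\<in>UNIV. d_zbar k (d_z k R) z) \<le> B"
    "\<And>z k. z \<in> closure \<Omega> \<Longrightarrow> cmod (d_z k R z) \<le> B"
  proof -
    have s: "0 \<le> (\<Sum>k\<in>UNIV. \<bar>Bk k\<bar>)" by (intro sum_nonneg) auto
    show "B \<ge> 0" using B1 s by (simp add: B_def)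
    show "cmod (\<Sum>k\<in>UNIV. d_zbar k (d_z k R) z) \<le> B" if "z \<in> closure \<Omega>" for z
      using B1(2)[OF that] s unfolding B_def by linarith
    show "cmod (d_z k R z) \<le> B" if "z \<in> closure \<Omega>" for z k
      using Bk[OF that, of k] member_le_sum[of k UNIV "\<lambda>k. \<bar>Bk k\<bar>"] B1(1) by (simp add: B_def)
  qed
  \<comment> \<open>(B + 1)^2 / (2 m) is the price of absorption; 4 n comes from squaring the sum of
    |v| and of its 2 n derivatives.\<close>
  define C5 where "C5 = (B + 1)\<^sup>2 / (2 * m) * (4 * real CARD('n))"
  have C5: "C5 > 0" using m B by (simp add: C5_def add_nonneg_pos)
  define e where "e n = inverse (real (Suc n))" for n
  have e: "0 < e n" for n by (auto simp: e_def)
  have e_lim: "e \<longlonglongrightarrow> 0" using LIMSEQ_inverse_real_of_nat by (simp add: e_def[abs_def])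
  have main: "set_integrable lborel \<Omega> (\<lambda>z. (- \<rho> z) powr (- 2) * (cmod (v z))\<^sup>2) \<and>
    (LINT z:\<Omega>|lborel. (- \<rho> z) powr (- 2) * (cmod (v z))\<^sup>2)
      \<le> (2 * C5 / m) * (LINT z:\<Omega>|lborel. (cmod (v z))\<^sup>2 + 2 * (\<Sum>k\<in>UNIV. (cmod (d_zbar k v z))\<^sup>2))"
    if v: "smooth v" "\<And>x. x \<in> frontier \<Omega> \<Longrightarrow> v x = 0" for v
  proof -
    have vc: "continuous_on A v" "continuous_on A (d_z k v)" "continuous_on A (d_zbar k v)" for A k
      by (intro smooth_continuous_on smooth_d_z v(1))+
    have dv: "v differentiable (at z)" for z by (rule smooth_differentiable[OF v(1)])
    let ?X = "\<lambda>z. (cmod (v z))\<^sup>2 + (\<Sum>k\<in>UNIV. (cmod (d_z k v z))\<^sup>2 + (cmod (d_zbar k v z))\<^sup>2)"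
    let ?RHS = "LINT z:\<Omega>|lborel. (cmod (v z))\<^sup>2 + 2 * (\<Sum>k\<in>UNIV. (cmod (d_zbar k v z))\<^sup>2)"
    have XR: "(LINT z:\<Omega>|lborel. ?X z) = ?RHS"
    proof -
      have "(LINT z:\<Omega>|lborel. ?X z) = (LINT z:\<Omega>|lborel. (cmod (v z))\<^sup>2) + (\<Sum>k\<in>UNIV. (LINT z:\<Omega>|lborel. (cmod (d_z k v z))\<^sup>2) + (LINT z:\<Omega>|lborel. (cmod (d_zbar k v z))\<^sup>2))"
        by (subst set_integral_add(2), (intro int_cont continuous_intros vc)[1], (intro int_cont continuous_intros vc)[1],
            subst set_lebesgue_integral_sum, (intro int_cont continuous_intros vc)[1],
            subst set_integral_add(2), (intro int_cont continuous_intros vc)[1], (intro int_cont continuous_intros vc)[1]) (rule refl)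
      also have "\<dots> = (LINT z:\<Omega>|lborel. (cmod (v z))\<^sup>2) + (\<Sum>k\<in>UNIV. 2 * (LINT z:\<Omega>|lborel. (cmod (d_zbar k v z))\<^sup>2))"
        by (simp add: integral_d_z_sq[OF v])
      also have "\<dots> = (LINT z:\<Omega>|lborel. (cmod (v z))\<^sup>2) + 2 * (LINT z:\<Omega>|lborel. \<Sum>k\<in>UNIV. (cmod (d_zbar k v z))\<^sup>2)"
        by (subst set_lebesgue_integral_sum, (intro int_cont continuous_intros vc)[1]) (simp add: sum_distrib_left)
      also have "\<dots> = ?RHS"
        by (subst set_integral_add(2)) (auto intro!: int_cont continuous_intros vc)
      finally show ?thesis .
    qed
    have est: "(LINT z:\<Omega>|lborel. (1 / (e n - \<rho> z))\<^sup>2 * (cmod (v z))\<^sup>2) \<le> (2 * C5 / m) * ?RHS" for n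
    proof -
      let ?h = "\<lambda>z. complex_of_real (1 / (e n - \<rho> z))"
      define U where "U = \<rho> -` {..<e n}"
      have U: "open U" "closure \<Omega> \<subseteq> U"
        using rho_continuous[of UNIV] rho_closure e[of n] by (auto simp: U_def intro: open_vimage le_less_trans)
      have hd: "((\<lambda>x. 1 / (e n - x)) has_real_derivative (1 / (e n - x))\<^sup>2) (at x)" if "x \<in> {..<e n}" for x
        using that by (auto intro!: derivative_eq_intros simp: power2_eq_square)
      have h2c: "continuous_on {..<e n} (\<lambda>x. (1 / (e n - x))\<^sup>2)" by (intro continuous_intros) auto
      have Ch: "C1_on U ?h"
        by (rule C1_on_of_real, rule C1_on_real_comp[OF C1_on_smooth[OF smooth_rho] _ hd h2c]) (auto simp: U_def)
      have hc: "continuous_on (closure \<Omega>) (\<lambda>z. 1 / (e n - \<rho> z))"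
        using rho_closure e[of n] by (intro continuous_intros rho_continuous) (force dest: rho_closure)
      have hcc: "continuous_on (closure \<Omega>) ?h" by (intro continuous_on_of_real hc)
      have dh: "d_zbar k ?h z = of_real ((1 / (e n - \<rho> z))\<^sup>2) * d_zbar k R z" if "z \<in> closure \<Omega>" for k z
        using d_z_real_comp(2)[OF smooth_differentiable[OF smooth_rho] hd, of z k] that U(2) by (auto simp: U_def)
      have hdiff: "?h differentiable (at z)" if "z \<in> closure \<Omega>" for z using C1_onD(1)[OF Ch] U(2) that by blast
      have df: "d_zbar k (\<lambda>z. d_z k R z * ?h z) z = d_z k R z * (of_real ((1 / (e n - \<rho> z))\<^sup>2) * d_zbar k R z) + d_zbar k (d_z k R) z * ?h z"
        if "z \<in> closure \<Omega>" for k z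
        using d_z_mult(2)[OF smooth_differentiable[OF smooth_d_z(1)[OF smooth_R]] hdiff[OF that], of k k] dh[OF that, of k] by simp
      have dg: "d_zbar k (\<lambda>z. v z * cnj (v z)) z = v z * cnj (d_z k v z) + d_zbar k v z * cnj (v z)" for k z
        using d_z_mult(2)[OF dv differentiable_cnj[OF dv], of k z] d_z_cnj(2)[OF dv, of k z] by simp
      \<comment> \<open>The product rule splits the divergence: \<open>?J1\<close> differentiates
        |v|^2, \<open>?J2\<close> differentiates the vector field and contains the good
        term.\<close>
      let ?J1 = "\<lambda>k z. (d_z k R z * ?h z) * (v z * cnj (d_z k v z) + d_zbar k v z * cnj (v z))"
      let ?J2 = "\<lambda>k z. (d_z k R z * (of_real ((1 / (e n - \<rho> z))\<^sup>2) * d_zbar k R z) + d_zbar k (d_z k R) z * ?h z) * (v z * cnj (v z))"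
      have Jc: "continuous_on (closure \<Omega>) (?J1 k)" "continuous_on (closure \<Omega>) (?J2 k)" for k
        by (intro continuous_intros continuous_on_of_real hc Rkc vc)+
      have J0: "(LINT z:\<Omega>|lborel. ?J1 k z + ?J2 k z) = 0" for k
      proof -
        have "(LINT z:\<Omega>|lborel. (d_z k R z * ?h z) * d_zbar k (\<lambda>z. v z * cnj (v z)) z)
          = - (LINT z:\<Omega>|lborel. d_zbar k (\<lambda>z. d_z k R z * ?h z) z * (v z * cnj (v z)))"
          by (rule integration_by_parts(2)[OF U(2) C1_on_mult[OF C1_on_smooth Ch] C1_on_smooth])
            (intro smooth_d_z smooth_R smooth_mult smooth_cnj v(1) | simp add: v(2))+
        also have "(LINT z:\<Omega>|lborel. d_zbar k (\<lambda>z. d_z k R z * ?h z) z * (v z * cnj (v z))) = (LINT z:\<Omega>|lborel. ?J2 k z)"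
          by (rule set_lebesgue_integral_cong') (simp only: df domain_subset_closure)
        finally have "(LINT z:\<Omega>|lborel. ?J1 k z) = - (LINT z:\<Omega>|lborel. ?J2 k z)" unfolding dg .
        moreover have "(LINT z:\<Omega>|lborel. ?J1 k z + ?J2 k z) = (LINT z:\<Omega>|lborel. ?J1 k z) + (LINT z:\<Omega>|lborel. ?J2 k z)"
          by (intro set_integral_add(2) int_cont Jc)
        ultimately show ?thesis by simp
      qed
      define J where "J z = (\<Sum>k\<in>UNIV. ?J1 k z + ?J2 k z)" for z
      have JC: "continuous_on (closure \<Omega>) J" unfolding J_def by (intro continuous_on_sum continuous_on_add Jc)
      have "(LINT z:\<Omega>|lborel. J z) = 0"
        unfolding J_def by (subst set_lebesgue_integral_sum) (auto simp only: J0 sum.neutral_const intro!: int_cont continuous_on_add Jc)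
      then have int0: "(LINT z:\<Omega>|lborel. Re (J z)) = 0"
        using integral_Re[OF int_cont[OF JC, unfolded set_integrable_def]] by (simp add: set_lebesgue_integral_def)
      have low: "m / 2 * ((1 / (e n - \<rho> z))\<^sup>2 * (cmod (v z))\<^sup>2) - C5 * ?X z \<le> Re (J z)" if z: "z \<in> \<Omega>" for z
      proof -
        have zc: "z \<in> closure \<Omega>" by (rule domain_subset_closure[OF z])
        define H where "H = 1 / (e n - \<rho> z)"
        have H: "H > 0" "H * - \<rho> z \<le> 1" using rho_neg[OF z] e[of n] by (auto simp: H_def field_simps)
        define a where "a = cmod (v z)"
        define S where "S = (\<Sum>k\<in>UNIV. cmod (d_z k v z) + cmod (d_zbar k v z))"
        have S: "S \<ge> 0" unfolding S_def by (intro sum_nonneg) auto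
        have a: "a \<ge> 0" by (simp add: a_def)
        have J2: "(\<Sum>k\<in>UNIV. ?J2 k z) = of_real (H\<^sup>2 * a\<^sup>2 * grad_R_sq z) + of_real (H * a\<^sup>2) * (\<Sum>k\<in>UNIV. d_zbar k (d_z k R) z)"
        proof -
          have "d_z k R z * d_zbar k R z = of_real ((cmod (d_z k R z))\<^sup>2)" for k
            by (simp add: complex_norm_square cnj_d_z_R del: of_real_power)
          then have "?J2 k z = of_real (H\<^sup>2 * a\<^sup>2) * of_real ((cmod (d_z k R z))\<^sup>2) + of_real (H * a\<^sup>2) * d_zbar k (d_z k R) z" for k
            unfolding H_def[symmetric] complex_norm_square[of "v z", symmetric] a_def[symmetric]
            by (simp add: algebra_simps)
          then show ?thesis by (simp add: sum.distrib sum_distrib_left grad_R_sq_def)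
        qed
        have r1: "- (B * (H * a\<^sup>2)) \<le> Re (of_real (H * a\<^sup>2) * (\<Sum>k\<in>UNIV. d_zbar k (d_z k R) z))"
        proof -
          have "\<bar>Re (of_real (H * a\<^sup>2) * (\<Sum>k\<in>UNIV. d_zbar k (d_z k R) z))\<bar> \<le> H * a\<^sup>2 * cmod (\<Sum>k\<in>UNIV. d_zbar k (d_z k R) z)"
            using H by (intro abs_Re_of_real_mult_le) simp
          also have "\<dots> \<le> H * a\<^sup>2 * B" using B(2)[OF zc] H by (intro mult_left_mono) auto
          finally show ?thesis by (simp add: mult_ac)
        qed
        have r2: "- (B * H * a * S) \<le> Re (\<Sum>k\<in>UNIV. ?J1 k z)"
        proof -
          have "cmod (?J1 k z) \<le> B * H * a * (cmod (d_z k v z) + cmod (d_zbar k v z))" for k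
          proof -
            have "cmod (?J1 k z) = cmod (d_z k R z) * H * cmod (v z * cnj (d_z k v z) + d_zbar k v z * cnj (v z))"
              unfolding H_def[symmetric] using H by (simp add: norm_mult)
            also have "\<dots> \<le> B * H * (a * (cmod (d_z k v z) + cmod (d_zbar k v z)))"
            proof (intro mult_mono)
              show "cmod (v z * cnj (d_z k v z) + d_zbar k v z * cnj (v z)) \<le> a * (cmod (d_z k v z) + cmod (d_zbar k v z))"
                by (rule order_trans[OF norm_triangle_ineq]) (simp add: norm_mult a_def algebra_simps)
            qed (use B H zc in auto)
            finally show ?thesis by (simp add: mult.assoc)
          qed
          then have "(\<Sum>k\<in>UNIV. cmod (?J1 k z)) \<le> B * H * a * S"
            unfolding S_def sum_distrib_left by (intro sum_mono)
          then have "cmod (\<Sum>k\<in>UNIV. ?J1 k z) \<le> B * H * a * S" by (rule order_trans[OF norm_sum])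
          then show ?thesis using abs_Re_le_cmod[of "\<Sum>k\<in>UNIV. ?J1 k z"] by linarith
        qed
        have "Re (J z) = Re (\<Sum>k\<in>UNIV. ?J1 k z) + (H\<^sup>2 * a\<^sup>2 * grad_R_sq z + Re (of_real (H * a\<^sup>2) * (\<Sum>k\<in>UNIV. d_zbar k (d_z k R) z)))"
          unfolding J_def sum.distrib plus_complex.sel(1) J2 Re_complex_of_real by simp
        then have J: "H\<^sup>2 * a\<^sup>2 * grad_R_sq z - B * (H * a\<^sup>2) - B * H * a * S \<le> Re (J z)" using r1 r2 by linarith
        \<comment> \<open>Since (-\<rho>) / (\<epsilon> - \<rho>) \<le> 1, the summand -\<rho> in
          the lower bound costs only one factor H; it accounts for the 1 in B + 1.\<close>
        have g: "m * (H\<^sup>2 * a\<^sup>2) - H * a\<^sup>2 \<le> H\<^sup>2 * a\<^sup>2 * grad_R_sq z"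
        proof -
          have "H\<^sup>2 * a\<^sup>2 * (m - - \<rho> z) \<le> H\<^sup>2 * a\<^sup>2 * grad_R_sq z"
            using m(2)[OF zc] by (intro mult_left_mono) auto
          moreover have "H * a\<^sup>2 * (H * - \<rho> z) \<le> H * a\<^sup>2 * 1"
            using H by (intro mult_left_mono) auto
          ultimately show ?thesis by (simp add: algebra_simps power2_eq_square)
        qed
        \<comment> \<open>All terms with a single H are handled together: half of m (H a)^2 pays for
          them.\<close>
        have "2 * ((H * a) * ((B + 1) * (a + S))) \<le> (H * a)\<^sup>2 * m + ((B + 1) * (a + S))\<^sup>2 / m"
          by (rule two_mult_le_weighted[OF m(1)])
        then have y: "(B + 1) * (H * a\<^sup>2) + (B + 1) * H * a * S \<le> m / 2 * (H\<^sup>2 * a\<^sup>2) + (B + 1)\<^sup>2 / (2 * m) * (a + S)\<^sup>2"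
          using m(1) by (simp add: power_mult_distrib power2_eq_square field_simps)
        have "(a + S)\<^sup>2 \<le> 4 * real CARD('n) * ?X z"
        proof -
          have "S\<^sup>2 \<le> (\<Sum>k\<in>UNIV. (cmod (d_z k v z) + cmod (d_zbar k v z))\<^sup>2) * real CARD('n)"
            unfolding S_def by (rule sum_squared_le_sum_of_squares)
          also have "\<dots> \<le> (\<Sum>k\<in>UNIV. 2 * ((cmod (d_z k v z))\<^sup>2 + (cmod (d_zbar k v z))\<^sup>2)) * real CARD('n)"
            using two_mult_norm_le[of "d_z _ v z" "d_zbar _ v z"]
            by (intro mult_right_mono sum_mono) (auto simp: power2_sum mult.assoc add.commute)
          finally have S2: "S\<^sup>2 \<le> 2 * real CARD('n) * (\<Sum>k\<in>UNIV. (cmod (d_z k v z))\<^sup>2 + (cmod (d_zbar k v z))\<^sup>2)"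
            unfolding sum_distrib_left[symmetric] by (simp only: mult_ac)
          have "(a + S)\<^sup>2 \<le> 2 * a\<^sup>2 + 2 * S\<^sup>2" using zero_le_power2[of "a - S"] by (simp add: power2_sum power2_diff)
          moreover have "2 * a\<^sup>2 \<le> 4 * real CARD('n) * a\<^sup>2"
          proof -
            have "1 \<le> real CARD('n)" by (simp add: Suc_leI)
            then have "2 \<le> 4 * real CARD('n)" by linarith
            then show ?thesis by (intro mult_right_mono) auto
          qed
          ultimately show ?thesis using S2 by (simp add: a_def algebra_simps)
        qed
        then have "(B + 1)\<^sup>2 / (2 * m) * (a + S)\<^sup>2 \<le> (B + 1)\<^sup>2 / (2 * m) * (4 * real CARD('n) * ?X z)"
          using m(1) by (intro mult_left_mono) auto
        then have X: "(B + 1)\<^sup>2 / (2 * m) * (a + S)\<^sup>2 \<le> C5 * ?X z" by (simp only: C5_def mult.assoc)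
        have "0 \<le> H * a * S" using H a S by simp
        then have "m / 2 * (H\<^sup>2 * a\<^sup>2) - C5 * ?X z \<le> Re (J z)"
          using J g y X by (simp add: algebra_simps)
        then show ?thesis by (simp add: H_def a_def)
      qed
      have i1: "set_integrable lborel \<Omega> (\<lambda>z. m / 2 * ((1 / (e n - \<rho> z))\<^sup>2 * (cmod (v z))\<^sup>2))" "set_integrable lborel \<Omega> (\<lambda>z. C5 * ?X z)"
        by (intro int_cont continuous_intros hc vc)+
      have "(LINT z:\<Omega>|lborel. m / 2 * ((1 / (e n - \<rho> z))\<^sup>2 * (cmod (v z))\<^sup>2) - C5 * ?X z) \<le> 0"
        unfolding int0[symmetric] by (intro set_integral_mono set_integral_diff(1) i1 int_cont continuous_intros JC low)
      then have "m / 2 * (LINT z:\<Omega>|lborel. (1 / (e n - \<rho> z))\<^sup>2 * (cmod (v z))\<^sup>2) \<le> C5 * (LINT z:\<Omega>|lborel. ?X z)"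
        unfolding set_integral_diff(2)[OF i1] by simp
      then show ?thesis unfolding XR using m(1) by (simp add: field_simps)
    qed
    have hc: "continuous_on (closure \<Omega>) (\<lambda>z. 1 / (e n - \<rho> z))" for n
      using rho_closure e[of n] by (intro continuous_intros rho_continuous) (force dest: rho_closure)
    have i: "set_integrable lborel \<Omega> (\<lambda>z. (1 / (e n - \<rho> z))\<^sup>2 * (cmod (v z))\<^sup>2)" for n
      by (intro int_cont continuous_intros hc vc)
    have lim: "(\<lambda>n. (1 / (e n - \<rho> z))\<^sup>2 * (cmod (v z))\<^sup>2) \<longlonglongrightarrow> (- \<rho> z) powr (- 2) * (cmod (v z))\<^sup>2" if "z \<in> \<Omega>" for z
    proof -
      have "(\<lambda>n. (1 / (e n - \<rho> z))\<^sup>2 * (cmod (v z))\<^sup>2) \<longlonglongrightarrow> (1 / (0 - \<rho> z))\<^sup>2 * (cmod (v z))\<^sup>2"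
        using rho_neg[OF that] by (intro tendsto_intros e_lim) auto
      moreover have "(- \<rho> z) powr (- 2) = (1 / (0 - \<rho> z))\<^sup>2"
        using rho_neg[OF that] by (simp add: powr_minus powr_numeral divide_inverse power_inverse)
      ultimately show ?thesis by simp
    qed
    show ?thesis
      using fatou_set_integral[OF measurable_domain i _ lim est tendsto_const] by simp
  qed
  show ?thesis
  proof (rule that[of "2 * C5 / m"])
    show "0 < 2 * C5 / m" using C5 m by simp
  qed (use main in blast)
qed


section \<open>Assembly of the estimates for the normal part\<close>

text \<open>A conjugate derivative of the normal part falls either on the bounded coefficients
  \<partial>\<rho> or on u, and in the latter case it is a conjugate derivative of u. This matches
  the right side of Hardy's inequality with the left side of the basic estimate.\<close>

lemma normal_part_bound:
  obtains C where "C > 0" "\<forall>w z. (\<forall>S. smooth (w S)) \<and> z \<in> closure \<Omega> \<longrightarrow>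
    (\<Sum>K | card K = p. (cmod (normal_part w K z))\<^sup>2 + 2 * (\<Sum>k\<in>UNIV. (cmod (d_zbar k (normal_part w K) z))\<^sup>2))
      \<le> C * (grad_sq p w z + norm_sq (Suc p) w z)"
proof -
  have Rc: "continuous_on A (d_z k R)" "continuous_on A (d_zbar j (d_z k R))" for A k j
    by (intro smooth_continuous_on smooth_d_z smooth_R)+
  have "\<exists>B. \<forall>z\<in>closure \<Omega>. cmod (d_z k R z) \<le> B" for k
    by (rule continuous_bound[OF Rc(1)]) blast
  then obtain B1 where B1: "\<And>k z. z \<in> closure \<Omega> \<Longrightarrow> cmod (d_z k R z) \<le> B1 k" by metis
  have "\<exists>B. \<forall>z\<in>closure \<Omega>. cmod (d_zbar j (d_z k R) z) \<le> B" for j k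
    by (rule continuous_bound[OF Rc(2)]) blast
  then obtain B2 where B2: "\<And>j k z. z \<in> closure \<Omega> \<Longrightarrow> cmod (d_zbar j (d_z k R) z) \<le> B2 j k" by metis
  define B where "B = (\<Sum>k\<in>UNIV. \<bar>B1 k\<bar>) + (\<Sum>j\<in>UNIV. \<Sum>k\<in>UNIV. \<bar>B2 j k\<bar>)"
  have s1: "0 \<le> (\<Sum>k\<in>UNIV. \<bar>B1 k\<bar>)" "0 \<le> (\<Sum>j\<in>UNIV. \<Sum>k\<in>UNIV. \<bar>B2 j k\<bar>)" by (intro sum_nonneg; simp)+
  have B: "B \<ge> 0" "\<And>k z. z \<in> closure \<Omega> \<Longrightarrow> cmod (d_z k R z) \<le> B" "\<And>j k z. z \<in> closure \<Omega> \<Longrightarrow> cmod (d_zbar j (d_z k R) z) \<le> B"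
  proof -
    show "B \<ge> 0" using s1 unfolding B_def by linarith
    show "cmod (d_z k R z) \<le> B" if "z \<in> closure \<Omega>" for k z
    proof -
      have "\<bar>B1 k\<bar> \<le> (\<Sum>k\<in>UNIV. \<bar>B1 k\<bar>)" by (rule member_le_sum) auto
      then show ?thesis using B1[OF that, of k] s1 unfolding B_def by linarith
    qed
    show "cmod (d_zbar j (d_z k R) z) \<le> B" if "z \<in> closure \<Omega>" for j k z
    proof -
      have "\<bar>B2 j k\<bar> \<le> (\<Sum>k\<in>UNIV. \<bar>B2 j k\<bar>)" by (rule member_le_sum) auto
      also have "\<dots> \<le> (\<Sum>j\<in>UNIV. \<Sum>k\<in>UNIV. \<bar>B2 j k\<bar>)"
        by (rule member_le_sum[of j UNIV "\<lambda>j. \<Sum>k\<in>UNIV. \<bar>B2 j k\<bar>"]) (auto intro: sum_nonneg)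
      finally show ?thesis using B2[OF that, of j k] s1 unfolding B_def by linarith
    qed
  qed
  define n where "n = real CARD('n)"
  have n: "1 \<le> n" by (simp add: n_def Suc_leI)
  \<comment> \<open>One factor n comes from Cauchy--Schwarz over the contraction index, the other
    from the sum over derivatives; p + 1 counts how often a coefficient occurs in contractions. The
    final 1 ensures positivity.\<close>
  define C where "C = 5 * B\<^sup>2 * n\<^sup>2 * real (Suc p) + 1"
  have "C > 0" unfolding C_def by (intro add_nonneg_pos mult_nonneg_nonneg) auto
  moreover have "(\<Sum>K | card K = p. (cmod (normal_part w K z))\<^sup>2 + 2 * (\<Sum>k\<in>UNIV. (cmod (d_zbar k (normal_part w K) z))\<^sup>2))
      \<le> C * (grad_sq p w z + norm_sq (Suc p) w z)" if w: "\<And>S. smooth (w S)" and z: "z \<in> closure \<Omega>" for w z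
  proof -
    let ?c = "\<lambda>j K. (cmod (con w j K z))\<^sup>2" and ?d = "\<lambda>k j K. (cmod (d_zbar k (con w j K) z))\<^sup>2"
    have b1: "(cmod (normal_part w K z))\<^sup>2 \<le> B\<^sup>2 * n * (\<Sum>j\<in>UNIV. ?c j K)" for K
    proof -
      have "cmod (normal_part w K z) \<le> (\<Sum>j\<in>UNIV. B * cmod (con w j K z))"
        unfolding normal_part_def
        by (rule order_trans[OF norm_sum]) (auto simp: norm_mult intro!: sum_mono mult_right_mono B(2)[OF z])
      then have "(cmod (normal_part w K z))\<^sup>2 \<le> (\<Sum>j\<in>UNIV. B * cmod (con w j K z))\<^sup>2" by (intro power_mono) auto
      also have "\<dots> \<le> (\<Sum>j\<in>UNIV. (B * cmod (con w j K z))\<^sup>2) * n"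
        unfolding n_def by (rule sum_squared_le_sum_of_squares)
      also have "\<dots> = B\<^sup>2 * n * (\<Sum>j\<in>UNIV. ?c j K)" by (simp add: power_mult_distrib sum_distrib_left mult_ac)
      finally show ?thesis .
    qed
    have b2: "(cmod (d_zbar k (normal_part w K) z))\<^sup>2 \<le> 2 * B\<^sup>2 * n * ((\<Sum>j\<in>UNIV. ?d k j K) + (\<Sum>j\<in>UNIV. ?c j K))" for k K
    proof -
      have dd: "d_z j R differentiable (at z)" "con w j K differentiable (at z)" for j
        by (intro smooth_differentiable smooth_d_z smooth_R smooth_con w)+
      have "d_zbar k (normal_part w K) z = (\<Sum>j\<in>UNIV. d_zbar k (\<lambda>z. d_z j R z * con w j K z) z)"
        unfolding normal_part_def[abs_def] by (rule d_z_sum(2)) (auto intro: differentiable_mult dd)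
      also have "\<dots> = (\<Sum>j\<in>UNIV. d_z j R z * d_zbar k (con w j K) z + d_zbar k (d_z j R) z * con w j K z)"
        by (simp add: d_z_mult(2)[OF dd])
      finally have "cmod (d_zbar k (normal_part w K) z) \<le> (\<Sum>j\<in>UNIV. cmod (d_z j R z * d_zbar k (con w j K) z + d_zbar k (d_z j R) z * con w j K z))"
        by (simp only: norm_sum)
      also have "\<dots> \<le> (\<Sum>j\<in>UNIV. B * cmod (d_zbar k (con w j K) z) + B * cmod (con w j K z))"
      proof (rule sum_mono)
        fix j
        have "cmod (d_z j R z * d_zbar k (con w j K) z + d_zbar k (d_z j R) z * con w j K z)
          \<le> cmod (d_z j R z) * cmod (d_zbar k (con w j K) z) + cmod (d_zbar k (d_z j R) z) * cmod (con w j K z)"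
          using norm_triangle_ineq[of "d_z j R z * d_zbar k (con w j K) z" "d_zbar k (d_z j R) z * con w j K z"] by (simp only: norm_mult)
        also have "\<dots> \<le> B * cmod (d_zbar k (con w j K) z) + B * cmod (con w j K z)"
          by (intro add_mono mult_right_mono B z) auto
        finally show "cmod (d_z j R z * d_zbar k (con w j K) z + d_zbar k (d_z j R) z * con w j K z)
          \<le> B * cmod (d_zbar k (con w j K) z) + B * cmod (con w j K z)" .
      qed
      finally have "(cmod (d_zbar k (normal_part w K) z))\<^sup>2 \<le> (\<Sum>j\<in>UNIV. B * cmod (d_zbar k (con w j K) z) + B * cmod (con w j K z))\<^sup>2"
        by (intro power_mono) auto
      also have "\<dots> \<le> (\<Sum>j\<in>UNIV. (B * cmod (d_zbar k (con w j K) z) + B * cmod (con w j K z))\<^sup>2) * n"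
        unfolding n_def by (rule sum_squared_le_sum_of_squares)
      also have "\<dots> \<le> (\<Sum>j\<in>UNIV. 2 * B\<^sup>2 * (?d k j K + ?c j K)) * n"
      proof (intro mult_right_mono sum_mono)
        fix j
        have "(B * cmod (d_zbar k (con w j K) z) + B * cmod (con w j K z))\<^sup>2 = B\<^sup>2 * (?d k j K + ?c j K + 2 * (cmod (d_zbar k (con w j K) z) * cmod (con w j K z)))"
          by (simp add: power2_eq_square algebra_simps)
        also have "\<dots> \<le> B\<^sup>2 * (?d k j K + ?c j K + (?d k j K + ?c j K))"
          by (intro mult_left_mono add_left_mono two_mult_norm_le) auto
        finally show "(B * cmod (d_zbar k (con w j K) z) + B * cmod (con w j K z))\<^sup>2 \<le> 2 * B\<^sup>2 * (?d k j K + ?c j K)" by (simp add: algebra_simps)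
      qed (use n in simp)
      also have "\<dots> = 2 * B\<^sup>2 * n * ((\<Sum>j\<in>UNIV. ?d k j K) + (\<Sum>j\<in>UNIV. ?c j K))"
        unfolding sum_distrib_left[symmetric] sum.distrib[symmetric] by (simp only: mult_ac)
      finally show ?thesis .
    qed
    have cs: "(\<Sum>K | card K = p. \<Sum>j\<in>UNIV. ?c j K) = real (Suc p) * norm_sq (Suc p) w z"
      unfolding con_def norm_sq_def by (rule contraction_norm_sum)
    have ds: "(\<Sum>K | card K = p. \<Sum>k\<in>UNIV. \<Sum>j\<in>UNIV. ?d k j K) = real (Suc p) * grad_sq p w z"
    proof -
      have "(\<Sum>K | card K = p. \<Sum>k\<in>UNIV. \<Sum>j\<in>UNIV. ?d k j K) = (\<Sum>k\<in>UNIV. \<Sum>K | card K = p. \<Sum>j\<in>UNIV. ?d k j K)" by (rule sum.swap)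
      also have "\<dots> = (\<Sum>k\<in>UNIV. real (Suc p) * (\<Sum>J | card J = Suc p. (cmod (d_zbar k (w J) z))\<^sup>2))"
        unfolding d_zbar_con[OF w, symmetric] by (intro sum.cong refl contraction_norm_sum)
      finally show ?thesis by (simp only: grad_sq_def sum_distrib_left)
    qed
    have "(\<Sum>K | card K = p. (cmod (normal_part w K z))\<^sup>2 + 2 * (\<Sum>k\<in>UNIV. (cmod (d_zbar k (normal_part w K) z))\<^sup>2))
      \<le> (\<Sum>K | card K = p. B\<^sup>2 * n * (\<Sum>j\<in>UNIV. ?c j K) + 2 * (\<Sum>k\<in>UNIV. 2 * B\<^sup>2 * n * ((\<Sum>j\<in>UNIV. ?d k j K) + (\<Sum>j\<in>UNIV. ?c j K))))"
      by (intro sum_mono add_mono mult_left_mono b1 b2) auto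
    also have "\<dots> = (\<Sum>K | card K = p. B\<^sup>2 * n * (\<Sum>j\<in>UNIV. ?c j K) + 4 * B\<^sup>2 * n * ((\<Sum>k\<in>UNIV. \<Sum>j\<in>UNIV. ?d k j K) + n * (\<Sum>j\<in>UNIV. ?c j K)))"
    proof (intro sum.cong refl arg_cong2[where f="(+)"])
      fix K
      show "2 * (\<Sum>k\<in>UNIV. 2 * B\<^sup>2 * n * ((\<Sum>j\<in>UNIV. ?d k j K) + (\<Sum>j\<in>UNIV. ?c j K)))
        = 4 * B\<^sup>2 * n * ((\<Sum>k\<in>UNIV. \<Sum>j\<in>UNIV. ?d k j K) + n * (\<Sum>j\<in>UNIV. ?c j K))"
        unfolding sum_distrib_left[symmetric] sum.distrib by (simp add: n_def)
    qed
    also have "\<dots> = B\<^sup>2 * n * (real (Suc p) * norm_sq (Suc p) w z) + 4 * B\<^sup>2 * n * (real (Suc p) * grad_sq p w z + n * (real (Suc p) * norm_sq (Suc p) w z))"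
      unfolding cs[symmetric] ds[symmetric] by (simp only: sum.distrib sum_distrib_left[symmetric])
    also have "\<dots> = B\<^sup>2 * n * real (Suc p) * (norm_sq (Suc p) w z + 4 * grad_sq p w z + 4 * n * norm_sq (Suc p) w z)"
      by (simp add: algebra_simps)
    also have "\<dots> \<le> B\<^sup>2 * n * real (Suc p) * (5 * n * (grad_sq p w z + norm_sq (Suc p) w z))"
    proof (rule mult_left_mono)
      have "1 * norm_sq (Suc p) w z \<le> n * norm_sq (Suc p) w z" "1 * grad_sq p w z \<le> n * grad_sq p w z"
        using n norm_sq_nonneg by (intro mult_right_mono; simp)+
      moreover have "0 \<le> n * grad_sq p w z" using n norm_sq_nonneg by simp
      ultimately show "norm_sq (Suc p) w z + 4 * grad_sq p w z + 4 * n * norm_sq (Suc p) w z \<le> 5 * n * (grad_sq p w z + norm_sq (Suc p) w z)"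
        by (simp add: algebra_simps)
    qed (use n in simp)
    also have "\<dots> = (C - 1) * (grad_sq p w z + norm_sq (Suc p) w z)"
      by (simp add: C_def power2_eq_square)
    also have "\<dots> \<le> C * (grad_sq p w z + norm_sq (Suc p) w z)"
      using norm_sq_nonneg by (intro mult_right_mono add_nonneg_nonneg) auto
    finally show ?thesis .
  qed
  ultimately show ?thesis by (intro that[of C]) blast+
qed

text \<open>Hardy's inequality for each component of the normal part, which vanishes on the
  boundary, followed by the bound for its derivatives and the basic estimate. The constant is
  obtained before the form, hence does not depend on it.\<close>

lemma unweighted_estimate:
  assumes p: "Suc p \<le> CARD('n)"
    and psh: "\<And>z. z \<in> closure \<Omega> \<Longrightarrow> any_q_eigenvalues_sum_nonneg (Suc p) (complex_hessian \<rho> z)"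
  obtains C where "C > 0" "\<And>u w. extends p u w \<Longrightarrow>
    set_integrable lborel \<Omega> (\<lambda>z. (- \<rho> z) powr (- 2) * norm_sq p (normal_part w) z) \<and>
    (LINT z:\<Omega>|lborel. (- \<rho> z) powr (- 2) * norm_sq p (normal_part w) z)
      \<le> C * (LINT z:\<Omega>|lborel. dbar_sq p w z + norm_sq p (divergence w) z)"
proof -
  obtain CH where CH: "CH > 0" "\<forall>v. smooth v \<and> (\<forall>x\<in>frontier \<Omega>. v x = 0) \<longrightarrow>
    set_integrable lborel \<Omega> (\<lambda>z. (- \<rho> z) powr (- 2) * (cmod (v z))\<^sup>2) \<and>
    (LINT z:\<Omega>|lborel. (- \<rho> z) powr (- 2) * (cmod (v z))\<^sup>2)
      \<le> CH * (LINT z:\<Omega>|lborel. (cmod (v z))\<^sup>2 + 2 * (\<Sum>k\<in>UNIV. (cmod (d_zbar k v z))\<^sup>2))"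
    by (rule hardy) (rule that)
  obtain CN where CN: "CN > 0" "\<forall>w z. (\<forall>S. smooth (w S)) \<and> z \<in> closure \<Omega> \<longrightarrow>
    (\<Sum>K | card K = p. (cmod (normal_part w K z))\<^sup>2 + 2 * (\<Sum>k\<in>UNIV. (cmod (d_zbar k (normal_part w K) z))\<^sup>2))
      \<le> CN * (grad_sq p w z + norm_sq (Suc p) w z)"
    by (rule normal_part_bound) (rule that)
  obtain M where M: "M \<ge> 1" "\<And>z. z \<in> closure \<Omega> \<Longrightarrow> (norm z)\<^sup>2 + 1 \<le> M"
  proof -
    have "continuous_on (closure \<Omega>) (\<lambda>z. (norm z)\<^sup>2 + 1)" by (intro continuous_intros)
    then obtain B where B: "B \<ge> 0" "\<And>z. z \<in> closure \<Omega> \<Longrightarrow> norm ((norm z)\<^sup>2 + 1) \<le> B"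
      by (rule continuous_bound) (rule that)
    have "(norm z)\<^sup>2 + 1 \<le> B + 1" if "z \<in> closure \<Omega>" for z using B(2)[OF that] by simp
    then show ?thesis using B(1) by (intro that[of "B + 1"]) auto
  qed
  \<comment> \<open>The 2 compensates for the factor 1/2 in front of the square norm of u in the
    basic estimate, where the constant is 3 M.\<close>
  define C where "C = CH * CN * (2 * (3 * M))"
  have "C > 0" using CH CN M by (simp add: C_def)
  moreover have "set_integrable lborel \<Omega> (\<lambda>z. (- \<rho> z) powr (- 2) * norm_sq p (normal_part w) z) \<and>
    (LINT z:\<Omega>|lborel. (- \<rho> z) powr (- 2) * norm_sq p (normal_part w) z)
      \<le> C * (LINT z:\<Omega>|lborel. dbar_sq p w z + norm_sq p (divergence w) z)" if u: "extends p u w" for u w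
  proof -
    have w: "smooth (w S)" for S using u by (simp add: extends_def)
    have sN: "smooth (normal_part w K)" for K by (rule smooth_normal_part[OF w])
    have Nc: "continuous_on A (normal_part w K)" "continuous_on A (d_zbar k (normal_part w K))" for A k K
      by (intro smooth_continuous_on smooth_d_z sN)+
    have H: "set_integrable lborel \<Omega> (\<lambda>z. (- \<rho> z) powr (- 2) * (cmod (normal_part w K z))\<^sup>2)"
      "(LINT z:\<Omega>|lborel. (- \<rho> z) powr (- 2) * (cmod (normal_part w K z))\<^sup>2)
      \<le> CH * (LINT z:\<Omega>|lborel. (cmod (normal_part w K z))\<^sup>2 + 2 * (\<Sum>k\<in>UNIV. (cmod (d_zbar k (normal_part w K) z))\<^sup>2))"
      if "card K = p" for K
      using CH(2) sN normal_part_frontier[OF u that] by blast+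
    have eq: "(\<lambda>z. (- \<rho> z) powr (- 2) * norm_sq p (normal_part w) z) = (\<lambda>z. \<Sum>K | card K = p. (- \<rho> z) powr (- 2) * (cmod (normal_part w K z))\<^sup>2)"
      by (simp add: norm_sq_def sum_distrib_left)
    have "set_integrable lborel \<Omega> (\<lambda>z. (- \<rho> z) powr (- 2) * norm_sq p (normal_part w) z)"
      unfolding eq by (intro set_integrable_sum H(1)) simp
    moreover have "(LINT z:\<Omega>|lborel. (- \<rho> z) powr (- 2) * norm_sq p (normal_part w) z)
      \<le> C * (LINT z:\<Omega>|lborel. dbar_sq p w z + norm_sq p (divergence w) z)"
    proof -
      have "(LINT z:\<Omega>|lborel. (- \<rho> z) powr (- 2) * norm_sq p (normal_part w) z) =
         (\<Sum>K | card K = p. LINT z:\<Omega>|lborel. (- \<rho> z) powr (- 2) * (cmod (normal_part w K z))\<^sup>2)"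
        unfolding eq by (intro set_lebesgue_integral_sum H(1)) simp
      also have "\<dots> \<le> (\<Sum>K | card K = p. CH * (LINT z:\<Omega>|lborel. (cmod (normal_part w K z))\<^sup>2 + 2 * (\<Sum>k\<in>UNIV. (cmod (d_zbar k (normal_part w K) z))\<^sup>2)))"
        by (intro sum_mono H(2)) simp
      also have "\<dots> = CH * (LINT z:\<Omega>|lborel. \<Sum>K | card K = p. (cmod (normal_part w K z))\<^sup>2 + 2 * (\<Sum>k\<in>UNIV. (cmod (d_zbar k (normal_part w K) z))\<^sup>2))"
        by (subst set_lebesgue_integral_sum, (intro int_cont continuous_intros Nc)[1]) (simp add: sum_distrib_left)
      also have "\<dots> \<le> CH * (LINT z:\<Omega>|lborel. CN * (2 * (grad_sq p w z + norm_sq (Suc p) w z / 2)))"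
      proof (intro mult_left_mono set_integral_mono)
        fix z assume "z \<in> \<Omega>"
        have "(\<Sum>K | card K = p. (cmod (normal_part w K z))\<^sup>2 + 2 * (\<Sum>k\<in>UNIV. (cmod (d_zbar k (normal_part w K) z))\<^sup>2))
          \<le> CN * (grad_sq p w z + norm_sq (Suc p) w z)" using CN(2) w domain_subset_closure[OF \<open>z \<in> \<Omega>\<close>] by blast
        also have "\<dots> \<le> CN * (2 * (grad_sq p w z + norm_sq (Suc p) w z / 2))"
          using CN(1) norm_sq_nonneg(2)[of p w z] by (intro mult_left_mono) auto
        finally show "(\<Sum>K | card K = p. (cmod (normal_part w K z))\<^sup>2 + 2 * (\<Sum>k\<in>UNIV. (cmod (d_zbar k (normal_part w K) z))\<^sup>2))
          \<le> CN * (2 * (grad_sq p w z + norm_sq (Suc p) w z / 2))" .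
      qed (use CH in \<open>auto intro!: int_cont continuous_intros Nc continuous_norm_sq w\<close>)
      also have "\<dots> = CH * CN * 2 * (LINT z:\<Omega>|lborel. grad_sq p w z + norm_sq (Suc p) w z / 2)"
        by (simp only: set_integral_mult_right mult.assoc)
      also have "\<dots> \<le> CH * CN * 2 * (3 * M * (LINT z:\<Omega>|lborel. dbar_sq p w z + norm_sq p (divergence w) z))"
        using CH CN by (intro mult_left_mono basic_estimate[OF u p psh M]) auto
      finally show ?thesis by (simp add: C_def mult.assoc)
    qed
    ultimately show ?thesis by blast
  qed
  ultimately show ?thesis by (rule that)
qed

lemma normal_part_estimate:
  assumes p: "Suc p \<le> CARD('n)" and s: "0 \<le> s" "s < 1"
    and psh: "\<And>z. z \<in> closure \<Omega> \<Longrightarrow> any_q_eigenvalues_sum_nonneg (Suc p) (complex_hessian \<rho> z)"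
  obtains C where "C > 0" "\<And>u w. extends p u w \<Longrightarrow>
    set_integrable lborel \<Omega> (\<lambda>z. (- \<rho> z) powr (- 2 + s) * norm_sq p (normal_part w) z) \<and>
    (LINT z:\<Omega>|lborel. (- \<rho> z) powr (- 2 + s) * norm_sq p (normal_part w) z)
      \<le> C * (LINT z:\<Omega>|lborel. (- \<rho> z) powr s * (dbar_sq p w z + norm_sq p (divergence w) z))"
proof (cases "s = 0")
  case True
  \<comment> \<open>\<open>x powr 0\<close> is 1 only for nonzero x; on the domain \<rho> < 0, so
    the weight may be removed.\<close>
  have one: "(LINT z:\<Omega>|lborel. (- \<rho> z) powr s * (dbar_sq p w z + norm_sq p (divergence w) z)) =
     (LINT z:\<Omega>|lborel. dbar_sq p w z + norm_sq p (divergence w) z)" for w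
    by (rule set_lebesgue_integral_cong') (use True rho_neg in force)
  show ?thesis
    by (rule unweighted_estimate[OF p psh]) (use that True one in auto)
next
  case False
  then have s0: "0 < s" using s by simp
  define \<kappa> where "\<kappa> = s * (1 - s) / 2"
  have \<kappa>: "\<kappa> > 0" using s s0 by (simp add: \<kappa>_def)
  define C where "C = (1 + 2 * s / (1 - s)) / \<kappa>"
  have "C > 0" using s s0 \<kappa> by (auto simp: C_def intro!: divide_pos_pos add_pos_nonneg)
  moreover have "set_integrable lborel \<Omega> (\<lambda>z. (- \<rho> z) powr (- 2 + s) * norm_sq p (normal_part w) z) \<and>
    (LINT z:\<Omega>|lborel. (- \<rho> z) powr (- 2 + s) * norm_sq p (normal_part w) z)
      \<le> C * (LINT z:\<Omega>|lborel. (- \<rho> z) powr s * (dbar_sq p w z + norm_sq p (divergence w) z))" if u: "extends p u w" for u w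
  proof -
    have ss: "- 2 + s = s - 2" by simp
    note W = weighted_estimate[OF s0 s(2) u p psh, folded \<kappa>_def]
    have "set_integrable lborel \<Omega> (\<lambda>z. (- \<rho> z) powr (s - 2) * norm_sq p (normal_part w) z)"
      using W(1) \<kappa> by simp
    moreover have "\<kappa> * (LINT z:\<Omega>|lborel. (- \<rho> z) powr (s - 2) * norm_sq p (normal_part w) z) \<le>
       (1 + 2 * s / (1 - s)) * (LINT z:\<Omega>|lborel. (- \<rho> z) powr s * (dbar_sq p w z + norm_sq p (divergence w) z))"
      using W(2) by simp
    then have "(LINT z:\<Omega>|lborel. (- \<rho> z) powr (s - 2) * norm_sq p (normal_part w) z) \<le>
       C * (LINT z:\<Omega>|lborel. (- \<rho> z) powr s * (dbar_sq p w z + norm_sq p (divergence w) z))"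
      unfolding C_def using \<kappa> by (simp add: field_simps)
    ultimately show ?thesis unfolding ss by blast
  qed
  ultimately show ?thesis by (rule that)
qed

section \<open>Return to the chosen representatives and the weighted inner products\<close>

lemma set_borel_measurable_scale:
  fixes h f :: "(complex, 'n) vec \<Rightarrow> 'b::{second_countable_topology,real_normed_field}"
  assumes "h \<in> borel_measurable borel" "set_borel_measurable lborel \<Omega> f"
  shows "set_borel_measurable lborel \<Omega> (\<lambda>z. h z * f z)"
proof -
  have eq: "(\<lambda>z. indicat_real \<Omega> z *\<^sub>R (h z * f z)) = (\<lambda>z. h z * (indicat_real \<Omega> z *\<^sub>R f z))" by auto
  have "h \<in> borel_measurable lborel" using assms(1) by simp
  from borel_measurable_times[OF this assms(2)[unfolded set_borel_measurable_def]]
  show ?thesis unfolding set_borel_measurable_def eq .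
qed

lemma set_borel_measurable_sum:
  fixes f :: "'i \<Rightarrow> (complex, 'n) vec \<Rightarrow> 'b::{second_countable_topology,real_normed_vector}"
  assumes "\<And>i. i \<in> I \<Longrightarrow> set_borel_measurable lborel \<Omega> (f i)"
  shows "set_borel_measurable lborel \<Omega> (\<lambda>z. \<Sum>i\<in>I. f i z)"
  using assms unfolding set_borel_measurable_def scaleR_sum_right by (intro borel_measurable_sum)

lemma rho_powr_measurable: "(\<lambda>z. (- \<rho> z) powr r) \<in> borel_measurable borel"
  using borel_measurable_continuous_onI[OF rho_continuous] by measurable

lemma dbar_star_sq_integrable:
  assumes "extends p u w" "card K = p"
  shows "sq_integrable_on \<Omega> (dbar_star \<Omega> (Suc p) u (sorted_list_of_set K))"
  using dbar_star_works[OF assms(1)] assms(2) by (simp add: is_dbar_star_sets)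

lemma set_integral_cong_AE':
  fixes f g :: "(complex, 'n) vec \<Rightarrow> 'b::{banach,second_countable_topology}"
  assumes "set_borel_measurable lborel \<Omega> f" "set_borel_measurable lborel \<Omega> g"
    and "AE z in lborel. z \<in> \<Omega> \<longrightarrow> f z = g z"
  shows "(LINT z:\<Omega>|lborel. f z) = (LINT z:\<Omega>|lborel. g z)"
    "set_integrable lborel \<Omega> f \<longleftrightarrow> set_integrable lborel \<Omega> g"
proof -
  have "AE z in lborel. indicat_real \<Omega> z *\<^sub>R f z = indicat_real \<Omega> z *\<^sub>R g z"
    using assms(3) by eventually_elim (auto simp: indicator_def)
  note A = assms(1,2)[unfolded set_borel_measurable_def] this
  show "(LINT z:\<Omega>|lborel. f z) = (LINT z:\<Omega>|lborel. g z)"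
    unfolding set_lebesgue_integral_def by (rule integral_cong_AE[OF A])
  show "set_integrable lborel \<Omega> f \<longleftrightarrow> set_integrable lborel \<Omega> g"
    unfolding set_integrable_def by (rule integrable_cong_AE[OF A])
qed

text \<open>For s = 0 the weight is 1 inside but 0 on the frontier, as \<open>0 powr 0 = 0\<close>,
  and so not continuous on the closure; for s > 0 it is continuous there.\<close>

lemma powr_integrable:
  assumes "0 \<le> s" "continuous_on (closure \<Omega>) f"
  shows "set_integrable lborel \<Omega> (\<lambda>z. (- \<rho> z) powr s * f z)"
proof (cases "s = 0")
  case True
  show ?thesis by (rule set_integrable_cong'[OF _ int_cont[OF assms(2)]]) (use True rho_neg in force)
next
  case False
  have "continuous_on (closure \<Omega>) (\<lambda>z. (- \<rho> z) powr s)"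
    using assms False by (intro continuous_on_powr' continuous_intros rho_continuous) (auto dest: rho_closure)
  then show ?thesis by (intro int_cont continuous_on_mult assms(2))
qed

text \<open>Equality holds only almost everywhere, so measurability of the chosen representative is
  also required; it comes from square integrability of the two adjoint forms in the
  commutator.\<close>

lemma commutator_integral:
  assumes u: "extends p u w"
  shows "(LINT z:\<Omega>|lborel. (- \<rho> z) powr r * form_norm_sq p (dbar_star_commutator \<Omega> (Suc p) \<rho> u) z)
      = (LINT z:\<Omega>|lborel. (- \<rho> z) powr r * norm_sq p (normal_part w) z)"
    "set_integrable lborel \<Omega> (\<lambda>z. (- \<rho> z) powr r * form_norm_sq p (dbar_star_commutator \<Omega> (Suc p) \<rho> u) z)
      \<longleftrightarrow> set_integrable lborel \<Omega> (\<lambda>z. (- \<rho> z) powr r * norm_sq p (normal_part w) z)"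
proof -
  let ?c = "dbar_star_commutator \<Omega> (Suc p) \<rho> u"
  have w: "smooth (w S)" for S using u by (simp add: extends_def)
  have c: "sq_integrable_on \<Omega> (?c (sorted_list_of_set K))" if "card K = p" for K
  proof -
    have "sq_integrable_on \<Omega> (\<lambda>z. dbar_star \<Omega> (Suc p) (mult_form \<rho> u) (sorted_list_of_set K) z
        + (- R z) * dbar_star \<Omega> (Suc p) u (sorted_list_of_set K) z)"
      by (intro sq_integrable_add sq_int_mult_cont dbar_star_sq_integrable[OF extends_mult_R[OF u]]
          dbar_star_sq_integrable[OF u] that continuous_intros smooth_continuous_on smooth_R)
    then show ?thesis by (simp add: dbar_star_commutator_def[abs_def] mult_form_def)
  qed
  have m1: "set_borel_measurable lborel \<Omega> (\<lambda>z. (- \<rho> z) powr r * form_norm_sq p ?c z)"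
    unfolding form_norm_sq_def sum_increasing
    using c by (intro set_borel_measurable_scale rho_powr_measurable set_borel_measurable_sum set_borel_measurable_norm_sq)
      (auto simp: sq_integrable_on_def)
  have m2: "set_borel_measurable lborel \<Omega> (\<lambda>z. (- \<rho> z) powr r * norm_sq p (normal_part w) z)"
    unfolding norm_sq_def
    using sq_int_cont[OF smooth_continuous_on[OF smooth_normal_part[OF w]]]
    by (intro set_borel_measurable_scale rho_powr_measurable set_borel_measurable_sum set_borel_measurable_norm_sq)
      (auto simp: sq_integrable_on_def)
  have "AE z in lborel. z \<in> \<Omega> \<longrightarrow> (- \<rho> z) powr r * form_norm_sq p ?c z = (- \<rho> z) powr r * norm_sq p (normal_part w) z"
    using AE_dbar_star[OF u] by eventually_elim (auto simp: form_norm_sq_def sum_increasing norm_sq_def)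
  from set_integral_cong_AE'[OF m1 m2 this]
  show "(LINT z:\<Omega>|lborel. (- \<rho> z) powr r * form_norm_sq p (dbar_star_commutator \<Omega> (Suc p) \<rho> u) z)
      = (LINT z:\<Omega>|lborel. (- \<rho> z) powr r * norm_sq p (normal_part w) z)"
    "set_integrable lborel \<Omega> (\<lambda>z. (- \<rho> z) powr r * form_norm_sq p (dbar_star_commutator \<Omega> (Suc p) \<rho> u) z)
      \<longleftrightarrow> set_integrable lborel \<Omega> (\<lambda>z. (- \<rho> z) powr r * norm_sq p (normal_part w) z)" by blast+
qed

text \<open>For dbar the integrands agree at every point of the domain, since derivatives at
  interior points see only the values that u shares with its extension; for the adjoint they agree
  almost everywhere.\<close>

lemma energy_integral:
  assumes u: "extends p u w" and s: "0 \<le> s"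
  shows "Re (L2_inner \<Omega> (Suc (Suc p)) (mult_form (\<lambda>z. (- \<rho> z) powr s) (dbar u)) (dbar u))
      + Re (L2_inner \<Omega> p (mult_form (\<lambda>z. (- \<rho> z) powr s) (dbar_star \<Omega> (Suc p) u)) (dbar_star \<Omega> (Suc p) u))
    = (LINT z:\<Omega>|lborel. (- \<rho> z) powr s * (dbar_sq p w z + norm_sq p (divergence w) z))"
proof -
  let ?v = "dbar_star \<Omega> (Suc p) u"
  have w: "smooth (w S)" for S using u by (simp add: extends_def)
  have sq: "(\<Sum>K\<in>A. complex_of_real h * f K * cnj (f K)) = complex_of_real (h * (\<Sum>K\<in>A. (cmod (f K))\<^sup>2))"
    for A :: "'n set set" and h f
    by (simp add: complex_norm_square sum_distrib_left mult.assoc del: of_real_power)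
  have "L2_inner \<Omega> (Suc (Suc p)) (mult_form (\<lambda>z. (- \<rho> z) powr s) (dbar u)) (dbar u)
    = (LINT z:\<Omega>|lborel. complex_of_real ((- \<rho> z) powr s * dbar_sq p w z))"
    unfolding L2_inner_def
  proof (rule set_lebesgue_integral_cong')
    fix z assume z: "z \<in> \<Omega>"
    have "dbar u (sorted_list_of_set L) z = wedge (\<lambda>k J. d_zbar k (w J) z) L" if L: "card L = Suc (Suc p)" for L
    proof -
      have "d_zbar k (u (sorted_list_of_set (L - {k}))) z = d_zbar k (w (L - {k})) z" if "k \<in> L" for k
        by (rule d_z_cong(2)[OF open_domain z])
          (use u L that domain_subset_closure in \<open>auto simp: extends_def\<close>)
      then show ?thesis unfolding dbar_sorted_list wedge_def by (intro sum.cong refl) simp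
    qed
    then show "(\<Sum>J\<in>increasing (Suc (Suc p)). mult_form (\<lambda>z. (- \<rho> z) powr s) (dbar u) J z * cnj (dbar u J z))
       = complex_of_real ((- \<rho> z) powr s * dbar_sq p w z)"
      unfolding sum_increasing mult_form_def dbar_sq_def sq[symmetric] by (intro sum.cong refl) simp
  qed
  then have 1: "Re (L2_inner \<Omega> (Suc (Suc p)) (mult_form (\<lambda>z. (- \<rho> z) powr s) (dbar u)) (dbar u))
    = (LINT z:\<Omega>|lborel. (- \<rho> z) powr s * dbar_sq p w z)"
    unfolding set_integral_complex_of_real by simp
  have hm: "(\<lambda>z. complex_of_real ((- \<rho> z) powr s)) \<in> borel_measurable borel"
    using rho_powr_measurable by measurable
  have "L2_inner \<Omega> p (mult_form (\<lambda>z. (- \<rho> z) powr s) ?v) ?v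
    = (LINT z:\<Omega>|lborel. complex_of_real ((- \<rho> z) powr s * norm_sq p (divergence w) z))"
    unfolding L2_inner_def sum_increasing mult_form_def
  proof (rule set_integral_cong_AE'(1))
    show "set_borel_measurable lborel \<Omega> (\<lambda>z. \<Sum>S | card S = p. complex_of_real ((- \<rho> z) powr s) * ?v (sorted_list_of_set S) z * cnj (?v (sorted_list_of_set S) z))"
      unfolding mult.assoc
      using dbar_star_sq_integrable[OF u] sq_integrable_cnj[OF dbar_star_sq_integrable[OF u]]
      by (intro set_borel_measurable_sum set_borel_measurable_scale hm set_borel_measurable_mult)
        (auto simp: sq_integrable_on_def)
    have "set_borel_measurable lborel \<Omega> (\<lambda>z. complex_of_real (norm_sq p (divergence w) z))"
    proof -
      have "continuous_on (closure \<Omega>) (\<lambda>z. complex_of_real (norm_sq p (divergence w) z))"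
        by (intro continuous_on_of_real continuous_norm_sq smooth_divergence w)
      from borel_measurable_integrable[OF int_cont[OF this, unfolded set_integrable_def]]
      show ?thesis unfolding set_borel_measurable_def .
    qed
    then show "set_borel_measurable lborel \<Omega> (\<lambda>z. complex_of_real ((- \<rho> z) powr s * norm_sq p (divergence w) z))"
      unfolding of_real_mult by (intro set_borel_measurable_scale hm)
    show "AE z in lborel. z \<in> \<Omega> \<longrightarrow> (\<Sum>S | card S = p. complex_of_real ((- \<rho> z) powr s) * ?v (sorted_list_of_set S) z * cnj (?v (sorted_list_of_set S) z))
        = complex_of_real ((- \<rho> z) powr s * norm_sq p (divergence w) z)"
      using AE_dbar_star[OF u] unfolding norm_sq_def sq[symmetric] by eventually_elim auto
  qed
  then have 2: "Re (L2_inner \<Omega> p (mult_form (\<lambda>z. (- \<rho> z) powr s) ?v) ?v)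
    = (LINT z:\<Omega>|lborel. (- \<rho> z) powr s * norm_sq p (divergence w) z)"
    unfolding set_integral_complex_of_real by simp
  show ?thesis
    unfolding 1 2 distrib_left
    by (intro set_integral_add(2)[symmetric] powr_integrable s continuous_norm_sq smooth_divergence w)
qed

end

theorem proposition3p4:
  fixes \<Omega> :: "(complex ^ 'n::{finite,linorder}) set" and q :: nat and s :: real
    and \<rho> :: "complex ^ 'n::{finite,linorder} \<Rightarrow> real"
  assumes "smoothly_bounded_domain \<Omega>"
    and "1 \<le> q" and "q \<le> CARD('n)"
    and "defining_function \<Omega> \<rho>"
    and "\<forall>z\<in>closure \<Omega>. any_q_eigenvalues_sum_nonneg q (complex_hessian \<rho> z)"
    and "0 \<le> s" and "s < 1"
  shows "\<exists>r C. defining_function \<Omega> r \<and> 0 < C \<and>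
    (\<forall>u\<in>D_forms \<Omega> q.
       set_integrable lborel \<Omega>
         (\<lambda>z. (- r z) powr (- 2 + s) * form_norm_sq (q - 1) (dbar_star_commutator \<Omega> q r u) z) \<and>
       (LINT z:\<Omega>|lborel.
          (- r z) powr (- 2 + s) * form_norm_sq (q - 1) (dbar_star_commutator \<Omega> q r u) z)
       \<le> C * (Re (L2_inner \<Omega> (q + 1) (mult_form (\<lambda>z. (- r z) powr s) (dbar u)) (dbar u))
              + Re (L2_inner \<Omega> (q - 1)
                  (mult_form (\<lambda>z. (- r z) powr s) (dbar_star \<Omega> q u)) (dbar_star \<Omega> q u))))"
proof -
  interpret smooth_domain \<Omega> \<rho>
    using assms(1,4) by unfold_locales (auto simp: smoothly_bounded_domain_def)
  obtain p where q: "q = Suc p" using assms(2) by (cases q) auto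
  \<comment> \<open>The constant is fixed here, before any form is introduced; the forms and their
    extensions come only below.\<close>
  obtain C where C: "C > 0" "\<And>u w. extends p u w \<Longrightarrow>
    set_integrable lborel \<Omega> (\<lambda>z. (- \<rho> z) powr (- 2 + s) * norm_sq p (normal_part w) z) \<and>
    (LINT z:\<Omega>|lborel. (- \<rho> z) powr (- 2 + s) * norm_sq p (normal_part w) z)
      \<le> C * (LINT z:\<Omega>|lborel. (- \<rho> z) powr s * (dbar_sq p w z + norm_sq p (divergence w) z))"
    by (rule normal_part_estimate[of p s]) (use assms q that in auto)
  show ?thesis
  proof (intro exI[of _ \<rho>] exI[of _ C] conjI ballI)
    fix u assume "u \<in> D_forms \<Omega> q"
    then obtain w where u: "extends p u w" using D_forms_extends q by blast
    show "set_integrable lborel \<Omega> (\<lambda>z. (- \<rho> z) powr (- 2 + s) * form_norm_sq (q - 1) (dbar_star_commutator \<Omega> q \<rho> u) z)"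
      using C(2)[OF u] commutator_integral(2)[OF u] by (simp add: q)
    show "(LINT z:\<Omega>|lborel. (- \<rho> z) powr (- 2 + s) * form_norm_sq (q - 1) (dbar_star_commutator \<Omega> q \<rho> u) z)
       \<le> C * (Re (L2_inner \<Omega> (q + 1) (mult_form (\<lambda>z. (- \<rho> z) powr s) (dbar u)) (dbar u))
              + Re (L2_inner \<Omega> (q - 1) (mult_form (\<lambda>z. (- \<rho> z) powr s) (dbar_star \<Omega> q u)) (dbar_star \<Omega> q u)))"
      using C(2)[OF u] unfolding commutator_integral(1)[OF u, symmetric] energy_integral[OF u assms(6), symmetric]
      by (simp add: q)
  qed (use assms C in auto)
qed

end
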